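(* Let $K$ be a commutative hypergroup with Haar measure $\lambda$. Let $p_1,p_2\in[1,\infty)$ and $q_1,q_2\in[1,\infty]$ satisfy $\frac{1}{p_1}+\frac{1}{p_2}>1$, let $p_0$ be defined by $\frac{1}{p_0}=\frac{1}{p_1}+\frac{1}{p_2}-1$, and let $q_0\in[1,\infty]$ be any number such that $\frac{1}{q_1}+\frac{1}{q_2}\ge \frac{1}{q_0}$ (with $\frac1\infty=0$). If $f\in L^{p_1,q_1}(K,\lambda)$ and $\varphi\in L^{p_2,q_2}(K,\lambda)$, then $f\ast_K\varphi\in L^{p_0,q_0}(K,\lambda)$ and $$\|f\ast_K\varphi\|_{K,p_0,q_0}\le 3p_0\,\|f\|_{K,p_1,q_1}\,\|\varphi\|_{K,p_2,q_2}.$$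
   Context: A hypergroup $(K,\ast_K)$ is a locally compact Hausdorff space $K$ together with a bilinear, associative, weakly continuous convolution $\ast_K$ on the Banach space of all bounded regular Borel measures on $K$ such that: (1) for all $x,y\in K$, $\delta_x\ast_K\delta_y$ (convolution of point measures) is a probability measure with compact support; (2) the map $(x,y)\mapsto \operatorname{supp}(\delta_x\ast_K\delta_y)$ from $K\times K$ to the space $\mathcal C(K)$ of nonvoid compact subsets of $K$ is continuous, where $\mathcal C(K)$ carries the Michael topology generated by the sets $U_{V,W}=\{L\in\mathcal C(K): L\cap V\ne\varnothing,\ L\subset W\}$ with $V,W$ open in $K$; (3) there is an identity $e\in K$ with $\delta_e\ast_K\delta_x=\delta_x\ast_K\delta_e=\delta_x$ for all $x\in K$; (4) there is a continuous involution $x\mapsto x^{\sim}$ on $K$ such that $(\delta_x\ast_K\delta_y)^{\sim}=\delta_{y^\sim}\ast_K\delta_{x^\sim}$ (where $\mu^\sim$ is the image of $\mu$ under the involution), and $e\in\operatorname{supp}(\delta_x\ast_K\delta_y)$ if and only if $x=y^\sim$. The hypergroup is commutative if $\delta_x\ast_K\delta_y=\delta_y\ast_K\delta_x$ for all $x,y\in K$. Generalized translation: $T^xf(y)=\int_K f\,d(\delta_x\ast_K\delta_y)$ for $x,y\in K$. Every commutative hypergroup has a Haar measure $\lambda$, i.e. a (nonzero, positive, Radon) measure with $\int_K T^xf(y)\,d\lambda(y)=\int_K f(y)\,d\lambda(y)$ for all $x\in K$ and Borel measurable $f$ (for which the integrals make sense). The convolution of two functions is $(f\ast_K\varphi)(x)=\int_K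 T^xf(y)\,\varphi(y^\sim)\,d\lambda(y)$. For a $\lambda$-measurable function $f$ on $K$: the distribution function is $\lambda_f(s)=\lambda\{x\in K:|f(x)|>s\}$, $s\ge0$; the non-increasing rearrangement is $f^{\ast_K}(t)=\inf\{s>0:\lambda_f(s)\le t\}$, $t\ge 0$; and $f^{\ast\ast_K}(t)=\frac1t\int_0^t f^{\ast_K}(u)\,du$, $t>0$. The Lorentz space $L^{p,q}(K,\lambda)$ is the set of $\lambda$-measurable $f$ on $K$ with $\|f\|_{K,p,q}<\infty$, where $\|f\|_{K,p,q}=\left(\int_0^\infty\left(t^{1/p}f^{\ast\ast_K}(t)\right)^q\frac{dt}{t}\right)^{1/q}$ for $1\le p<\infty$, $1\le q<\infty$, and $\|f\|_{K,p,\infty}=\sup_{t>0}t^{1/p}f^{\ast\ast_K}(t)$. *)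

theory Defs
  imports "HOL-Analysis.Analysis"
begin

text \<open>
  The hypergroup is the universe of a topological type. A complex Borel measure is a countably
  additive set function on the Borel sets, normalised to be 0 on all other sets, so that equality
  of measures is equality of functions. Such a set function is automatically bounded.
  Regularity: every Borel set lies between a compact and an open set whose difference has
  arbitrarily small variation; since the total variation of a set \<open>E\<close> is at most
  4 times the supremum of the \<open>cmod (\<mu> B)\<close> over Borel \<open>B \<subseteq> E\<close>, it suffices to control the latter.
\<close>

definition bounded_regular_measures :: "('a::t2_space set \<Rightarrow> complex) set" where
  "bounded_regular_measures = {\<mu>.
     (\<forall>A. A \<notin> sets borel \<longrightarrow> \<mu> A = 0) \<and>
     (\<forall>A :: nat \<Rightarrow> 'a set. range A \<subseteq> sets borel \<longrightarrow> disjoint_family A \<longrightarrow>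
        (\<lambda>i. \<mu> (A i)) sums \<mu> (\<Union>i. A i)) \<and>
     (\<forall>A\<in>sets borel. \<forall>\<epsilon>>0. \<exists>C U. compact C \<and> open U \<and> C \<subseteq> A \<and> A \<subseteq> U \<and>
        (\<forall>B\<in>sets borel. B \<subseteq> U - C \<longrightarrow> cmod (\<mu> B) < \<epsilon>))}"

definition positive_measures :: "('a::t2_space set \<Rightarrow> complex) set" where
  "positive_measures = {\<mu> \<in> bounded_regular_measures. \<forall>A. \<mu> A \<in> \<real>\<^sub>\<ge>\<^sub>0}"

definition to_measure :: "('a::t2_space set \<Rightarrow> complex) \<Rightarrow> 'a measure" where
  "to_measure \<mu> = measure_of UNIV (sets borel) (\<lambda>A. ennreal (Re (\<mu> A)))"

definition dirac_measure :: "'a::t2_space \<Rightarrow> 'a set \<Rightarrow> complex" where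
  "dirac_measure x = (\<lambda>A. if A \<in> sets borel \<and> x \<in> A then 1 else 0)"

definition supp_measure :: "('a::t2_space set \<Rightarrow> complex) \<Rightarrow> 'a set" where
  "supp_measure \<mu> = {x. \<forall>U. open U \<and> x \<in> U \<longrightarrow> (\<exists>B\<in>sets borel. B \<subseteq> U \<and> \<mu> B \<noteq> 0)}"

definition positive_weak_topology :: "('a::t2_space set \<Rightarrow> complex) topology" where
  "positive_weak_topology = topology_generated_by
     {{\<mu> \<in> positive_measures. (LINT z|to_measure \<mu>. f z) \<in> U} | (f :: 'a \<Rightarrow> real) U.
        continuous_on UNIV f \<and> bounded (range f) \<and> open U}"

definition michael_topology :: "'a::t2_space set topology" where
  "michael_topology = topology_generated_by
     {{L. compact L \<and> L \<noteq> {} \<and> L \<inter> V \<noteq> {} \<and> L \<subseteq> W} | V W. open V \<and> open W}"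

text \<open>
  Weak continuity of the convolution is meant as usual in the theory of hypergroups (Jewett's
  ``positive-continuous''): the convolution maps pairs of positive measures to positive measures and
  is there jointly continuous for the weak topology. Joint weak continuity on all pairs of complex
  measures would already fail for the group of integers, and separate weak continuity on all
  measures follows from the version used here.
\<close>

locale hypergroup =
  fixes conv :: "('a::t2_space set \<Rightarrow> complex) \<Rightarrow> ('a set \<Rightarrow> complex) \<Rightarrow> 'a set \<Rightarrow> complex"
    and e :: 'a
    and invol :: "'a \<Rightarrow> 'a"
  assumes locally_compact: "locally_compact_space (euclidean :: 'a topology)"
    and conv_closed: "\<lbrakk>\<mu> \<in> bounded_regular_measures; \<nu> \<in> bounded_regular_measures\<rbrakk>
          \<Longrightarrow> conv \<mu> \<nu> \<in> bounded_regular_measures"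
    and conv_linear_left: "\<lbrakk>\<mu> \<in> bounded_regular_measures; \<mu>' \<in> bounded_regular_measures;
            \<nu> \<in> bounded_regular_measures\<rbrakk>
          \<Longrightarrow> conv (\<lambda>A. a * \<mu> A + b * \<mu>' A) \<nu> = (\<lambda>A. a * conv \<mu> \<nu> A + b * conv \<mu>' \<nu> A)"
    and conv_linear_right: "\<lbrakk>\<mu> \<in> bounded_regular_measures; \<nu> \<in> bounded_regular_measures;
            \<nu>' \<in> bounded_regular_measures\<rbrakk>
          \<Longrightarrow> conv \<mu> (\<lambda>A. a * \<nu> A + b * \<nu>' A) = (\<lambda>A. a * conv \<mu> \<nu> A + b * conv \<mu> \<nu>' A)"
    and conv_assoc: "\<lbrakk>\<mu> \<in> bounded_regular_measures; \<nu> \<in> bounded_regular_measures;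
            \<kappa> \<in> bounded_regular_measures\<rbrakk>
          \<Longrightarrow> conv (conv \<mu> \<nu>) \<kappa> = conv \<mu> (conv \<nu> \<kappa>)"
    and conv_weakly_continuous:
          "continuous_map (prod_topology positive_weak_topology positive_weak_topology)
             positive_weak_topology (\<lambda>(\<mu>, \<nu>). conv \<mu> \<nu>)"
    and conv_point_prob: "conv (dirac_measure x) (dirac_measure y) \<in> positive_measures"
          "conv (dirac_measure x) (dirac_measure y) UNIV = 1"
    and conv_point_supp: "compact (supp_measure (conv (dirac_measure x) (dirac_measure y)))"
    and supp_continuous:
          "continuous_map (euclidean :: ('a \<times> 'a) topology) michael_topology
             (\<lambda>(x, y). supp_measure (conv (dirac_measure x) (dirac_measure y)))"
    and conv_identity: "conv (dirac_measure e) (dirac_measure x) = dirac_measure x"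
          "conv (dirac_measure x) (dirac_measure e) = dirac_measure x"
    and invol_continuous: "continuous_on UNIV invol"
    and invol_invol: "invol (invol x) = x"
    and conv_invol: "(\<lambda>A. conv (dirac_measure x) (dirac_measure y) (invol -` A))
          = conv (dirac_measure (invol y)) (dirac_measure (invol x))"
    and identity_in_supp:
          "e \<in> supp_measure (conv (dirac_measure x) (dirac_measure y)) \<longleftrightarrow> x = invol y"

locale commutative_hypergroup = hypergroup +
  assumes conv_commute:
    "conv (dirac_measure x) (dirac_measure y) = conv (dirac_measure y) (dirac_measure x)"

text \<open>
  Functions are only required to be measurable with respect to the completed Haar measure, so
  all integrals of such functions are taken with respect to completed measures.
\<close>

definition translation ::
  "(('a::t2_space set \<Rightarrow> complex) \<Rightarrow> ('a set \<Rightarrow> complex) \<Rightarrow> 'a set \<Rightarrow> complex)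
     \<Rightarrow> 'a \<Rightarrow> ('a \<Rightarrow> complex) \<Rightarrow> 'a \<Rightarrow> complex" where
  "translation conv x f y =
     (LINT z|completion (to_measure (conv (dirac_measure x) (dirac_measure y))). f z)"

definition radon_measure :: "'a::t2_space measure \<Rightarrow> bool" where
  "radon_measure M \<longleftrightarrow> sets M = sets borel \<and>
     (\<forall>C. compact C \<longrightarrow> emeasure M C < \<infinity>) \<and>
     (\<forall>A\<in>sets borel. emeasure M A = (INF U\<in>{U. open U \<and> A \<subseteq> U}. emeasure M U)) \<and>
     (\<forall>U. open U \<longrightarrow> emeasure M U = (SUP C\<in>{C. compact C \<and> C \<subseteq> U}. emeasure M C))"

text \<open>
  Invariance is required for integrable functions. For non-negative functions with infinite integral
  it can fail when the hypergroup is not \<open>\<sigma>\<close>-compact, because a Radon measure that is outer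
  regular on Borel sets need not be inner regular on sets of infinite measure.
\<close>

definition haar_measure ::
  "(('a::t2_space set \<Rightarrow> complex) \<Rightarrow> ('a set \<Rightarrow> complex) \<Rightarrow> 'a set \<Rightarrow> complex)
     \<Rightarrow> 'a measure \<Rightarrow> bool" where
  "haar_measure conv M \<longleftrightarrow> radon_measure M \<and> emeasure M UNIV \<noteq> 0 \<and>
     (\<forall>x (f :: 'a \<Rightarrow> complex). integrable M f \<longrightarrow>
        integrable M (translation conv x f) \<and>
        (LINT y|M. translation conv x f y) = (LINT y|M. f y))"

definition fun_conv ::
  "(('a::t2_space set \<Rightarrow> complex) \<Rightarrow> ('a set \<Rightarrow> complex) \<Rightarrow> 'a set \<Rightarrow> complex)
     \<Rightarrow> ('a \<Rightarrow> 'a) \<Rightarrow> 'a measure \<Rightarrow> ('a \<Rightarrow> complex) \<Rightarrow> ('a \<Rightarrow> complex) \<Rightarrow> 'a \<Rightarrow> complex" where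
  "fun_conv conv invol M f \<phi> x =
     (LINT y|completion M. translation conv x f y * \<phi> (invol y))"

text \<open>
  The integrals defining the convolution at a point exist. This has to be stated separately because
  the integral of a non-integrable function is 0 by convention.
\<close>

definition fun_conv_exists_at ::
  "(('a::t2_space set \<Rightarrow> complex) \<Rightarrow> ('a set \<Rightarrow> complex) \<Rightarrow> 'a set \<Rightarrow> complex)
     \<Rightarrow> ('a \<Rightarrow> 'a) \<Rightarrow> 'a measure \<Rightarrow> ('a \<Rightarrow> complex) \<Rightarrow> ('a \<Rightarrow> complex) \<Rightarrow> 'a \<Rightarrow> bool" where
  "fun_conv_exists_at conv invol M f \<phi> x \<longleftrightarrow>
     (AE y in completion M.
        integrable (completion (to_measure (conv (dirac_measure x) (dirac_measure y)))) f) \<and>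
     integrable (completion M) (\<lambda>y. translation conv x f y * \<phi> (invol y))"

definition epowr :: "ennreal \<Rightarrow> real \<Rightarrow> ennreal" where
  "epowr x r = (if x = \<infinity> then \<infinity> else ennreal (enn2real x powr r))"

definition distribution_function :: "'a measure \<Rightarrow> ('a \<Rightarrow> complex) \<Rightarrow> real \<Rightarrow> ennreal" where
  "distribution_function M f s = emeasure (completion M) {x \<in> space M. cmod (f x) > s}"

definition rearrangement :: "'a measure \<Rightarrow> ('a \<Rightarrow> complex) \<Rightarrow> real \<Rightarrow> ennreal" where
  "rearrangement M f t = Inf {ennreal s | s. s > 0 \<and> distribution_function M f s \<le> ennreal t}"

definition max_rearrangement :: "'a measure \<Rightarrow> ('a \<Rightarrow> complex) \<Rightarrow> real \<Rightarrow> ennreal" where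
  "max_rearrangement M f t = ennreal (1 / t) * (\<integral>\<^sup>+u\<in>{0..t}. rearrangement M f u \<partial>lborel)"

definition lorentz_norm :: "'a measure \<Rightarrow> real \<Rightarrow> ennreal \<Rightarrow> ('a \<Rightarrow> complex) \<Rightarrow> ennreal" where
  "lorentz_norm M p q f =
     (if q = \<infinity> then (SUP t\<in>{0<..}. ennreal (t powr (1 / p)) * max_rearrangement M f t)
      else epowr (\<integral>\<^sup>+t\<in>{0<..}. epowr (ennreal (t powr (1 / p)) * max_rearrangement M f t) (enn2real q)
                      * ennreal (1 / t) \<partial>lborel)
             (1 / enn2real q))"

definition lorentz_space :: "'a measure \<Rightarrow> real \<Rightarrow> ennreal \<Rightarrow> ('a \<Rightarrow> complex) set" where
  "lorentz_space M p q = {f \<in> borel_measurable (completion M). lorentz_norm M p q f < \<infinity>}"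

end

theory Submission
  imports Defs "HOL-Probability.Probability"
begin

text \<open>
  Let \<open>D\<^sub>f(s) = \<lambda>{|f| > s}\<close>, so that \<open>t f\<^sup>*\<^sup>*(t) = \<integral> min(t, D\<^sub>f(s)) ds\<close>. Cut \<open>f\<close> and \<open>\<phi>\<close> at the heights
  where \<open>D\<^sub>f\<close> and \<open>D\<^sub>\<phi>\<close> cross \<open>t\<close>. On the four resulting products the trivial \<open>L\<^sup>1\<close> and \<open>L\<^sup>\<infinity>\<close> bounds
  for convolutions give
  \<open>(f*\<phi>)\<^sup>*\<^sup>*(t) \<le> \<integral>\<integral> D\<^sub>f(s) D\<^sub>\<phi>(r) / max(t, D\<^sub>f(s), D\<^sub>\<phi>(r)) ds dr \<le> \<integral>\<^sub>t f\<^sup>*\<^sup>*(u) \<phi>\<^sup>*\<^sup>*(u) du\<close>,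
  where the last integral extends to infinity and the second step only uses that \<open>u\<^sup>-\<^sup>2\<close> has
  integral \<open>1/m\<close> over \<open>u \<ge> m\<close>. Hardy's inequality costs a factor \<open>p0\<close>, and Hoelder's inequality
  together with the embeddings of Lorentz spaces in the second index, whose constants
  \<open>(q/p)\<close> to the power \<open>1/q\<close> are at most \<open>\<surd>e\<close>, costs a factor \<open>e \<le> 3\<close>.

  The \<open>L\<^sup>\<infinity>\<close> bounds require that Haar measure is invariant under the involution, which has to be
  derived from the axioms. Fubini's theorem requires joint measurability of \<open>(x, y) \<mapsto> T\<^sup>xf(y)\<close> with
  respect to the product \<open>\<sigma>\<close>-algebra. As \<open>K\<close> is not second countable, this is only available for
  Baire functions \<open>f\<close>; but each function in a Lorentz space agrees almost everywhere with a Baire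
  function that vanishes off a \<open>\<sigma>\<close>-compact set.
\<close>

section \<open>Distribution functions and rearrangements\<close>

text \<open>Distribution functions replace rearrangements throughout: they are monotone on the line,
  so the exchanges behind the kernel estimates take place over Lebesgue measure, and Haar measure
  enters through one L^1 bound, two sup bounds and the translation of level sets. The truncated
  factors are bounded but need not be integrable, so their product is estimated level by level:
  heights \<sigma> and \<tau> contribute at most the smaller of the two measures a and b, which is
  the value of ab / max(t, a, b) when both exceed t.

  The axioms on supports concern products of point masses only. What carries the measure theory is
  the cancellation rule \<open>point_supp_cancel\<close>: v \<in> supp(u~ * y) implies y \<in>
  supp(u * v). It yields the invariance under the involution, and it confines the convolution of
  functions living on \<sigma>-compact sets to a \<sigma>-compact set, where Fubini's theorem
  applies. Passing to Baire representatives is harmless at every x, because a null set stays null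
  for the product of x and y for almost every y.\<close>

lemma borel_measurable_antimono_ennreal:
  fixes D :: "real \<Rightarrow> ennreal"
  assumes "\<And>s t. s \<le> t \<Longrightarrow> D t \<le> D s"
  shows "D \<in> borel_measurable borel"
proof (rule borel_measurableI_greater)
  fix c
  have "is_interval {x \<in> space borel. c < D x}"
    unfolding is_interval_1 using assms by (auto intro: less_le_trans)
  then show "{x \<in> space borel. c < D x} \<in> sets borel"
    by (rule real_interval_borel_measurable)
qed

text \<open>Writes an extended real value as the length of the set of heights below it; the layer
  cake formulas are this identity followed by an exchange of integrals.\<close>

lemma nn_integral_indicator_less:
  "(\<integral>\<^sup>+s. indicator {0<..} s * indicator {s. ennreal s < c} s \<partial>lborel) = c"
proof (cases c)
  case (real r)
  have "(\<lambda>s. indicator {0<..} s * indicator {s. ennreal s < c} s) = (\<lambda>s. indicator {0<..<r} s :: ennreal)"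
    using real by (auto simp: indicator_def ennreal_less_iff fun_eq_iff)
  then show ?thesis using real by simp
next
  case top
  have "(\<lambda>s. indicator {0<..} s * indicator {s. ennreal s < c} s) = (\<lambda>s. indicator {0<..} s :: ennreal)"
    using top by (auto simp: indicator_def fun_eq_iff)
  moreover have "emeasure lborel {0::real<..} = \<infinity>"
  proof (rule ccontr)
    assume *: "emeasure lborel {0::real<..} \<noteq> \<infinity>"
    then obtain r where r: "emeasure lborel {0::real<..} = ennreal r" "0 \<le> r"
      by (cases "emeasure lborel {0::real<..}") auto
    have "emeasure lborel {0<..<r+1} \<le> emeasure lborel {0::real<..}"
      by (rule emeasure_mono) auto
    then show False using r by (simp add: ennreal_le_iff)
  qed
  ultimately show ?thesis using top by simp
qed

text \<open>\<open>N\<close> need not be \<sigma>-finite, but the set g > 0 is the union of the sets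
  g > 1 / (n + 1), which have finite measure; its complement is a null set for the density.\<close>

lemma sigma_finite_density_levels:
  fixes g :: "'a \<Rightarrow> ennreal"
  assumes [measurable]: "g \<in> borel_measurable N"
    and fin: "\<And>s. 0 < s \<Longrightarrow> emeasure N {x\<in>space N. ennreal s < g x} < \<infinity>"
  shows "sigma_finite_measure (density N (indicator {x\<in>space N. 0 < g x}))"
proof
  let ?S = "{x\<in>space N. 0 < g x}"
  let ?A = "\<lambda>n::nat. {x\<in>space N. ennreal (1 / Suc n) < g x}"
  have "{space N - ?S} \<union> range ?A \<subseteq> sets N" by auto
  moreover have "\<Union> ({space N - ?S} \<union> range ?A) = space N"
  proof -
    have "x \<in> (\<Union>n. ?A n)" if x: "x \<in> ?S" for x
    proof -
      obtain z where z: "0 < z" "z < g x"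
        using x dense[of 0 "g x"] by auto
      define r where "r = enn2real z"
      have r: "0 < r" "ennreal r < g x"
        using z by (cases z; force simp: r_def)+
      obtain n where "1 / Suc n < r"
        using r(1) nat_approx_posE by blast
      then show ?thesis using r x by (auto intro!: exI[of _ n] le_less_trans[OF _ r(2)] ennreal_leI)
    qed
    then show ?thesis by auto
  qed
  moreover have "emeasure (density N (indicator ?S)) a \<noteq> \<infinity>" if "a \<in> {space N - ?S} \<union> range ?A" for a
  proof -
    have a: "a \<in> sets N" using that by auto
    then have *: "emeasure (density N (indicator ?S)) a = emeasure N (?S \<inter> a)"
      by (subst emeasure_density) (auto simp: nn_integral_indicator[symmetric] indicator_inter_arith simp del: nn_integral_indicator)
    from that show ?thesis
    proof
      assume "a \<in> {space N - ?S}"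
      then have "?S \<inter> a = {}" by auto
      then show ?thesis unfolding * by simp
    next
      assume "a \<in> range ?A"
      then obtain n where a': "a = ?A n" by auto
      have "emeasure N (?S \<inter> a) \<le> emeasure N (?A n)"
        using a' by (intro emeasure_mono) auto
      also have "\<dots> < \<infinity>" by (rule fin) simp
      finally show ?thesis unfolding * by simp
    qed
  qed
  ultimately show "\<exists>A. countable A \<and> A \<subseteq> sets (density N (indicator ?S)) \<and>
      \<Union> A = space (density N (indicator ?S)) \<and> (\<forall>a\<in>A. emeasure (density N (indicator ?S)) a \<noteq> \<infinity>)"
    by (intro exI[of _ "{space N - ?S} \<union> range ?A"]) auto
qed

text \<open>Replace g(x) by the length of {s > 0. s < g(x)} and exchange the integrals. The
  integrand vanishes where g does, so Fubini's theorem is applied only to the restriction of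
  \<open>N\<close> to g > 0, which is \<sigma>-finite. The weight b later carries the translate of
  another function.\<close>

lemma nn_integral_layer_cake:
  fixes g b :: "'a \<Rightarrow> ennreal"
  assumes [measurable]: "g \<in> borel_measurable N" "b \<in> borel_measurable N"
    and fin: "\<And>s. 0 < s \<Longrightarrow> emeasure N {x\<in>space N. ennreal s < g x} < \<infinity>"
  shows "(\<integral>\<^sup>+x. b x * g x \<partial>N) =
    (\<integral>\<^sup>+s\<in>{0<..}. (\<integral>\<^sup>+x. b x * indicator {x\<in>space N. ennreal s < g x} x \<partial>N) \<partial>lborel)"
proof -
  let ?S = "{x\<in>space N. 0 < g x}"
  define N' where "N' = density N (indicator ?S)"
  have [measurable_cong]: "sets N' = sets N" and sp: "space N' = space N" by (auto simp: N'_def)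
  interpret N': sigma_finite_measure N'
    unfolding N'_def by (rule sigma_finite_density_levels[OF assms(1) fin])
  interpret pair_sigma_finite N' lborel ..
  have N': "(\<integral>\<^sup>+x. h x \<partial>N) = (\<integral>\<^sup>+x. h x \<partial>N')"
    if [measurable]: "h \<in> borel_measurable N" and "\<And>x. x \<in> space N \<Longrightarrow> g x = 0 \<Longrightarrow> h x = 0" for h :: "'a \<Rightarrow> ennreal"
    unfolding N'_def using that(2)
    by (subst nn_integral_density) (auto intro!: nn_integral_cong simp: indicator_def zero_less_iff_neq_zero)
  have "(\<integral>\<^sup>+x. b x * g x \<partial>N) = (\<integral>\<^sup>+x. b x * g x \<partial>N')"
    by (rule N') auto
  also have "\<dots> = (\<integral>\<^sup>+x. \<integral>\<^sup>+s. b x * (indicator {0<..} s * indicator {s. ennreal s < g x} s) \<partial>lborel \<partial>N')"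
    by (subst nn_integral_cmult) (auto simp: nn_integral_indicator_less)
  also have "\<dots> = (\<integral>\<^sup>+s. \<integral>\<^sup>+x. b x * (indicator {0<..} s * indicator {s. ennreal s < g x} s) \<partial>N' \<partial>lborel)"
    by (rule Fubini'[symmetric]) (simp add: indicator_def)
  also have "\<dots> = (\<integral>\<^sup>+s\<in>{0<..}. (\<integral>\<^sup>+x. b x * indicator {x\<in>space N. ennreal s < g x} x \<partial>N') \<partial>lborel)"
    by (intro nn_integral_cong) (auto simp: indicator_def sp intro!: nn_integral_cong)
  also have "\<dots> = (\<integral>\<^sup>+s\<in>{0<..}. (\<integral>\<^sup>+x. b x * indicator {x\<in>space N. ennreal s < g x} x \<partial>N) \<partial>lborel)"
    by (intro nn_integral_cong, subst N') (auto simp: indicator_def)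
  finally show ?thesis .
qed

definition superlevel :: "'a measure \<Rightarrow> ('a \<Rightarrow> ennreal) \<Rightarrow> real \<Rightarrow> ennreal" where
  "superlevel N g s = emeasure N {x\<in>space N. ennreal s < g x}"

text \<open>Stands in for \<sigma>-finiteness of the measure: it makes the measure \<sigma>-finite
  where g is positive. Functions in a Lorentz space have this property.\<close>

definition levels_finite :: "'a measure \<Rightarrow> ('a \<Rightarrow> ennreal) \<Rightarrow> bool" where
  "levels_finite N g \<longleftrightarrow> (\<forall>s>0. superlevel N g s < \<infinity>)"

text \<open>For real t > 0 this is t g**(t), the K-functional of g at t for the couple L^1,
  L^\<infinity>. The argument is an \<open>ennreal\<close> so that the measure of a set can be
  inserted.\<close>

definition level_integral :: "'a measure \<Rightarrow> ('a \<Rightarrow> ennreal) \<Rightarrow> ennreal \<Rightarrow> ennreal" where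
  "level_integral N g t = (\<integral>\<^sup>+s\<in>{0<..}. min t (superlevel N g s) \<partial>lborel)"

lemma superlevel_antimono:
  assumes [measurable]: "g \<in> borel_measurable N" and "s \<le> t"
  shows "superlevel N g t \<le> superlevel N g s"
  unfolding superlevel_def using \<open>s \<le> t\<close>
  by (intro emeasure_mono) (auto intro: le_less_trans[OF ennreal_leI])

lemma measurable_superlevel [measurable]:
  assumes [measurable]: "g \<in> borel_measurable N"
  shows "superlevel N g \<in> borel_measurable borel"
  by (intro borel_measurable_antimono_ennreal superlevel_antimono assms)

lemma ennreal_less_right_approx:
  fixes c :: ennreal
  assumes "ennreal s < c" "0 \<le> s"
  obtains n where "ennreal (s + 1 / Suc n) < c"
proof -
  obtain z where z: "ennreal s < z" "z < c" using dense[OF assms(1)] by auto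
  then obtain r where r: "z = ennreal r" "s < r"
    using assms by (cases z) (auto simp: ennreal_less_iff)
  obtain n where "1 / Suc n < r - s" using nat_approx_posE[of "r - s"] r(2) by auto
  then have "ennreal (s + 1 / Suc n) \<le> z" unfolding r(1) by (intro ennreal_leI) simp
  then show ?thesis using z(2) by (intro that[of n]) simp
qed

text \<open>The set g > s is the increasing union of the sets g > s + 1 / (n + 1). Right continuity
  is what makes the strict inequalities in \<open>less_rearrangement_iff\<close> equivalent.\<close>

lemma superlevel_right_continuous:
  assumes [measurable]: "g \<in> borel_measurable N" and "0 \<le> s"
  shows "superlevel N g s = (SUP n. superlevel N g (s + 1 / Suc n))"
proof -
  have "(SUP n. superlevel N g (s + 1 / Suc n)) = emeasure N (\<Union>n. {x\<in>space N. ennreal (s + 1 / Suc n) < g x})"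
    unfolding superlevel_def
  proof (intro SUP_emeasure_incseq incseq_SucI subsetI)
    fix n x assume "x \<in> {x\<in>space N. ennreal (s + 1 / Suc n) < g x}"
    moreover have "ennreal (s + 1 / Suc (Suc n)) \<le> ennreal (s + 1 / Suc n)"
      by (intro ennreal_leI) (auto simp: field_simps)
    ultimately show "x \<in> {x\<in>space N. ennreal (s + 1 / Suc (Suc n)) < g x}"
      by (auto intro: le_less_trans simp del: ennreal_plus of_nat_Suc)
  qed auto
  also have "(\<Union>n. {x\<in>space N. ennreal (s + 1 / Suc n) < g x}) = {x\<in>space N. ennreal s < g x}"
  proof (intro set_eqI iffI)
    fix x assume "x \<in> (\<Union>n. {x\<in>space N. ennreal (s + 1 / Suc n) < g x})"
    then obtain n where "x \<in> space N" "ennreal (s + 1 / Suc n) < g x" by auto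
    moreover have "ennreal s \<le> ennreal (s + 1 / Suc n)" by (intro ennreal_leI) auto
    ultimately show "x \<in> {x\<in>space N. ennreal s < g x}" by (auto simp del: ennreal_plus)
  next
    fix x assume "x \<in> {x\<in>space N. ennreal s < g x}"
    then have x: "x \<in> space N" "ennreal s < g x" by auto
    obtain n where "ennreal (s + 1 / Suc n) < g x"
      using x(2) \<open>0 \<le> s\<close> by (rule ennreal_less_right_approx)
    then show "x \<in> (\<Union>n. {x\<in>space N. ennreal (s + 1 / Suc n) < g x})"
      using x(1) by (intro UN_I[of n]) (simp_all del: ennreal_plus of_nat_Suc)
  qed
  finally show ?thesis by (simp add: superlevel_def)
qed

lemma distribution_function_superlevel:
  "0 \<le> s \<Longrightarrow> distribution_function M f s = superlevel (completion M) (\<lambda>x. ennreal (cmod (f x))) s"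
  by (simp add: distribution_function_def superlevel_def ennreal_less_iff)

text \<open>The rearrangement is the generalized inverse of the distribution function D. If D(s)
  exceeds u, right continuity gives a level strictly above s where D still exceeds u; no admissible
  level lies below that one, which keeps the infimum strictly above s.\<close>

lemma less_rearrangement_iff:
  assumes [measurable]: "f \<in> borel_measurable (completion M)" and "0 < s"
  shows "ennreal s < rearrangement M f u \<longleftrightarrow>
    ennreal u < superlevel (completion M) (\<lambda>x. ennreal (cmod (f x))) s"
proof
  let ?D = "superlevel (completion M) (\<lambda>x. ennreal (cmod (f x)))"
  assume "ennreal s < rearrangement M f u"
  show "ennreal u < ?D s"
  proof (rule ccontr)
    assume "\<not> ennreal u < ?D s"
    then have "rearrangement M f u \<le> ennreal s"
      unfolding rearrangement_def using \<open>0 < s\<close>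
      by (intro Inf_lower) (auto simp: distribution_function_superlevel)
    then show False using \<open>ennreal s < _\<close> by simp
  qed
next
  let ?D = "superlevel (completion M) (\<lambda>x. ennreal (cmod (f x)))"
  assume "ennreal u < ?D s"
  then obtain n where n: "ennreal u < ?D (s + 1 / Suc n)"
    using \<open>0 < s\<close> by (subst (asm) superlevel_right_continuous) (auto simp: less_SUP_iff)
  have "ennreal (s + 1 / Suc n) \<le> rearrangement M f u"
    unfolding rearrangement_def
  proof (rule Inf_greatest)
    fix w assume "w \<in> {ennreal s |s. 0 < s \<and> distribution_function M f s \<le> ennreal u}"
    then obtain v where v: "0 < v" "distribution_function M f v \<le> ennreal u" and w: "w = ennreal v"
      by auto
    show "ennreal (s + 1 / Suc n) \<le> w" unfolding w
    proof (rule ccontr)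
      assume "\<not> ennreal (s + 1 / Suc n) \<le> ennreal v"
      then have "v \<le> s + 1 / Suc n" using v w by (simp add: not_le ennreal_less_iff)
      then have "?D (s + 1 / Suc n) \<le> ?D v" by (intro superlevel_antimono) auto
      then show False using n v by (simp add: distribution_function_superlevel)
    qed
  qed
  moreover have "ennreal s < ennreal (s + 1 / Suc n)"
    using \<open>0 < s\<close> by (intro ennreal_lessI) (auto intro: add_pos_pos)
  ultimately show "ennreal s < rearrangement M f u" by (rule less_le_trans[rotated])
qed

text \<open>Both sides are 1 / t times the area of {(u, s). 0 \<le> u \<le> t, 0 < s, u < D(s)},
  sliced in u on the left and in s on the right.\<close>

lemma max_rearrangement_level_integral:
  assumes [measurable]: "f \<in> borel_measurable (completion M)" and "0 < t"
  shows "max_rearrangement M f t =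
    ennreal (1 / t) * level_integral (completion M) (\<lambda>x. ennreal (cmod (f x))) (ennreal t)"
proof -
  let ?D = "superlevel (completion M) (\<lambda>x. ennreal (cmod (f x)))"
  have R: "rearrangement M f u = (\<integral>\<^sup>+s\<in>{0<..}. indicator {s. ennreal u < ?D s} s \<partial>lborel)" for u
    by (subst nn_integral_indicator_less[of "rearrangement M f u", symmetric], intro nn_integral_cong)
       (auto simp: indicator_def less_rearrangement_iff)
  have "(\<integral>\<^sup>+u\<in>{0..t}. rearrangement M f u \<partial>lborel) =
    (\<integral>\<^sup>+u. \<integral>\<^sup>+s. indicator {0..t} u * (indicator {0<..} s * indicator {s. ennreal u < ?D s} s) \<partial>lborel \<partial>lborel)"
    unfolding R by (subst nn_integral_cmult) (auto simp: mult_ac)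
  also have "\<dots> = (\<integral>\<^sup>+s. \<integral>\<^sup>+u. indicator {0..t} u * (indicator {0<..} s * indicator {s. ennreal u < ?D s} s) \<partial>lborel \<partial>lborel)"
    by (rule lborel_pair.Fubini'[symmetric]) (simp add: indicator_def)
  also have "\<dots> = (\<integral>\<^sup>+s. indicator {0<..} s * (\<integral>\<^sup>+u. indicator {0..t} u * indicator {u. ennreal u < ?D s} u \<partial>lborel) \<partial>lborel)"
    by (subst nn_integral_cmult[symmetric]) (auto intro!: nn_integral_cong simp: indicator_def)
  also have "(\<lambda>s. \<integral>\<^sup>+u. indicator {0..t} u * indicator {u. ennreal u < ?D s} u \<partial>lborel) = (\<lambda>s. min (ennreal t) (?D s))"
  proof
    fix s
    have "AE u in lborel. u \<noteq> (0::real)" by (rule AE_lborel_singleton)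
    moreover have "AE u in lborel. u \<noteq> t" by (rule AE_lborel_singleton)
    ultimately have "AE u in lborel. indicator {0..t} u * indicator {u. ennreal u < ?D s} u =
      (indicator {0<..} u * indicator {u. ennreal u < min (ennreal t) (?D s)} u :: ennreal)"
      by eventually_elim (auto simp: indicator_def ennreal_less_iff)
    then have "(\<integral>\<^sup>+u. indicator {0..t} u * indicator {u. ennreal u < ?D s} u \<partial>lborel) = 
       (\<integral>\<^sup>+u. indicator {0<..} u * indicator {u. ennreal u < min (ennreal t) (?D s)} u \<partial>lborel)"
      by (rule nn_integral_cong_AE)
    then show "(\<integral>\<^sup>+u. indicator {0..t} u * indicator {u. ennreal u < ?D s} u \<partial>lborel) = min (ennreal t) (?D s)"
      by (simp only: nn_integral_indicator_less)
  qed
  finally show ?thesis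
    by (simp add: max_rearrangement_def level_integral_def mult.commute)
qed

text \<open>The cut height is the supremum of the heights whose superlevel sets have measure above
  t, in effect the rearrangement at t. Each such height \<sigma> satisfies t \<sigma> \<le>
  \<open>level_integral N g t\<close>, so the supremum is finite. Nothing is claimed at s
  itself.\<close>

lemma split_level:
  assumes [measurable]: "g \<in> borel_measurable N" and t: "0 < t"
    and fin: "level_integral N g (ennreal t) < \<infinity>"
  obtains s where "0 \<le> s" "\<And>\<sigma>. s < \<sigma> \<Longrightarrow> superlevel N g \<sigma> \<le> ennreal t"
    "\<And>\<sigma>. 0 < \<sigma> \<Longrightarrow> \<sigma> < s \<Longrightarrow> ennreal t < superlevel N g \<sigma>"
proof -
  let ?D = "superlevel N g"
  \<comment> \<open>The point 0 keeps \<open>S\<close> nonempty and its supremum nonnegative when no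
    level set is larger than t.\<close>
  define S where "S = insert 0 {\<sigma>. 0 < \<sigma> \<and> ennreal t < ?D \<sigma>}"
  obtain L where L: "level_integral N g (ennreal t) = ennreal L" "0 \<le> L"
    using fin by (cases "level_integral N g (ennreal t)") auto
  have bound: "\<sigma> \<le> L / t" if "\<sigma> \<in> S" for \<sigma>
  proof (cases "\<sigma> = 0")
    case False
    with that have \<sigma>: "0 < \<sigma>" "ennreal t < ?D \<sigma>" by (auto simp: S_def)
    have "ennreal (t * \<sigma>) = (\<integral>\<^sup>+s. ennreal t * indicator {0<..<\<sigma>} s \<partial>lborel)"
      using \<sigma> t by (subst nn_integral_cmult_indicator) (auto simp: ennreal_mult)
    also have "\<dots> \<le> level_integral N g (ennreal t)"
      unfolding level_integral_def
    proof (intro nn_integral_mono)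
      fix s :: real
      have "ennreal t \<le> ?D s" if "s < \<sigma>"
        using \<sigma> superlevel_antimono[of g N s \<sigma>] that by (simp add: order.strict_implies_order order.trans)
      then show "ennreal t * indicator {0<..<\<sigma>} s \<le> min (ennreal t) (?D s) * indicator {0<..} s"
        by (auto simp: indicator_def)
    qed
    finally show ?thesis using L t by (simp add: field_simps)
  qed (use L t in auto)
  then have bdd: "bdd_above S" by (auto simp: bdd_above_def)
  show thesis
  proof (rule that[of "Sup S"])
    show S0: "0 \<le> Sup S" by (rule cSup_upper[OF _ bdd]) (simp add: S_def)
    show "?D \<sigma> \<le> ennreal t" if "Sup S < \<sigma>" for \<sigma>
    proof (rule ccontr)
      assume "\<not> ?thesis"
      then have "\<sigma> \<in> S" using S0 that by (auto simp: S_def)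
      then have "\<sigma> \<le> Sup S" by (rule cSup_upper[OF _ bdd])
      then show False using that by simp
    qed
    show "ennreal t < ?D \<sigma>" if "0 < \<sigma>" "\<sigma> < Sup S" for \<sigma>
    proof -
      obtain v where "v \<in> S" "\<sigma> < v"
        using \<open>\<sigma> < Sup S\<close> less_cSup_iff[OF _ bdd, of \<sigma>] by (auto simp: S_def)
      then show ?thesis using that superlevel_antimono[of g N \<sigma> v]
        by (auto simp: S_def)
    qed
  qed
qed

lemma nn_integral_superlevels:
  assumes [measurable]: "g \<in> borel_measurable N" and "levels_finite N g"
  shows "(\<integral>\<^sup>+x. g x \<partial>N) = (\<integral>\<^sup>+s\<in>{0<..}. superlevel N g s \<partial>lborel)"
  using nn_integral_layer_cake[of g N "\<lambda>_. 1"] assms(2)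
  by (simp add: levels_finite_def superlevel_def)

text \<open>Subtraction stops at 0, so the superlevel sets of g - s are those of g shifted by s, and
  the layer cake formula becomes an integral over the heights above s.\<close>

lemma nn_integral_minus_level:
  assumes [measurable]: "g \<in> borel_measurable N" and fin: "levels_finite N g" and "0 \<le> s"
  shows "(\<integral>\<^sup>+x. g x - ennreal s \<partial>N) = (\<integral>\<^sup>+\<sigma>\<in>{s<..}. superlevel N g \<sigma> \<partial>lborel)"
proof -
  have eq: "superlevel N (\<lambda>x. g x - ennreal s) \<sigma> = superlevel N g (s + \<sigma>)" if "0 < \<sigma>" for \<sigma>
  proof -
    have "ennreal \<sigma> < c - ennreal s \<longleftrightarrow> ennreal (s + \<sigma>) < c" for c
      using that \<open>0 \<le> s\<close> by (cases c) (auto simp: ennreal_minus ennreal_less_iff ennreal_plus[symmetric] simp del: ennreal_plus)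
    then show ?thesis by (simp add: superlevel_def)
  qed
  have "levels_finite N (\<lambda>x. g x - ennreal s)"
    using fin \<open>0 \<le> s\<close> by (auto simp: levels_finite_def eq)
  then have "(\<integral>\<^sup>+x. g x - ennreal s \<partial>N) = (\<integral>\<^sup>+\<sigma>\<in>{0<..}. superlevel N g (s + \<sigma>) \<partial>lborel)"
    by (subst nn_integral_superlevels) (auto intro!: nn_integral_cong simp: eq indicator_def)
  also have "\<dots> = (\<integral>\<^sup>+\<sigma>\<in>{s<..}. superlevel N g \<sigma> \<partial>lborel)"
    by (subst nn_integral_real_affine[of _ 1 s]) (auto intro!: nn_integral_cong simp: indicator_def)
  finally show ?thesis .
qed

lemma levels_finite_integrable:
  assumes [measurable]: "g \<in> borel_measurable N" and "(\<integral>\<^sup>+x. g x \<partial>N) < \<infinity>"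
  shows "levels_finite N g"
  unfolding levels_finite_def
proof (intro allI impI)
  fix s :: real assume "0 < s"
  have "superlevel N g s \<le> emeasure N {x\<in>space N. 1 \<le> ennreal (1 / s) * g x}"
    unfolding superlevel_def
  proof (rule emeasure_mono, clarsimp)
    fix x assume "ennreal s < g x"
    then have "ennreal (1 / s) * ennreal s \<le> ennreal (1 / s) * g x" by (intro mult_left_mono) auto
    then show "1 \<le> ennreal (1 / s) * g x" using \<open>0 < s\<close> by (simp add: ennreal_mult[symmetric])
  qed measurable
  also have "\<dots> \<le> ennreal (1 / s) * (\<integral>\<^sup>+x. g x * indicator (space N) x \<partial>N)"
    using nn_integral_Markov_inequality[of "\<lambda>x. g x" "space N" N "ennreal (1/s)"] by simp
  also have "(\<integral>\<^sup>+x. g x * indicator (space N) x \<partial>N) = (\<integral>\<^sup>+x. g x \<partial>N)"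
    by (intro nn_integral_cong) auto
  finally show "superlevel N g s < \<infinity>" using assms(2)
    by (auto simp: ennreal_mult_less_top intro: le_less_trans)
qed

text \<open>Heights above b are charged to \<open>h1\<close>, because h > b + \<sigma> forces h1 >
  \<sigma>; the heights in [0, b] cost at most t each. This turns a pointwise bound for a
  convolution into a bound for its maximal rearrangement.\<close>

lemma level_integral_le_K_functional:
  fixes h h1 :: "'a \<Rightarrow> ennreal" and B t :: ennreal
  assumes [measurable]: "h \<in> borel_measurable N" "h1 \<in> borel_measurable N"
    and le: "AE x in N. h x \<le> h1 x + B"
  shows "level_integral N h t \<le> (\<integral>\<^sup>+x. h1 x \<partial>N) + t * B"
\<comment> \<open>Excluding t = 0 makes \<open>t * B\<close> infinite when \<open>B\<close>
  is.\<close>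
proof (cases "(\<integral>\<^sup>+x. h1 x \<partial>N) = \<infinity> \<or> t = 0")
  case True then show ?thesis by (auto simp: level_integral_def)
next
  case F1: False
  show ?thesis
  proof (cases B)
    case top then show ?thesis using F1 by (auto simp: ennreal_mult_top)
  next
    case (real b)
    have fin: "levels_finite N h1" using F1 by (intro levels_finite_integrable) (auto simp: less_top)
    have sl: "superlevel N h (b + \<sigma>) \<le> superlevel N h1 \<sigma>" if "0 < \<sigma>" for \<sigma>
      unfolding superlevel_def
    proof (rule emeasure_mono_AE)
      show "AE x in N. x \<in> {x \<in> space N. ennreal (b + \<sigma>) < h x} \<longrightarrow> x \<in> {x \<in> space N. ennreal \<sigma> < h1 x}"
        using le
      proof eventually_elim
        case (elim x)
        have "ennreal \<sigma> < h1 x" if "ennreal (b + \<sigma>) < h x"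
        proof -
          have "ennreal b + ennreal \<sigma> < h1 x + ennreal b"
            using that elim real \<open>0 < \<sigma>\<close> by (auto simp: ennreal_plus[symmetric] simp del: ennreal_plus)
          then show ?thesis by (simp add: add.commute[of "h1 x"] ennreal_add_left_cancel_less)
        qed
        then show ?case by auto
      qed
    qed measurable
    have "level_integral N h t \<le> (\<integral>\<^sup>+\<sigma>. (superlevel N h \<sigma> * indicator {b<..} \<sigma>) + t * indicator {0..b} \<sigma> \<partial>lborel)"
      unfolding level_integral_def by (intro nn_integral_mono) (auto simp: indicator_def min_def)
    also have "\<dots> = (\<integral>\<^sup>+\<sigma>\<in>{b<..}. superlevel N h \<sigma> \<partial>lborel) + t * B"
      using real by (subst nn_integral_add) (auto simp: nn_integral_cmult_indicator)
    also have "(\<integral>\<^sup>+\<sigma>\<in>{b<..}. superlevel N h \<sigma> \<partial>lborel) = (\<integral>\<^sup>+\<sigma>\<in>{0<..}. superlevel N h (b + \<sigma>) \<partial>lborel)"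
      by (subst nn_integral_real_affine[of _ 1 b]) (auto intro!: nn_integral_cong simp: indicator_def)
    also have "\<dots> \<le> (\<integral>\<^sup>+\<sigma>\<in>{0<..}. superlevel N h1 \<sigma> \<partial>lborel)"
      by (intro nn_integral_mono) (auto simp: indicator_def sl)
    also have "\<dots> = (\<integral>\<^sup>+x. h1 x \<partial>N)"
      by (rule nn_integral_superlevels[symmetric]) (use fin in auto)
    finally show ?thesis by (simp add: add_right_mono)
  qed
qed

text \<open>At a cut height for t the decomposition of g into g - s and min g s is optimal, so the
  bound of \<open>level_integral_le_K_functional\<close> becomes an equality. The height \<sigma> =
  s is discarded as a null set.\<close>

lemma level_integral_split:
  assumes [measurable]: "g \<in> borel_measurable N" and t: "0 < t" and lf: "levels_finite N g"
    and s: "0 \<le> s" "\<And>\<sigma>. s < \<sigma> \<Longrightarrow> superlevel N g \<sigma> \<le> ennreal t"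
    "\<And>\<sigma>. 0 < \<sigma> \<Longrightarrow> \<sigma> < s \<Longrightarrow> ennreal t < superlevel N g \<sigma>"
  shows "level_integral N g (ennreal t) = (\<integral>\<^sup>+x. g x - ennreal s \<partial>N) + ennreal t * ennreal s"
proof -
  have "level_integral N g (ennreal t) =
    (\<integral>\<^sup>+\<sigma>. (superlevel N g \<sigma> * indicator {s<..} \<sigma>) + ennreal t * indicator {0<..s} \<sigma> \<partial>lborel)"
    unfolding level_integral_def
  proof (rule nn_integral_cong_AE)
    show "AE \<sigma> in lborel. min (ennreal t) (superlevel N g \<sigma>) * indicator {0<..} \<sigma> =
       superlevel N g \<sigma> * indicator {s<..} \<sigma> + ennreal t * indicator {0<..s} \<sigma>"
      using AE_lborel_singleton[of s]
    proof eventually_elim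
      case (elim \<sigma>)
      consider "\<sigma> \<le> 0" | "0 < \<sigma>" "\<sigma> < s" | "s < \<sigma>" using elim by linarith
      then show ?case
        using s by cases (auto simp: indicator_def min_def dest: s(2,3) order.strict_trans2 order.antisym intro: antisym)
    qed
  qed
  also have "\<dots> = (\<integral>\<^sup>+\<sigma>\<in>{s<..}. superlevel N g \<sigma> \<partial>lborel) + ennreal t * ennreal s"
    using s by (subst nn_integral_add) (auto simp: nn_integral_cmult_indicator)
  also have "(\<integral>\<^sup>+\<sigma>\<in>{s<..}. superlevel N g \<sigma> \<partial>lborel) = (\<integral>\<^sup>+x. g x - ennreal s \<partial>N)"
    by (rule nn_integral_minus_level[symmetric]) (use s lf in auto)
  finally show ?thesis .
qed

section \<open>The kernel ab / max(t, a, b)\<close>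

definition truncation_kernel :: "ennreal \<Rightarrow> ennreal \<Rightarrow> ennreal \<Rightarrow> ennreal" where
  "truncation_kernel t a b = a * b / max t (max a b)"

lemma measurable_truncation_kernel [measurable (raw)]:
  assumes [measurable]: "f \<in> borel_measurable N" "g \<in> borel_measurable N"
  shows "(\<lambda>x. truncation_kernel t (f x) (g x)) \<in> borel_measurable N"
  unfolding truncation_kernel_def by measurable

lemma truncation_kernel_real:
  assumes "0 < t" "0 \<le> a" "0 \<le> b"
  shows "truncation_kernel (ennreal t) (ennreal a) (ennreal b) = ennreal (a * b / max t (max a b))"
  using assms by (simp add: truncation_kernel_def ennreal_mult[symmetric] divide_ennreal
      max.strict_coboundedI1 ennreal_max_0 max_def)

lemma nn_integral_inverse_square:
  assumes "0 < m"
  shows "(\<integral>\<^sup>+u\<in>{m..}. ennreal (1 / u\<^sup>2) \<partial>lborel) = ennreal (1 / m)"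
proof -
  have "(\<integral>\<^sup>+u. ennreal (1 / u\<^sup>2) * indicator {m..} u \<partial>lborel) = ennreal (0 - (- 1 / m))"
  proof (rule nn_integral_FTC_atLeast)
    show "((\<lambda>u. - 1 / u) has_real_derivative 1 / u\<^sup>2) (at u)" if "m \<le> u" for u
      using that assms by (auto intro!: derivative_eq_intros simp: power2_eq_square field_simps)
    show "((\<lambda>u::real. - 1 / u) \<longlongrightarrow> 0) at_top" by real_asymp
  qed auto
  then show ?thesis by simp
qed

text \<open>For m = max(t, a, b) the value 1 / m is the integral of u^(-2) over u \<ge> m, where the
  minima with u are a and b. Enlarging the range to u \<ge> t is what produces, after integration
  over the heights, two level integrals at the same u.\<close>

lemma truncation_kernel_le_nn_integral:
  assumes t: "0 < t" and fin: "a < \<infinity>" "b < \<infinity>"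
  shows "truncation_kernel (ennreal t) a b \<le>
    (\<integral>\<^sup>+u\<in>{t..}. ennreal (1 / u\<^sup>2) * (min (ennreal u) a * min (ennreal u) b) \<partial>lborel)"
proof -
  obtain a' b' where ab: "a = ennreal a'" "0 \<le> a'" "b = ennreal b'" "0 \<le> b'"
    using fin by (cases a; cases b) auto
  define m where "m = max t (max a' b')"
  have m: "0 < m" "t \<le> m" "a' \<le> m" "b' \<le> m" using t by (auto simp: m_def)
  have "truncation_kernel (ennreal t) a b = ennreal (a' * b') * (\<integral>\<^sup>+u\<in>{m..}. ennreal (1 / u\<^sup>2) \<partial>lborel)"
    using ab t m by (simp add: nn_integral_inverse_square truncation_kernel_real m_def[symmetric] ennreal_mult[symmetric])
  also have "\<dots> = (\<integral>\<^sup>+u. ennreal (a' * b') * (ennreal (1 / u\<^sup>2) * indicator {m..} u) \<partial>lborel)"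
    by (rule nn_integral_cmult[symmetric]) measurable
  also have "\<dots> \<le> (\<integral>\<^sup>+u\<in>{t..}. ennreal (1 / u\<^sup>2) * (min (ennreal u) a * min (ennreal u) b) \<partial>lborel)"
  proof (intro nn_integral_mono)
    fix u
    show "ennreal (a' * b') * (ennreal (1 / u\<^sup>2) * indicator {m..} u) \<le>
      ennreal (1 / u\<^sup>2) * (min (ennreal u) a * min (ennreal u) b) * indicator {t..} u"
    proof (cases "m \<le> u")
      case True
      then have "min (ennreal u) a = ennreal a'" "min (ennreal u) b = ennreal b'"
        using m ab by (auto simp: min_def intro!: antisym ennreal_leI)
      then show ?thesis using True m ab by (auto simp: indicator_def ennreal_mult mult_ac)
    qed auto
  qed
  finally show ?thesis .
qed

context
  fixes A B :: "real \<Rightarrow> ennreal" and t :: real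
  assumes A [measurable]: "A \<in> borel_measurable borel" and B [measurable]: "B \<in> borel_measurable borel"
    and fin: "\<And>s. 0 < s \<Longrightarrow> A s < \<infinity>" "\<And>s. 0 < s \<Longrightarrow> B s < \<infinity>" and t: "0 < t"
begin

lemma truncation_kernel_integral_le:
  "(\<integral>\<^sup>+\<sigma>\<in>{0<..}. (\<integral>\<^sup>+\<tau>\<in>{0<..}. truncation_kernel (ennreal t) (A \<sigma>) (B \<tau>) \<partial>lborel) \<partial>lborel) \<le>
   (\<integral>\<^sup>+u\<in>{t..}. ennreal (1 / u\<^sup>2) * ((\<integral>\<^sup>+\<sigma>\<in>{0<..}. min (ennreal u) (A \<sigma>) \<partial>lborel) *
      (\<integral>\<^sup>+\<tau>\<in>{0<..}. min (ennreal u) (B \<tau>) \<partial>lborel)) \<partial>lborel)" (is "?L \<le> ?R")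
proof -
  \<comment> \<open>All ranges are put into the integrand, so that each exchange is Fubini's theorem
    for two variables and Lebesgue measure; with u outermost the integrals over \<sigma> and \<tau>
    separate.\<close>
  define F where "F \<sigma> \<tau> u = indicator {0<..} \<sigma> * (indicator {0<..} \<tau> * (indicator {t..} u *
      (ennreal (1 / u\<^sup>2) * (min (ennreal u) (A \<sigma>) * min (ennreal u) (B \<tau>)))))" for \<sigma> \<tau> u
  have F [measurable (raw)]: "(\<lambda>x. F (f x) (g x) (h x)) \<in> borel_measurable N"
    if [measurable]: "f \<in> borel_measurable N" "g \<in> borel_measurable N" "h \<in> borel_measurable N" for f g h and N :: "'z measure"
    unfolding F_def by measurable
  have "?L \<le> (\<integral>\<^sup>+\<sigma>. \<integral>\<^sup>+\<tau>. \<integral>\<^sup>+u. F \<sigma> \<tau> u \<partial>lborel \<partial>lborel \<partial>lborel)"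
  proof (subst nn_integral_multc[symmetric], measurable, intro nn_integral_mono)
    fix \<sigma> \<tau>
    show "truncation_kernel (ennreal t) (A \<sigma>) (B \<tau>) * indicator {0<..} \<tau> * indicator {0<..} \<sigma> \<le>
       (\<integral>\<^sup>+u. F \<sigma> \<tau> u \<partial>lborel)"
      using truncation_kernel_le_nn_integral[OF t fin, of \<sigma> \<tau>]
      by (auto simp: indicator_def F_def mult_ac)
  qed
  also have "\<dots> = (\<integral>\<^sup>+\<sigma>. \<integral>\<^sup>+u. \<integral>\<^sup>+\<tau>. F \<sigma> \<tau> u \<partial>lborel \<partial>lborel \<partial>lborel)"
    by (intro nn_integral_cong lborel_pair.Fubini') simp
  also have "\<dots> = (\<integral>\<^sup>+u. \<integral>\<^sup>+\<sigma>. \<integral>\<^sup>+\<tau>. F \<sigma> \<tau> u \<partial>lborel \<partial>lborel \<partial>lborel)"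
    by (rule lborel_pair.Fubini') simp
  also have "\<dots> = ?R"
  proof (intro nn_integral_cong)
    fix u
    have "(\<integral>\<^sup>+\<sigma>. \<integral>\<^sup>+\<tau>. F \<sigma> \<tau> u \<partial>lborel \<partial>lborel) =
      (\<integral>\<^sup>+\<sigma>. (indicator {t..} u * ennreal (1 / u\<^sup>2)) * ((min (ennreal u) (A \<sigma>) * indicator {0<..} \<sigma>) *
         (\<integral>\<^sup>+\<tau>\<in>{0<..}. min (ennreal u) (B \<tau>) \<partial>lborel)) \<partial>lborel)"
      by (intro nn_integral_cong, subst nn_integral_cmult[symmetric], measurable,
          subst nn_integral_cmult[symmetric], measurable)
         (auto intro!: nn_integral_cong simp: F_def mult_ac)
    also have "\<dots> = (indicator {t..} u * ennreal (1 / u\<^sup>2)) * ((\<integral>\<^sup>+\<sigma>\<in>{0<..}. min (ennreal u) (A \<sigma>) \<partial>lborel) *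
         (\<integral>\<^sup>+\<tau>\<in>{0<..}. min (ennreal u) (B \<tau>) \<partial>lborel))"
      by (subst nn_integral_cmult, measurable, subst nn_integral_multc) auto
    finally show "(\<integral>\<^sup>+\<sigma>. \<integral>\<^sup>+\<tau>. F \<sigma> \<tau> u \<partial>lborel \<partial>lborel) = ennreal (1 / u\<^sup>2) *
      ((\<integral>\<^sup>+\<sigma>\<in>{0<..}. min (ennreal u) (A \<sigma>) \<partial>lborel) *
      (\<integral>\<^sup>+\<tau>\<in>{0<..}. min (ennreal u) (B \<tau>) \<partial>lborel)) * indicator {t..} u"
      by (simp add: mult_ac)
  qed
  finally show ?thesis .
qed

text \<open>Pointwise comparison in the four quadrants cut out by (s, r). Multiplied by t, the
  kernel equals ab where a, b \<le> t, tb where only a exceeds t, ta where only b does, and t min(a,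
  b) where both do; these are the integrands of I J, t s J, t r I and t times the double integral.
  On the lines \<sigma> = s and \<tau> = r, where the hypotheses say nothing, the integrands on the
  left vanish.\<close>

lemma split_terms_le_truncation_kernel_integral:
  assumes s: "0 \<le> s" "\<And>\<sigma>. s < \<sigma> \<Longrightarrow> A \<sigma> \<le> ennreal t" "\<And>\<sigma>. 0 < \<sigma> \<Longrightarrow> \<sigma> < s \<Longrightarrow> ennreal t < A \<sigma>"
    and r: "0 \<le> r" "\<And>\<tau>. r < \<tau> \<Longrightarrow> B \<tau> \<le> ennreal t" "\<And>\<tau>. 0 < \<tau> \<Longrightarrow> \<tau> < r \<Longrightarrow> ennreal t < B \<tau>"
  defines "I \<equiv> (\<integral>\<^sup>+\<sigma>\<in>{s<..}. A \<sigma> \<partial>lborel)" and "J \<equiv> (\<integral>\<^sup>+\<tau>\<in>{r<..}. B \<tau> \<partial>lborel)"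
  shows "I * J + ennreal t * (ennreal s * J + ennreal r * I +
      (\<integral>\<^sup>+\<tau>\<in>{0<..<r}. (\<integral>\<^sup>+\<sigma>\<in>{0<..<s}. min (A \<sigma>) (B \<tau>) \<partial>lborel) \<partial>lborel)) \<le>
    ennreal t * (\<integral>\<^sup>+\<sigma>\<in>{0<..}. (\<integral>\<^sup>+\<tau>\<in>{0<..}. truncation_kernel (ennreal t) (A \<sigma>) (B \<tau>) \<partial>lborel) \<partial>lborel)"
proof -
  define G1 where "G1 \<sigma> \<tau> = A \<sigma> * indicator {s<..} \<sigma> * (B \<tau> * indicator {r<..} \<tau>)" for \<sigma> \<tau>
  define G2 where "G2 \<sigma> \<tau> = (indicator {0<..<s} \<sigma> * (B \<tau> * indicator {r<..} \<tau>) :: ennreal)" for \<sigma> \<tau>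
  define G3 where "G3 \<sigma> \<tau> = (A \<sigma> * indicator {s<..} \<sigma>) * (indicator {0<..<r} \<tau> :: ennreal)" for \<sigma> \<tau>
  define G4 where "G4 \<sigma> \<tau> = min (A \<sigma>) (B \<tau>) * indicator {0<..<s} \<sigma> * indicator {0<..<r} \<tau>" for \<sigma> \<tau>
  note G = G1_def G2_def G3_def G4_def
  have M [measurable (raw)]:
    "(\<lambda>x. G1 (f x) (g x)) \<in> borel_measurable N" "(\<lambda>x. G2 (f x) (g x)) \<in> borel_measurable N"
    "(\<lambda>x. G3 (f x) (g x)) \<in> borel_measurable N" "(\<lambda>x. G4 (f x) (g x)) \<in> borel_measurable N"
    if [measurable]: "f \<in> borel_measurable N" "g \<in> borel_measurable N" for f g and N :: "'z measure"
    unfolding G by measurable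
  have 1: "I * J = (\<integral>\<^sup>+\<sigma>. \<integral>\<^sup>+\<tau>. G1 \<sigma> \<tau> \<partial>lborel \<partial>lborel)"
    unfolding G1_def I_def J_def by (subst nn_integral_cmult, measurable, subst nn_integral_multc) auto
  have 2: "ennreal s * J = (\<integral>\<^sup>+\<sigma>. \<integral>\<^sup>+\<tau>. G2 \<sigma> \<tau> \<partial>lborel \<partial>lborel)"
    unfolding G2_def J_def using s(1) by (subst nn_integral_cmult, measurable, subst nn_integral_multc) auto
  have 3: "ennreal r * I = (\<integral>\<^sup>+\<sigma>. \<integral>\<^sup>+\<tau>. G3 \<sigma> \<tau> \<partial>lborel \<partial>lborel)"
    unfolding G3_def I_def using r(1) by (subst nn_integral_cmult, measurable, subst nn_integral_multc) (auto simp: mult.commute)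
  have "(\<integral>\<^sup>+\<tau>\<in>{0<..<r}. (\<integral>\<^sup>+\<sigma>\<in>{0<..<s}. min (A \<sigma>) (B \<tau>) \<partial>lborel) \<partial>lborel) =
    (\<integral>\<^sup>+\<tau>. \<integral>\<^sup>+\<sigma>. G4 \<sigma> \<tau> \<partial>lborel \<partial>lborel)"
    unfolding G4_def by (subst nn_integral_multc) auto
  also have "\<dots> = (\<integral>\<^sup>+\<sigma>. \<integral>\<^sup>+\<tau>. G4 \<sigma> \<tau> \<partial>lborel \<partial>lborel)"
    by (rule lborel_pair.Fubini') simp
  finally have 4: "(\<integral>\<^sup>+\<tau>\<in>{0<..<r}. (\<integral>\<^sup>+\<sigma>\<in>{0<..<s}. min (A \<sigma>) (B \<tau>) \<partial>lborel) \<partial>lborel) =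
    (\<integral>\<^sup>+\<sigma>. \<integral>\<^sup>+\<tau>. G4 \<sigma> \<tau> \<partial>lborel \<partial>lborel)" .
  have "I * J + ennreal t * (ennreal s * J + ennreal r * I +
      (\<integral>\<^sup>+\<tau>\<in>{0<..<r}. (\<integral>\<^sup>+\<sigma>\<in>{0<..<s}. min (A \<sigma>) (B \<tau>) \<partial>lborel) \<partial>lborel)) =
    (\<integral>\<^sup>+\<sigma>. \<integral>\<^sup>+\<tau>. G1 \<sigma> \<tau> + ennreal t * (G2 \<sigma> \<tau> + G3 \<sigma> \<tau> + G4 \<sigma> \<tau>) \<partial>lborel \<partial>lborel)"
    unfolding 1 2 3 4 by (simp add: nn_integral_add nn_integral_cmult)
  also have "\<dots> \<le> (\<integral>\<^sup>+\<sigma>. \<integral>\<^sup>+\<tau>. ennreal t * (indicator {0<..} \<sigma> * (truncation_kernel (ennreal t) (A \<sigma>) (B \<tau>) * indicator {0<..} \<tau>)) \<partial>lborel \<partial>lborel)"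
  proof (intro nn_integral_mono)
    fix \<sigma> \<tau> :: real
    show "G1 \<sigma> \<tau> + ennreal t * (G2 \<sigma> \<tau> + G3 \<sigma> \<tau> + G4 \<sigma> \<tau>) \<le>
       ennreal t * (indicator {0<..} \<sigma> * (truncation_kernel (ennreal t) (A \<sigma>) (B \<tau>) * indicator {0<..} \<tau>))"
    proof (cases "0 < \<sigma> \<and> 0 < \<tau>")
      case False then show ?thesis using s(1) r(1) by (auto simp: G indicator_def)
    next
      case True
      then obtain a b where ab: "A \<sigma> = ennreal a" "0 \<le> a" "B \<tau> = ennreal b" "0 \<le> b"
        using fin(1)[of \<sigma>] fin(2)[of \<tau>] by (cases "A \<sigma>"; cases "B \<tau>") auto
      have sa: "s < \<sigma> \<Longrightarrow> a \<le> t" "\<sigma> < s \<Longrightarrow> t < a" and rb: "r < \<tau> \<Longrightarrow> b \<le> t" "\<tau> < r \<Longrightarrow> t < b"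
        using s(2,3)[of \<sigma>] r(2,3)[of \<tau>] ab t True by (auto simp: ennreal_less_iff)
      have K: "truncation_kernel (ennreal t) (A \<sigma>) (B \<tau>) = ennreal (a * b / max t (max a b))"
        unfolding ab by (rule truncation_kernel_real) (use t ab in auto)
      consider "\<sigma> = s \<or> \<tau> = r" | "s < \<sigma>" "r < \<tau>" | "\<sigma> < s" "r < \<tau>" | "s < \<sigma>" "\<tau> < r" | "\<sigma> < s" "\<tau> < r"
        by linarith
      then show ?thesis
      proof cases
        case 1 then show ?thesis by (auto simp: G indicator_def)
      next
        case 2 
        then have eq: "max t (max a b) = t" using sa rb by (simp add: max_def)
        show ?thesis using 2 True t ab K[unfolded eq] by (simp add: G ennreal_mult[symmetric])
      next
        case 3
        then have "a * b / max t (max a b) = b" using sa rb t by (auto simp: max_def)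
        then show ?thesis using 3 True t ab K by (simp add: G ennreal_mult[symmetric])
      next
        case 4
        then have "a * b / max t (max a b) = a" using sa rb t by (auto simp: max_def)
        then show ?thesis using 4 True t ab K by (simp add: G ennreal_mult[symmetric])
      next
        case 5
        then have "a * b / max t (max a b) = min a b" using sa rb t by (auto simp: max_def min_def)
        then show ?thesis using 5 True t ab K by (simp add: G ennreal_mult[symmetric] min_def)
      qed
    qed
  qed
  also have "\<dots> = ennreal t * (\<integral>\<^sup>+\<sigma>\<in>{0<..}. (\<integral>\<^sup>+\<tau>\<in>{0<..}. truncation_kernel (ennreal t) (A \<sigma>) (B \<tau>) \<partial>lborel) \<partial>lborel)"
    by (simp add: nn_integral_cmult mult.commute)
  finally show ?thesis .
qed

end

section \<open>Lorentz norms\<close>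

lemma epowr_ennreal [simp]: "0 \<le> x \<Longrightarrow> epowr (ennreal x) r = ennreal (x powr r)"
  by (simp add: epowr_def)

lemma epowr_top [simp]: "epowr top r = top"
  by (simp add: epowr_def)

lemma epowr_0 [simp]: "epowr 0 r = 0"
  by (simp add: epowr_def)

lemma epowr_1 [simp]: "epowr 1 r = 1"
  by (simp add: epowr_def)

lemma epowr_one_right [simp]: "epowr x 1 = x"
  by (cases x) (auto simp: powr_one_gt_zero_iff)

lemma epowr_eq_top_iff [simp]: "epowr x r = top \<longleftrightarrow> x = top"
  by (cases x) auto

lemma epowr_eq_0_iff [simp]: "epowr x r = 0 \<longleftrightarrow> x = 0"
  by (cases x) auto

lemma epowr_mono: "x \<le> y \<Longrightarrow> 0 \<le> r \<Longrightarrow> epowr x r \<le> epowr y r"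
  by (cases x; cases y) (auto intro!: ennreal_leI powr_mono2 simp: top_unique)

text \<open>Both 0 and infinity are fixed by every exponent, also by 0 and by negative ones, so the
  power laws hold for all real exponents; the price is that \<open>epowr x 0\<close> differs from 1
  at these two values.\<close>

lemma epowr_mult: "epowr (x * y) r = epowr x r * epowr y r"
proof (cases "x = top \<or> y = top")
  case True then show ?thesis by (auto simp: ennreal_mult_top ennreal_top_mult)
next
  case False
  then obtain a b where "x = ennreal a" "0 \<le> a" "y = ennreal b" "0 \<le> b" by (cases x; cases y) auto
  then show ?thesis by (simp add: ennreal_mult[symmetric] powr_mult)
qed

lemma epowr_epowr: "epowr (epowr x r) s = epowr x (r * s)"
  by (cases x) (auto simp: powr_powr)

lemma epowr_add: "epowr x (r + s) = epowr x r * epowr x s"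
  by (cases x) (auto simp: powr_add ennreal_mult[symmetric])

lemma measurable_epowr [measurable (raw)]:
  assumes [measurable]: "f \<in> borel_measurable N"
  shows "(\<lambda>x. epowr (f x) r) \<in> borel_measurable N"
  unfolding epowr_def by measurable

text \<open>Young's inequality for X / i and Y / j, where i and j are the two integrals, integrated
  over the space. A vanishing integral makes the product of the powers vanish almost everywhere; an
  infinite one next to a nonzero one makes the bound trivial.\<close>

lemma nn_integral_Holder:
  assumes [measurable]: "X \<in> borel_measurable N" "Y \<in> borel_measurable N" and \<theta>: "0 < \<theta>" "\<theta> < 1"
  shows "(\<integral>\<^sup>+x. epowr (X x) \<theta> * epowr (Y x) (1 - \<theta>) \<partial>N) \<le>
    epowr (\<integral>\<^sup>+x. X x \<partial>N) \<theta> * epowr (\<integral>\<^sup>+x. Y x \<partial>N) (1 - \<theta>)"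
proof -
  consider "(\<integral>\<^sup>+x. X x \<partial>N) = 0 \<or> (\<integral>\<^sup>+x. Y x \<partial>N) = 0"
    | "(\<integral>\<^sup>+x. X x \<partial>N) = top" "(\<integral>\<^sup>+x. Y x \<partial>N) \<noteq> 0"
    | "(\<integral>\<^sup>+x. X x \<partial>N) \<noteq> 0" "(\<integral>\<^sup>+x. Y x \<partial>N) = top"
    | i j where "(\<integral>\<^sup>+x. X x \<partial>N) = ennreal i" "(\<integral>\<^sup>+x. Y x \<partial>N) = ennreal j" "0 < i" "0 < j"
    by (cases "\<integral>\<^sup>+x. X x \<partial>N"; cases "\<integral>\<^sup>+x. Y x \<partial>N") (auto simp: less_le)
  then show ?thesis
  proof cases
    case 1
    then have "AE x in N. X x = 0 \<or> Y x = 0"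
      by (auto simp: nn_integral_0_iff_AE)
    then have "(\<integral>\<^sup>+x. epowr (X x) \<theta> * epowr (Y x) (1 - \<theta>) \<partial>N) = 0"
      by (subst nn_integral_0_iff_AE) auto
    then show ?thesis by simp
  next
    case 2 then show ?thesis by (simp add: ennreal_top_mult)
  next
    case 3 then show ?thesis by (simp add: ennreal_mult_top)
  next
    case (4 i j)
    \<comment> \<open>\<open>k\<close> is the claimed bound; with the coefficients k\<theta> / i and
      k(1 - \<theta>) / j the pointwise majorant integrates to k\<theta> + k(1 - \<theta>) =
      k.\<close>
    define k where "k = i powr \<theta> * j powr (1 - \<theta>)"
    have k: "0 < k" using 4 by (simp add: k_def)
    have pw: "epowr (X x) \<theta> * epowr (Y x) (1 - \<theta>) \<le>
      ennreal (k * \<theta> / i) * X x + ennreal (k * (1 - \<theta>) / j) * Y x" for x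
    proof (cases "X x = top \<or> Y x = top")
      case True
      then have "ennreal (k * \<theta> / i) * X x + ennreal (k * (1 - \<theta>) / j) * Y x = top"
        using k 4 \<theta> by (auto simp: ennreal_mult_top)
      then show ?thesis by (simp only: top_greatest)
    next
      case False
      then obtain a b where ab: "X x = ennreal a" "0 \<le> a" "Y x = ennreal b" "0 \<le> b"
        by (cases "X x"; cases "Y x") auto
      show ?thesis
      proof (cases "a = 0 \<or> b = 0")
        case False
        then have "(a / i) powr \<theta> * (b / j) powr (1 - \<theta>) \<le> \<theta> * (a / i) + (1 - \<theta>) * (b / j)"
          using 4 ab \<theta> by (intro Youngs_inequality_0) auto
        then have "k * ((a / i) powr \<theta> * (b / j) powr (1 - \<theta>)) \<le> k * (\<theta> * (a / i) + (1 - \<theta>) * (b / j))"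
          using k by (intro mult_left_mono) auto
        also have "k * ((a / i) powr \<theta> * (b / j) powr (1 - \<theta>)) = a powr \<theta> * b powr (1 - \<theta>)"
          using 4 ab by (simp add: k_def powr_divide)
        also have "k * (\<theta> * (a / i) + (1 - \<theta>) * (b / j)) = k * \<theta> / i * a + k * (1 - \<theta>) / j * b"
          by (simp add: algebra_simps)
        finally have "ennreal (a powr \<theta> * b powr (1 - \<theta>)) \<le> ennreal (k * \<theta> / i * a + k * (1 - \<theta>) / j * b)"
          by (rule ennreal_leI)
        then show ?thesis
          using k 4 \<theta> ab by (simp add: ennreal_mult[symmetric] del: times_divide_eq_left)
      qed (use ab \<theta> in auto)
    qed
    have "(\<integral>\<^sup>+x. epowr (X x) \<theta> * epowr (Y x) (1 - \<theta>) \<partial>N) \<le>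
      (\<integral>\<^sup>+x. ennreal (k * \<theta> / i) * X x + ennreal (k * (1 - \<theta>) / j) * Y x \<partial>N)"
      by (intro nn_integral_mono pw)
    also have "\<dots> = ennreal (k * \<theta> / i) * ennreal i + ennreal (k * (1 - \<theta>) / j) * ennreal j"
      using 4 by (simp add: nn_integral_add nn_integral_cmult)
    also have "\<dots> = ennreal k"
      using 4 k \<theta> by (simp add: ennreal_mult[symmetric] ennreal_plus[symmetric] field_simps del: ennreal_plus)
    also have "\<dots> = epowr (\<integral>\<^sup>+x. X x \<partial>N) \<theta> * epowr (\<integral>\<^sup>+x. Y x \<partial>N) (1 - \<theta>)"
      using 4 by (simp add: k_def ennreal_mult)
    finally show ?thesis .
  qed
qed

text \<open>Write w g as the product of (w g^q)^(1/q) and w^(1 - 1/q) and apply Hoelder's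
  inequality; the second factor contributes a power of the integral of w, which is 1.\<close>

lemma nn_integral_Jensen_epowr:
  assumes [measurable]: "w \<in> borel_measurable N" "g \<in> borel_measurable N"
    and w: "(\<integral>\<^sup>+x. w x \<partial>N) = 1" and q: "1 \<le> q"
  shows "epowr (\<integral>\<^sup>+x. w x * g x \<partial>N) q \<le> (\<integral>\<^sup>+x. w x * epowr (g x) q \<partial>N)"
proof (cases "q = 1")
  case False
  then have q1: "1 < q" using q by simp
  have "w x * g x = epowr (w x * epowr (g x) q) (1 / q) * epowr (w x) (1 - 1 / q)" for x
  proof -
    have "w x = epowr (w x) (1 / q) * epowr (w x) (1 - 1 / q)"
      by (subst epowr_add[symmetric]) simp
    then show ?thesis using q1 by (simp add: epowr_mult epowr_epowr mult_ac)
  qed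
  then have "(\<integral>\<^sup>+x. w x * g x \<partial>N) \<le> epowr (\<integral>\<^sup>+x. w x * epowr (g x) q \<partial>N) (1 / q)"
    using nn_integral_Holder[of "\<lambda>x. w x * epowr (g x) q" N w "1 / q"] q1 w by simp
  then have "epowr (\<integral>\<^sup>+x. w x * g x \<partial>N) q \<le> epowr (epowr (\<integral>\<^sup>+x. w x * epowr (g x) q \<partial>N) (1 / q)) q"
    using q1 by (intro epowr_mono) auto
  then show ?thesis using q1 by (simp add: epowr_epowr)
qed simp

section \<open>Norms for the measure dt / t on the positive half-line\<close>

definition log_measure :: "real measure" where
  "log_measure = density lborel (\<lambda>t. ennreal (1 / t) * indicator {0<..} t)"

lemma sets_log_measure [measurable_cong, simp]: "sets log_measure = sets borel"
  by (simp add: log_measure_def)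

lemma nn_integral_log_measure:
  assumes [measurable]: "h \<in> borel_measurable borel"
  shows "(\<integral>\<^sup>+t. h t \<partial>log_measure) = (\<integral>\<^sup>+t\<in>{0<..}. h t * ennreal (1 / t) \<partial>lborel)"
  unfolding log_measure_def by (subst nn_integral_density) (auto simp: mult_ac)

lemma AE_log_measure_pos: "AE t in log_measure. 0 < t"
  unfolding log_measure_def by (subst AE_density) (auto simp: indicator_def)

text \<open>The L^q norm for dt / t, except that q = \<infinity> takes a true supremum instead of an
  essential one, in accordance with \<open>lorentz_norm\<close>.\<close>

definition log_norm :: "ennreal \<Rightarrow> (real \<Rightarrow> ennreal) \<Rightarrow> ennreal" where
  "log_norm q F = (if q = \<infinity> then (SUP t\<in>{0<..}. F t)
     else epowr (\<integral>\<^sup>+t. epowr (F t) (enn2real q) \<partial>log_measure) (1 / enn2real q))"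

lemma log_norm_top: "log_norm top F = (SUP t\<in>{0<..}. F t)"
  by (simp add: log_norm_def)

lemma log_norm_real: "0 \<le> q \<Longrightarrow> log_norm (ennreal q) F = epowr (\<integral>\<^sup>+t. epowr (F t) q \<partial>log_measure) (1 / q)"
  by (simp add: log_norm_def)

lemma epowr_log_norm_real:
  "0 < q \<Longrightarrow> epowr (log_norm (ennreal q) F) q = (\<integral>\<^sup>+t. epowr (F t) q \<partial>log_measure)"
  by (simp add: log_norm_real epowr_epowr)

lemma log_norm_mono:
  assumes "\<And>t. 0 < t \<Longrightarrow> F t \<le> G t"
  shows "log_norm q F \<le> log_norm q G"
proof -
  have "(\<integral>\<^sup>+t. epowr (F t) (enn2real q) \<partial>log_measure) \<le> (\<integral>\<^sup>+t. epowr (G t) (enn2real q) \<partial>log_measure)"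
    using AE_log_measure_pos
    by (intro nn_integral_mono_AE) (auto elim!: eventually_mono intro!: epowr_mono assms)
  then show ?thesis using assms
    by (auto simp: log_norm_def intro!: epowr_mono SUP_subset_mono)
qed

lemma log_norm_cmult:
  assumes [measurable]: "F \<in> borel_measurable borel" and q: "1 \<le> q"
  shows "log_norm q (\<lambda>t. c * F t) = c * log_norm q F"
proof (cases q)
  case top
  then show ?thesis by (simp add: log_norm_top SUP_mult_left_ennreal)
next
  case (real r)
  then have r: "1 \<le> r" using q by (simp add: ennreal_1[symmetric] del: ennreal_1)
  then show ?thesis unfolding real
    by (simp add: log_norm_real epowr_mult nn_integral_cmult epowr_epowr)
qed

lemma nn_integral_powr_from_0:
  assumes "0 < a" "0 \<le> c"
  shows "(\<integral>\<^sup>+t\<in>{0<..c}. ennreal (t powr (a - 1)) \<partial>lborel) = ennreal (c powr a / a)"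
proof -
  have "((\<lambda>t. t powr (a - 1)) has_integral (c powr (a - 1 + 1) / (a - 1 + 1))) {0..c}"
    using assms by (intro has_integral_powr_from_0) auto
  then have "(\<integral>\<^sup>+t. indicator {0..c} t * ennreal (t powr (a - 1)) \<partial>lborel) = ennreal (c powr a / a)"
    by (subst nn_integral_has_integral_lebesgue[symmetric, where f = "\<lambda>t. t powr (a - 1)" and \<Omega> = "{0..c}"])
       (auto intro!: nn_integral_cong simp: indicator_def)
  moreover have "(\<integral>\<^sup>+t\<in>{0<..c}. ennreal (t powr (a - 1)) \<partial>lborel) =
      (\<integral>\<^sup>+t. indicator {0..c} t * ennreal (t powr (a - 1)) \<partial>lborel)"
    by (intro nn_integral_cong) (auto simp: indicator_def)
  ultimately show ?thesis by simp
qed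

text \<open>Normalised as a probability density on [t, \<infinity>), which is the form in which
  Jensen's inequality uses it in the proof of Hardy's inequality.\<close>

lemma nn_integral_powr_tail:
  assumes "0 < a" "0 < t"
  shows "(\<integral>\<^sup>+u\<in>{t..}. ennreal (a * t powr a * u powr (- a - 1)) \<partial>lborel) = 1"
proof -
  have "(\<integral>\<^sup>+u. ennreal (a * t powr a * (if 0 < u then u powr (- a - 1) else 0)) * indicator {t..} u \<partial>lborel) =
    ennreal (0 - (- (t powr a * t powr (- a))))"
  proof (rule nn_integral_FTC_atLeast[where F = "\<lambda>u. - (t powr a * u powr (- a))"])
    show "((\<lambda>u. - (t powr a * u powr (- a))) has_real_derivative
       a * t powr a * (if 0 < u then u powr (- a - 1) else 0)) (at u)" if "t \<le> u" for u
    proof -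
      have "((\<lambda>u. u powr (- a)) has_real_derivative - a * u powr (- a - 1)) (at u)"
        using that assms by (intro has_real_derivative_powr) auto
      from DERIV_cmult[OF this, of "- (t powr a)"] show ?thesis
        using that assms by (simp add: mult_ac)
    qed
    have "((\<lambda>u. u powr (- a)) \<longlongrightarrow> 0) at_top" using assms by (intro tendsto_neg_powr filterlim_ident) auto
    then show "((\<lambda>u. - (t powr a * u powr (- a))) \<longlongrightarrow> 0) at_top"
      using tendsto_mult_left[of "\<lambda>u. u powr (- a)" 0 at_top "- (t powr a)"] by simp
  qed (use assms in auto)
  also have "t powr a * t powr (- a) = 1" using assms by (simp add: powr_add[symmetric])
  finally show ?thesis using assms
    by (subst (asm) nn_integral_cong[where v = "\<lambda>u. ennreal (a * t powr a * u powr (- a - 1)) * indicator {t..} u"])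
       (auto simp: indicator_def)
qed

text \<open>The function on the left is 1 / a times the average of g(u) = u^(a+1) G(u) for the
  probability density a t^a u^(-a-1) on u \<ge> t. Jensen's inequality moves the power inside the
  average; integrating the kernel over 0 < t \<le> u against dt / t then gives exactly 1 / u, so
  averaging is a contraction for every q. The constant 1 / a becomes p0 in the application.\<close>

lemma log_norm_Hardy:
  assumes a: "0 < a" and [measurable]: "G \<in> borel_measurable borel" and q: "1 \<le> q"
  shows "log_norm q (\<lambda>t. ennreal (t powr a) * (\<integral>\<^sup>+u\<in>{t..}. G u \<partial>lborel)) \<le>
    ennreal (1 / a) * log_norm q (\<lambda>u. ennreal (u powr (a + 1)) * G u)"
proof -
  define g where "g u = ennreal (u powr (a + 1)) * G u" for u
  define w where "w t u = ennreal (a * t powr a * u powr (- a - 1)) * indicator {t..} u" for t u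
  have [measurable]: "g \<in> borel_measurable borel" "\<And>t. w t \<in> borel_measurable borel"
    unfolding g_def w_def by measurable
  have w1: "(\<integral>\<^sup>+u. w t u \<partial>lborel) = 1" if "0 < t" for t
    unfolding w_def using that a by (rule nn_integral_powr_tail[rotated])
  have H: "ennreal (t powr a) * (\<integral>\<^sup>+u\<in>{t..}. G u \<partial>lborel) = ennreal (1 / a) * (\<integral>\<^sup>+u. w t u * g u \<partial>lborel)"
    if t: "0 < t" for t
  proof -
    have "(\<integral>\<^sup>+u. w t u * g u \<partial>lborel) = (\<integral>\<^sup>+u. ennreal (a * t powr a) * (G u * indicator {t..} u) \<partial>lborel)"
    proof (intro nn_integral_cong)
      fix u
      have "u powr (- a - 1) * u powr (a + 1) = 1" if "t \<le> u"
        using that t by (simp add: powr_add[symmetric])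
      then have "ennreal (u powr (- a - 1)) * ennreal (u powr (a + 1)) = 1" if "t \<le> u"
        using that by (simp add: ennreal_mult[symmetric])
      then have "t \<le> u \<Longrightarrow> ennreal (u powr (- a - 1)) * (ennreal (u powr (a + 1)) * G u) = G u"
        by (simp add: mult.assoc[symmetric])
      then show "w t u * g u = ennreal (a * t powr a) * (G u * indicator {t..} u)"
        using a by (auto simp: w_def g_def indicator_def ennreal_mult mult.assoc)
    qed
    also have "\<dots> = ennreal (a * t powr a) * (\<integral>\<^sup>+u\<in>{t..}. G u \<partial>lborel)"
      by (rule nn_integral_cmult) measurable
    finally show ?thesis using a
      by (simp add: mult.assoc[symmetric] ennreal_mult[symmetric])
  qed
  \<comment> \<open>Joint measurability in t and u, which Fubini's theorem requires, becomes visible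
    once the moving indicator is written as a condition.\<close>
  have wm [measurable (raw)]: "(\<lambda>x. w (f x) (h x)) \<in> borel_measurable N"
    if [measurable]: "f \<in> borel_measurable N" "h \<in> borel_measurable N" for f h and N :: "'z measure"
  proof -
    have "(\<lambda>x. w (f x) (h x)) = (\<lambda>x. ennreal (a * f x powr a * h x powr (- a - 1)) * (if f x \<le> h x then 1 else 0))"
      by (auto simp: w_def indicator_def)
    then show ?thesis by simp
  qed
  have "log_norm q (\<lambda>t. \<integral>\<^sup>+u. w t u * g u \<partial>lborel) \<le> log_norm q g"
  proof (cases q)
    case top
    have "(\<integral>\<^sup>+u. w t u * g u \<partial>lborel) \<le> (SUP u\<in>{0<..}. g u)" if t: "0 < t" for t
    proof -
      have "(\<integral>\<^sup>+u. w t u * g u \<partial>lborel) \<le> (\<integral>\<^sup>+u. w t u * (SUP u\<in>{0<..}. g u) \<partial>lborel)"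
        using t by (intro nn_integral_mono) (auto simp: w_def indicator_def intro!: mult_left_mono SUP_upper)
      also have "\<dots> = (SUP u\<in>{0<..}. g u)" using w1[OF t] by (subst nn_integral_multc) auto
      finally show ?thesis .
    qed
    then show ?thesis by (auto simp: top log_norm_top intro!: SUP_least)
  next
    case (real r)
    then have r: "1 \<le> r" using q by (simp add: ennreal_1[symmetric] del: ennreal_1)
    have "(\<integral>\<^sup>+t. epowr (\<integral>\<^sup>+u. w t u * g u \<partial>lborel) r \<partial>log_measure) \<le>
       (\<integral>\<^sup>+t. (\<integral>\<^sup>+u. w t u * epowr (g u) r \<partial>lborel) \<partial>log_measure)"
      using AE_log_measure_pos
    proof (intro nn_integral_mono_AE, elim eventually_mono)
      fix t :: real assume "0 < t"
      then show "epowr (\<integral>\<^sup>+u. w t u * g u \<partial>lborel) r \<le> (\<integral>\<^sup>+u. w t u * epowr (g u) r \<partial>lborel)"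
        using r w1 by (intro nn_integral_Jensen_epowr) auto
    qed
    also have "\<dots> = (\<integral>\<^sup>+t. \<integral>\<^sup>+u. w t u * epowr (g u) r * ennreal (1 / t) * indicator {0<..} t \<partial>lborel \<partial>lborel)"
      by (subst nn_integral_log_measure, measurable, subst nn_integral_multc[symmetric], measurable,
          subst nn_integral_multc[symmetric], measurable)
    also have "\<dots> = (\<integral>\<^sup>+u. \<integral>\<^sup>+t. w t u * epowr (g u) r * ennreal (1 / t) * indicator {0<..} t \<partial>lborel \<partial>lborel)"
      by (rule lborel_pair.Fubini') simp
    also have "\<dots> = (\<integral>\<^sup>+u\<in>{0<..}. epowr (g u) r * ennreal (1 / u) \<partial>lborel)"
    proof (intro nn_integral_cong)
      fix u :: real
      show "(\<integral>\<^sup>+t. w t u * epowr (g u) r * ennreal (1 / t) * indicator {0<..} t \<partial>lborel) =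
        epowr (g u) r * ennreal (1 / u) * indicator {0<..} u"
      proof (cases "0 < u")
        case False
        then have "w t u * epowr (g u) r * ennreal (1 / t) * indicator {0<..} t = 0" for t
          by (auto simp: w_def indicator_def)
        then show ?thesis using False by (simp only:) simp
      next
        case True
        have "(\<integral>\<^sup>+t. w t u * epowr (g u) r * ennreal (1 / t) * indicator {0<..} t \<partial>lborel) =
          (\<integral>\<^sup>+t. epowr (g u) r * ennreal (a * u powr (- a - 1)) * (ennreal (t powr (a - 1)) * indicator {0<..u} t) \<partial>lborel)"
        proof (intro nn_integral_cong)
          fix t :: real
          have "t powr a * (1 / t) = t powr (a - 1)" if "0 < t"
            using that by (simp add: powr_diff)
          then have "0 < t \<Longrightarrow> ennreal (t powr a) * ennreal (1 / t) = ennreal (t powr (a - 1))"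
            by (simp add: ennreal_mult[symmetric])
          moreover have "t \<le> u \<Longrightarrow> w t u = ennreal (a * u powr (- a - 1)) * ennreal (t powr a)"
            using a by (simp add: w_def ennreal_mult[symmetric] mult_ac)
          ultimately have "0 < t \<Longrightarrow> t \<le> u \<Longrightarrow> w t u * epowr (g u) r * ennreal (1 / t) =
            epowr (g u) r * ennreal (a * u powr (- a - 1)) * ennreal (t powr (a - 1))"
            by (metis mult.assoc mult.commute)
          then show "w t u * epowr (g u) r * ennreal (1 / t) * indicator {0<..} t =
            epowr (g u) r * ennreal (a * u powr (- a - 1)) * (ennreal (t powr (a - 1)) * indicator {0<..u} t)"
            by (auto simp: w_def indicator_def)
        qed
        also have "\<dots> = epowr (g u) r * ennreal (a * u powr (- a - 1)) * ennreal (u powr a / a)"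
          using True a by (subst nn_integral_cmult, measurable, subst nn_integral_powr_from_0) auto
        also have "\<dots> = epowr (g u) r * ennreal (1 / u)"
        proof -
          have "a * u powr (- a - 1) * (u powr a / a) = u powr (- a - 1 + a)"
            using a by (subst powr_add) simp
          also have "\<dots> = 1 / u" using True by (simp add: powr_minus_divide)
          finally show ?thesis using a True by (simp add: mult.assoc ennreal_mult[symmetric])
        qed
        finally show ?thesis using True by simp
      qed
    qed
    also have "\<dots> = (\<integral>\<^sup>+u. epowr (g u) r \<partial>log_measure)"
      by (rule nn_integral_log_measure[symmetric]) measurable
    finally show ?thesis unfolding real using r by (auto simp: log_norm_real intro!: epowr_mono)
  qed
  then have "ennreal (1 / a) * log_norm q (\<lambda>t. \<integral>\<^sup>+u. w t u * g u \<partial>lborel) \<le> ennreal (1 / a) * log_norm q g"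
    by (rule mult_left_mono) simp
  moreover have "log_norm q (\<lambda>t. ennreal (t powr a) * (\<integral>\<^sup>+u\<in>{t..}. G u \<partial>lborel)) \<le>
     log_norm q (\<lambda>t. ennreal (1 / a) * (\<integral>\<^sup>+u. w t u * g u \<partial>lborel))"
    by (intro log_norm_mono) (simp add: H)
  moreover have "\<dots> = ennreal (1 / a) * log_norm q (\<lambda>t. \<integral>\<^sup>+u. w t u * g u \<partial>lborel)"
    by (rule log_norm_cmult) (use q in measurable)
  moreover have "(\<lambda>u. ennreal (u powr (a + 1)) * G u) = g" by (simp add: g_def fun_eq_iff)
  ultimately show ?thesis by simp
qed

text \<open>The source of the constant 3: each factor of a product is embedded once, at a cost of at
  most exp(1/2), and exp(1/2)^2 = e \<le> 3.\<close>

lemma self_powr_inverse_le: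
  assumes "1 \<le> q" "1 \<le> (p::real)"
  shows "(q / p) powr (1 / q) \<le> exp (1 / 2)"
proof -
  have "ln (q / p) \<le> ln q" using assms by (intro ln_mono) (auto simp: field_simps)
  \<comment> \<open>The tangent to the logarithm at 2 is used; the tangent at 1 would only give the
    bound e, whose square exceeds 3.\<close>
  also have "ln q = ln 2 + ln (q / 2)" using assms by (simp add: ln_div)
  also have "ln (q / 2) \<le> q / 2 - 1" using assms by (intro ln_le_minus_one) auto
  also have "ln 2 \<le> (1::real)" using ln_le_minus_one[of 2] by simp
  finally have "ln (q / p) \<le> q / 2" by simp
  then have "1 / q * ln (q / p) \<le> 1 / 2" using assms by (simp add: field_simps)
  then show ?thesis using assms by (simp add: powr_def)
qed

text \<open>Since b(u) \<ge> b(t) for u \<le> t, the integral of the q-th power over (0, t] is at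
  least b(t)^q t^(q/p) / (q/p), which is p/q times the q-th power of t^(1/p) b(t).\<close>

lemma log_norm_embedding_top:
  assumes p: "1 \<le> p" and q: "1 \<le> q" and [measurable]: "b \<in> borel_measurable borel"
    and anti: "\<And>s t. 0 < s \<Longrightarrow> s \<le> t \<Longrightarrow> b t \<le> b s"
  shows "log_norm top (\<lambda>t. ennreal (t powr (1 / p)) * b t) \<le>
    ennreal (exp (1 / 2)) * log_norm (ennreal q) (\<lambda>t. ennreal (t powr (1 / p)) * b t)"
proof -
  define F where "F t = ennreal (t powr (1 / p)) * b t" for t
  have [measurable]: "F \<in> borel_measurable borel" unfolding F_def by measurable
  have "F t \<le> ennreal (exp (1 / 2)) * log_norm (ennreal q) F" if t: "0 < t" for t
  proof -
    have "epowr (b t) q * ennreal (t powr (q / p) / (q / p)) = epowr (b t) q * (\<integral>\<^sup>+u\<in>{0<..t}. ennreal (u powr (q / p - 1)) \<partial>lborel)"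
      using p q t by (subst nn_integral_powr_from_0) auto
    also have "\<dots> = (\<integral>\<^sup>+u. epowr (b t) q * (ennreal (u powr (q / p - 1)) * indicator {0<..t} u) \<partial>lborel)"
      by (rule nn_integral_cmult[symmetric]) measurable
    also have "\<dots> \<le> (\<integral>\<^sup>+u\<in>{0<..}. epowr (F u) q * ennreal (1 / u) \<partial>lborel)"
    proof (intro nn_integral_mono)
      fix u :: real
      show "epowr (b t) q * (ennreal (u powr (q / p - 1)) * indicator {0<..t} u) \<le>
        epowr (F u) q * ennreal (1 / u) * indicator {0<..} u"
      proof (cases "0 < u \<and> u \<le> t")
        case True
        have "u powr (q / p - 1) = (u powr (1 / p)) powr q * (1 / u)"
          using True by (simp add: powr_powr powr_diff)
        then have "ennreal (u powr (q / p - 1)) = epowr (ennreal (u powr (1 / p))) q * ennreal (1 / u)"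
          using True by (simp add: ennreal_mult[symmetric])
        moreover have "epowr (b t) q \<le> epowr (b u) q"
          using True q by (intro epowr_mono anti) auto
        ultimately show ?thesis using True
          by (simp add: F_def epowr_mult mult_ac mult_left_mono del: epowr_ennreal) (simp add: mult_ac mult_right_mono)
      qed (auto simp: indicator_def)
    qed
    also have "\<dots> = epowr (log_norm (ennreal q) F) q"
      using q by (simp add: epowr_log_norm_real nn_integral_log_measure)
    finally have *: "epowr (b t) q * ennreal (t powr (q / p) / (q / p)) \<le> epowr (log_norm (ennreal q) F) q" .
    have "t powr (q / p) = q / p * (t powr (q / p) / (q / p))" using p q by simp
    also have "ennreal \<dots> = ennreal (q / p) * ennreal (t powr (q / p) / (q / p))" using p q by (intro ennreal_mult) auto
    finally have "epowr (F t) q = ennreal (q / p) * (epowr (b t) q * ennreal (t powr (q / p) / (q / p)))"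
      using p q by (simp add: F_def epowr_mult powr_powr mult_ac)
    also have "\<dots> \<le> ennreal (q / p) * epowr (log_norm (ennreal q) F) q"
      by (intro mult_left_mono *) simp
    finally have "epowr (epowr (F t) q) (1 / q) \<le> epowr (ennreal (q / p) * epowr (log_norm (ennreal q) F) q) (1 / q)"
      using q by (intro epowr_mono) auto
    then have "F t \<le> ennreal ((q / p) powr (1 / q)) * log_norm (ennreal q) F"
      using q p by (simp add: epowr_epowr epowr_mult)
    also have "\<dots> \<le> ennreal (exp (1 / 2)) * log_norm (ennreal q) F"
      by (intro mult_right_mono ennreal_leI self_powr_inverse_le p q) simp
    finally show ?thesis .
  qed
  then show ?thesis unfolding log_norm_top F_def by (auto intro!: SUP_least)
qed

text \<open>Interpolate between q and \<infinity>: F^q' = F^(q'-q) F^q, and the first factor is at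
  most (cL)^(q'-q), where L is the norm of index q. Because c \<ge> 1, the remaining L^q may be
  enlarged to (cL)^q, so the constant stays c.\<close>

lemma log_norm_embedding:
  assumes p: "1 \<le> p" and q: "1 \<le> q" "q \<le> q'" and [measurable]: "b \<in> borel_measurable borel"
    and anti: "\<And>s t. 0 < s \<Longrightarrow> s \<le> t \<Longrightarrow> b t \<le> b s"
  shows "log_norm q' (\<lambda>t. ennreal (t powr (1 / p)) * b t) \<le>
    ennreal (exp (1 / 2)) * log_norm q (\<lambda>t. ennreal (t powr (1 / p)) * b t)"
proof -
  define F where "F t = ennreal (t powr (1 / p)) * b t" for t
  have [measurable]: "F \<in> borel_measurable borel" unfolding F_def by measurable
  define c where "c = ennreal (exp (1 / 2))"
  have c1: "1 \<le> c" by (simp add: c_def ennreal_1[symmetric] del: ennreal_1)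
  have "log_norm q' F \<le> c * log_norm q F"
  proof (cases "q' = q")
    case True
    show ?thesis using mult_right_mono[OF c1, of "log_norm q F"] by (simp add: True)
  next
    case False
    then have "q < q'" using q by simp
    then obtain r where r: "q = ennreal r" "0 \<le> r" by (cases q) auto
    have r1: "1 \<le> r" using q r by (simp add: ennreal_1[symmetric] del: ennreal_1)
    have sup: "log_norm top F \<le> c * log_norm q F"
      unfolding F_def c_def r(1) using p r1 by (intro log_norm_embedding_top anti) auto
    show ?thesis
    proof (cases q')
      case top then show ?thesis using sup by simp
    next
      case (real r')
      then have rr: "r < r'" using \<open>q < q'\<close> r by (simp add: ennreal_less_iff)
      let ?L = "log_norm q F"
      have "(\<integral>\<^sup>+t. epowr (F t) r' \<partial>log_measure) \<le> (\<integral>\<^sup>+t. epowr (c * ?L) (r' - r) * epowr (F t) r \<partial>log_measure)"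
        using AE_log_measure_pos
      proof (intro nn_integral_mono_AE, elim eventually_mono)
        fix t :: real assume t: "0 < t"
        have "F t \<le> log_norm top F" unfolding log_norm_top using t by (intro SUP_upper) auto
        then have "epowr (F t) (r' - r) \<le> epowr (c * ?L) (r' - r)"
          using sup rr by (intro epowr_mono) auto
        then have "epowr (F t) (r' - r) * epowr (F t) r \<le> epowr (c * ?L) (r' - r) * epowr (F t) r"
          by (rule mult_right_mono) simp
        then show "epowr (F t) r' \<le> epowr (c * ?L) (r' - r) * epowr (F t) r"
          by (simp add: epowr_add[symmetric])
      qed
      also have "\<dots> = epowr (c * ?L) (r' - r) * epowr ?L r"
        using r r1 by (simp add: nn_integral_cmult epowr_log_norm_real)
      also have "\<dots> \<le> epowr (c * ?L) (r' - r) * epowr (c * ?L) r"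
        using mult_right_mono[OF c1, of ?L] r1 by (intro mult_left_mono epowr_mono) auto
      also have "\<dots> = epowr (c * ?L) r'" by (simp add: epowr_add[symmetric])
      finally have "epowr (\<integral>\<^sup>+t. epowr (F t) r' \<partial>log_measure) (1 / r') \<le> epowr (epowr (c * ?L) r') (1 / r')"
        using rr r1 by (intro epowr_mono) auto
      then show ?thesis using rr r1 by (simp add: real log_norm_real epowr_epowr)
    qed
  qed
  then show ?thesis unfolding F_def c_def .
qed

lemma log_norm_mult_sup_le:
  assumes [measurable]: "F \<in> borel_measurable borel" and q: "1 \<le> q"
  shows "log_norm q (\<lambda>t. F t * G t) \<le> log_norm q F * log_norm top G"
proof -
  have "log_norm q (\<lambda>t. F t * G t) \<le> log_norm q (\<lambda>t. log_norm top G * F t)"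
    by (intro log_norm_mono) (auto simp: log_norm_top mult.commute[of _ "F _"] intro!: mult_left_mono SUP_upper)
  also have "\<dots> = log_norm q F * log_norm top G"
    using q by (subst log_norm_cmult) (auto simp: mult.commute)
  finally show ?thesis .
qed

lemma log_norm_Holder:
  assumes [measurable]: "F \<in> borel_measurable borel" "G \<in> borel_measurable borel"
    and q: "0 < q0" "0 < q1" "0 < q2" "1 / q0 = 1 / q1 + 1 / q2"
  shows "log_norm (ennreal q0) (\<lambda>t. F t * G t) \<le> log_norm (ennreal q1) F * log_norm (ennreal q2) G"
proof -
  define \<theta> where "\<theta> = q0 / q1"
  have \<theta>: "0 < \<theta>" "1 - \<theta> = q0 / q2" using q by (auto simp: \<theta>_def field_simps)
  then have \<theta>1: "\<theta> < 1" using q by (metis diff_gt_0_iff_gt divide_pos_pos)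
  have "epowr (F t * G t) q0 = epowr (epowr (F t) q1) \<theta> * epowr (epowr (G t) q2) (1 - \<theta>)" for t
    using q by (simp add: epowr_epowr epowr_mult \<theta>(2)) (simp add: \<theta>_def)
  then have "(\<integral>\<^sup>+t. epowr (F t * G t) q0 \<partial>log_measure) \<le>
     epowr (\<integral>\<^sup>+t. epowr (F t) q1 \<partial>log_measure) \<theta> * epowr (\<integral>\<^sup>+t. epowr (G t) q2 \<partial>log_measure) (1 - \<theta>)"
    using nn_integral_Holder[of "\<lambda>t. epowr (F t) q1" log_measure "\<lambda>t. epowr (G t) q2" \<theta>] \<theta> \<theta>1 by simp
  then have "epowr (\<integral>\<^sup>+t. epowr (F t * G t) q0 \<partial>log_measure) (1 / q0) \<le>
     epowr (epowr (\<integral>\<^sup>+t. epowr (F t) q1 \<partial>log_measure) \<theta> * epowr (\<integral>\<^sup>+t. epowr (G t) q2 \<partial>log_measure) (1 - \<theta>)) (1 / q0)"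
    using q by (intro epowr_mono) auto
  moreover have "\<theta> * (1 / q0) = 1 / q1" "(1 - \<theta>) * (1 / q0) = 1 / q2"
    using q(1-3) unfolding \<theta>(2) by (auto simp: \<theta>_def)
  ultimately show ?thesis using q(1-3)
    by (simp add: log_norm_real epowr_mult[of "epowr _ _"] epowr_epowr)
qed

text \<open>If q1 or q2 is at most q0, raise that index to q0 and the other to \<infinity>.
  Otherwise keep q1 and raise q2 until Hoelder's inequality is exact. In every case each factor is
  embedded once, so the loss is c * c = e.\<close>

lemma log_norm_mult_le:
  fixes q0 q1 q2 :: ennreal
  assumes p: "1 \<le> p1" "1 \<le> p2" and q: "1 \<le> q0" "1 \<le> q1" "1 \<le> q2" and qq: "1 / q0 \<le> 1 / q1 + 1 / q2"
    and [measurable]: "b1 \<in> borel_measurable borel" "b2 \<in> borel_measurable borel"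
    and anti: "\<And>s t. 0 < s \<Longrightarrow> s \<le> t \<Longrightarrow> b1 t \<le> b1 s" "\<And>s t. 0 < s \<Longrightarrow> s \<le> t \<Longrightarrow> b2 t \<le> b2 s"
  defines "F1 \<equiv> \<lambda>t. ennreal (t powr (1 / p1)) * b1 t" and "F2 \<equiv> \<lambda>t. ennreal (t powr (1 / p2)) * b2 t"
  shows "log_norm q0 (\<lambda>t. F1 t * F2 t) \<le> 3 * log_norm q1 F1 * log_norm q2 F2"
proof -
  define c where "c = ennreal (exp (1 / 2))"
  have c1: "1 \<le> c" by (simp add: c_def ennreal_1[symmetric] del: ennreal_1)
  have c3: "c * c \<le> 3"
  proof -
    have "exp (1 / 2) * exp (1 / 2) = exp (1::real)" by (simp add: exp_add[symmetric])
    also have "\<dots> \<le> 3" by (rule exp_le)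
    finally have "ennreal (exp (1 / 2) * exp (1 / 2)) \<le> ennreal 3" by (rule ennreal_leI)
    then show ?thesis by (simp add: c_def ennreal_mult)
  qed
  have [measurable]: "F1 \<in> borel_measurable borel" "F2 \<in> borel_measurable borel"
    unfolding F1_def F2_def by measurable
  have e1: "log_norm r F1 \<le> c * log_norm q1 F1" if "q1 \<le> r" for r
    unfolding F1_def c_def using that by (intro log_norm_embedding p q anti) auto
  have e2: "log_norm r F2 \<le> c * log_norm q2 F2" if "q2 \<le> r" for r
    unfolding F2_def c_def using that by (intro log_norm_embedding p q anti) auto
  have fin: "?thesis" if "log_norm q0 (\<lambda>t. F1 t * F2 t) \<le> log_norm r1 F1 * log_norm r2 F2" "q1 \<le> r1" "q2 \<le> r2" for r1 r2
  proof -
    have "log_norm r1 F1 * log_norm r2 F2 \<le> (c * log_norm q1 F1) * (c * log_norm q2 F2)"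
      by (intro mult_mono e1 e2 that) auto
    also have "\<dots> = (c * c) * (log_norm q1 F1 * log_norm q2 F2)" by (simp add: mult_ac)
    also have "\<dots> \<le> 3 * (log_norm q1 F1 * log_norm q2 F2)" by (rule mult_right_mono[OF c3]) simp
    finally show ?thesis using that(1) by (simp add: mult_ac)
  qed
  consider "q1 \<le> q0" | "q2 \<le> q0" | "q0 < q1" "q0 < q2" by force
  then show ?thesis
  proof cases
    case 1
    show ?thesis by (rule fin[of q0 top]) (use 1 q in \<open>auto intro!: log_norm_mult_sup_le\<close>)
  next
    case 2
    show ?thesis
      by (rule fin[of top q0], subst mult.commute[of "log_norm top F1"], subst mult.commute[of "F1 _"])
         (use 2 q in \<open>auto intro!: log_norm_mult_sup_le\<close>)
  next
    case 3
    have ne: "q1 \<noteq> top" "q2 \<noteq> top" "q0 \<noteq> top"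
    proof -
      show "q0 \<noteq> top" using 3 by auto
      then obtain r0 where r0: "q0 = ennreal r0" "1 \<le> r0"
        using q by (cases q0) (auto simp: ennreal_1[symmetric] simp del: ennreal_1)
      \<comment> \<open>If one of q1, q2 were infinite, \<open>qq\<close> would compare 1 / q0 with
        the reciprocal of the other alone, although q0 is smaller than both.\<close>
      have *: False if "1 / q0 \<le> 1 / s" "q0 < s" for s
      proof (cases s)
        case top then show ?thesis using that r0 by (simp add: divide_ennreal_def ennreal_inverse_eq_0_iff top_unique)
      next
        case (real r)
        then show ?thesis using that r0
          by (simp add: ennreal_1[symmetric] divide_ennreal ennreal_less_iff field_simps del: ennreal_1)
      qed
      show "q1 \<noteq> top" using *[of q2] qq 3 by auto
      show "q2 \<noteq> top" using *[of q1] qq 3 by auto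
    qed
    then obtain r0 r1 r2 where r: "q0 = ennreal r0" "q1 = ennreal r1" "q2 = ennreal r2" "1 \<le> r0" "1 \<le> r1" "1 \<le> r2"
      using q by (cases q0; cases q1; cases q2) (auto simp: ennreal_1[symmetric] simp del: ennreal_1)
    have r01: "r0 < r1" using 3 r by (simp add: ennreal_less_iff)
    have rr: "1 / r0 \<le> 1 / r1 + 1 / r2"
      using qq r by (simp add: ennreal_1[symmetric] divide_ennreal ennreal_plus[symmetric] del: ennreal_1 ennreal_plus)
    \<comment> \<open>The index with 1 / q0 = 1 / q1 + 1 / r2'. It is positive because q0 < q1, and
      at least q2 by \<open>rr\<close>.\<close>
    define r2' where "r2' = 1 / (1 / r0 - 1 / r1)"
    have pos: "0 < 1 / r0 - 1 / r1" using r01 r by (simp add: field_simps)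
    have "1 / r2' \<le> 1 / r2" "0 < r2'" using rr pos by (auto simp: r2'_def)
    then have r2': "r2 \<le> r2'" using r by (simp add: field_simps)
    show ?thesis
    proof (rule fin[of q1 "ennreal r2'"])
      show "log_norm q0 (\<lambda>t. F1 t * F2 t) \<le> log_norm q1 F1 * log_norm (ennreal r2') F2"
        unfolding r using r pos by (intro log_norm_Holder) (auto simp: r2'_def)
    qed (use r2' r in \<open>auto intro: ennreal_leI\<close>)
  qed
qed

section \<open>Lorentz norms and the size of Lorentz functions\<close>

lemma lorentz_norm_log_norm:
  assumes [measurable]: "max_rearrangement M f \<in> borel_measurable borel"
  shows "lorentz_norm M p q f = log_norm q (\<lambda>t. ennreal (t powr (1 / p)) * max_rearrangement M f t)"
  by (simp add: lorentz_norm_def log_norm_def nn_integral_log_measure)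

lemma max_rearrangement_nonpos: "t \<le> 0 \<Longrightarrow> max_rearrangement M f t = 0"
  by (simp add: max_rearrangement_def ennreal_neg divide_nonneg_nonpos)

text \<open>Visible on level integrals: for each d the quotient min(t, d) / t decreases in t. This
  monotonicity is all that the embeddings ask of the function.\<close>

lemma max_rearrangement_antimono:
  assumes [measurable]: "f \<in> borel_measurable (completion M)" and st: "0 < s" "s \<le> t"
  shows "max_rearrangement M f t \<le> max_rearrangement M f s"
proof -
  let ?D = "superlevel (completion M) (\<lambda>x. ennreal (cmod (f x)))"
  have pw: "ennreal (1 / t) * min (ennreal t) d \<le> ennreal (1 / s) * min (ennreal s) d" for d
  proof (cases d)
    case top
    then show ?thesis using st by (simp add: ennreal_mult[symmetric])
  next
    case (real r)
    have "1 / t * min t r \<le> 1 / s * min s r"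
      using st real mult_left_mono[of s t r] by (auto simp: min_def field_simps)
    then have "ennreal (1 / t * min t r) \<le> ennreal (1 / s * min s r)" by (rule ennreal_leI)
    moreover have "min (ennreal v) (ennreal r) = ennreal (min v r)" if "0 < v" for v
      using that real by (auto simp: min_def)
    ultimately show ?thesis using real st by (simp add: ennreal_mult[symmetric])
  qed
  have eq: "max_rearrangement M f u = (\<integral>\<^sup>+\<sigma>\<in>{0<..}. (ennreal (1 / u) * min (ennreal u) (?D \<sigma>)) \<partial>lborel)" if "0 < u" for u
    using that by (simp add: max_rearrangement_level_integral level_integral_def nn_integral_cmult[symmetric] mult.assoc)
  show ?thesis using st by (simp add: eq) (intro nn_integral_mono mult_right_mono pw, auto)
qed

lemma measurable_max_rearrangement [measurable]:
  assumes "f \<in> borel_measurable (completion M)"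
  shows "max_rearrangement M f \<in> borel_measurable borel"
proof (rule borel_measurableI_greater)
  fix c
  have "is_interval {t \<in> space borel. c < max_rearrangement M f t}"
    unfolding is_interval_1
  proof safe
    fix a b x assume "c < max_rearrangement M f a" "c < max_rearrangement M f b" "a \<le> x" "x \<le> b"
    moreover have "0 < a" using calculation(1) max_rearrangement_nonpos[of a M f] by (cases "0 < a") auto
    ultimately show "c < max_rearrangement M f x"
      using max_rearrangement_antimono[OF assms, of x b] by (auto intro: less_le_trans)
  qed auto
  then show "{t \<in> space borel. c < max_rearrangement M f t} \<in> sets borel"
    by (rule real_interval_borel_measurable)
qed

text \<open>Hardy's inequality with a = 1 / p0 costs p0 and raises the power of u to 1 / p0 + 1 = 1
  / p1 + 1 / p2, which splits exactly between the two factors.\<close>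

lemma lorentz_norm_bilinear_bound:
  assumes [measurable]: "f \<in> borel_measurable (completion M)" "g \<in> borel_measurable (completion M)"
      "h \<in> borel_measurable (completion M)"
    and p: "1 \<le> p1" "1 \<le> p2" "1 < 1 / p1 + 1 / p2" "1 / p0 = 1 / p1 + 1 / p2 - 1"
    and q: "1 \<le> q0" "1 \<le> q1" "1 \<le> q2" "1 / q0 \<le> 1 / q1 + 1 / q2"
    and le: "\<And>t. 0 < t \<Longrightarrow> max_rearrangement M h t \<le>
      (\<integral>\<^sup>+u\<in>{t..}. max_rearrangement M f u * max_rearrangement M g u \<partial>lborel)"
  shows "lorentz_norm M p0 q0 h \<le> ennreal (3 * p0) * lorentz_norm M p1 q1 f * lorentz_norm M p2 q2 g"
proof -
  have "0 < 1 / p0" using p by linarith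
  then have p0: "0 < p0" by simp
  let ?F = "\<lambda>t. ennreal (t powr (1 / p1)) * max_rearrangement M f t"
  let ?G = "\<lambda>t. ennreal (t powr (1 / p2)) * max_rearrangement M g t"
  have "lorentz_norm M p0 q0 h \<le> log_norm q0 (\<lambda>t. ennreal (t powr (1 / p0)) *
      (\<integral>\<^sup>+u\<in>{t..}. max_rearrangement M f u * max_rearrangement M g u \<partial>lborel))"
    by (subst lorentz_norm_log_norm, measurable, intro log_norm_mono mult_left_mono le) auto
  also have "\<dots> \<le> ennreal (1 / (1 / p0)) * log_norm q0
      (\<lambda>u. ennreal (u powr (1 / p0 + 1)) * (max_rearrangement M f u * max_rearrangement M g u))"
    by (rule log_norm_Hardy) (use p0 q in auto)
  also have "log_norm q0 (\<lambda>u. ennreal (u powr (1 / p0 + 1)) * (max_rearrangement M f u * max_rearrangement M g u)) =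
     log_norm q0 (\<lambda>u. ?F u * ?G u)"
  proof -
    have "ennreal (u powr (1 / p0 + 1)) = ennreal (u powr (1 / p1)) * ennreal (u powr (1 / p2))" for u
      by (simp add: p(4) powr_add ennreal_mult[symmetric])
    then show ?thesis by (simp add: mult_ac)
  qed
  also have "1 / (1 / p0) = p0" by simp
  also have "ennreal p0 * log_norm q0 (\<lambda>u. ?F u * ?G u) \<le>
      ennreal p0 * (3 * log_norm q1 ?F * log_norm q2 ?G)"
    using p q by (intro mult_mono log_norm_mult_le max_rearrangement_antimono) (auto intro: max_rearrangement_antimono)
  also have "\<dots> = ennreal (3 * p0) * lorentz_norm M p1 q1 f * lorentz_norm M p2 q2 g"
    using p0 by (simp add: lorentz_norm_log_norm ennreal_mult mult_ac)
  finally show ?thesis .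
qed

text \<open>Embedding into the space of second index \<infinity>. The qualitative finiteness
  statements about Lorentz functions below all come from this power bound.\<close>

lemma lorentz_space_decay:
  assumes f: "f \<in> lorentz_space M p q" and pq: "1 \<le> p" "1 \<le> q"
  obtains C where "0 \<le> C" "\<And>t. 0 < t \<Longrightarrow> max_rearrangement M f t \<le> ennreal (C * t powr (- 1 / p))"
proof -
  have [measurable]: "f \<in> borel_measurable (completion M)" and fin: "lorentz_norm M p q f < \<infinity>"
    using f by (auto simp: lorentz_space_def)
  let ?F = "\<lambda>t. ennreal (t powr (1 / p)) * max_rearrangement M f t"
  have "log_norm top ?F \<le> ennreal (exp (1 / 2)) * log_norm q ?F"
    using pq by (intro log_norm_embedding max_rearrangement_antimono) auto
  also have "\<dots> < \<infinity>" using fin by (simp add: lorentz_norm_log_norm ennreal_mult_less_top)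
  finally obtain C where C: "log_norm top ?F = ennreal C" "0 \<le> C"
    by (cases "log_norm top ?F") auto
  have "max_rearrangement M f t \<le> ennreal (C * t powr (- 1 / p))" if t: "0 < t" for t
  proof -
    have "?F t \<le> ennreal C" unfolding C(1)[symmetric] log_norm_top using t by (intro SUP_upper) auto
    then have "ennreal (t powr (- 1 / p)) * ?F t \<le> ennreal (t powr (- 1 / p)) * ennreal C"
      by (intro mult_left_mono) auto
    moreover have "ennreal (t powr (- 1 / p)) * ?F t = max_rearrangement M f t"
    proof -
      have "t powr (- 1 / p) * t powr (1 / p) = 1" using t by (simp add: powr_add[symmetric])
      then have "ennreal (t powr (- 1 / p)) * ennreal (t powr (1 / p)) = 1"
        by (simp add: ennreal_mult[symmetric])
      then show ?thesis by (simp add: mult.assoc[symmetric])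
    qed
    ultimately show ?thesis using C(2) by (simp add: ennreal_mult[symmetric] mult.commute)
  qed
  then show thesis using C(2) by (rule that[rotated])
qed

lemma level_integral_max_rearrangement:
  assumes [measurable]: "f \<in> borel_measurable (completion M)" and "0 < t"
  shows "level_integral (completion M) (\<lambda>x. ennreal (cmod (f x))) (ennreal t) = ennreal t * max_rearrangement M f t"
  using \<open>0 < t\<close>
  by (simp add: max_rearrangement_level_integral mult.assoc[symmetric] ennreal_mult[symmetric])

lemma level_integral_lorentz_finite:
  assumes f: "f \<in> lorentz_space M p q" and pq: "1 \<le> p" "1 \<le> q" and t: "0 < t"
  shows "level_integral (completion M) (\<lambda>x. ennreal (cmod (f x))) (ennreal t) < \<infinity>"
proof -
  have [measurable]: "f \<in> borel_measurable (completion M)" using f by (auto simp: lorentz_space_def)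
  obtain C where C: "\<And>t. 0 < t \<Longrightarrow> max_rearrangement M f t \<le> ennreal (C * t powr (- 1 / p))"
    using lorentz_space_decay[OF f pq] by blast
  show ?thesis using t C[OF t]
    by (auto simp: level_integral_max_rearrangement ennreal_mult_less_top intro: le_less_trans)
qed

text \<open>If the level set at height s had infinite measure, the maximal rearrangement would be at
  least s everywhere, against its decay at infinity.\<close>

lemma levels_finite_lorentz:
  assumes f: "f \<in> lorentz_space M p q" and pq: "1 \<le> p" "1 \<le> q"
  shows "levels_finite (completion M) (\<lambda>x. ennreal (cmod (f x)))"
  unfolding levels_finite_def
proof (intro allI impI, rule ccontr)
  let ?D = "superlevel (completion M) (\<lambda>x. ennreal (cmod (f x)))"
  fix s :: real assume s: "0 < s" and "\<not> ?D s < \<infinity>"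
  then have top: "?D s = top" by (simp add: less_top[symmetric])
  have [measurable]: "f \<in> borel_measurable (completion M)" using f by (auto simp: lorentz_space_def)
  obtain C where C: "0 \<le> C" "\<And>t. 0 < t \<Longrightarrow> max_rearrangement M f t \<le> ennreal (C * t powr (- 1 / p))"
    using lorentz_space_decay[OF f pq] by blast
  have bound: "s \<le> C * t powr (- 1 / p)" if t: "0 < t" for t
  proof -
    have "ennreal s = ennreal (1 / t) * (\<integral>\<^sup>+\<sigma>. ennreal t * indicator {0<..s} \<sigma> \<partial>lborel)"
      using s t by (subst nn_integral_cmult_indicator) (auto simp: ennreal_mult[symmetric])
    also have "\<dots> \<le> ennreal (1 / t) * level_integral (completion M) (\<lambda>x. ennreal (cmod (f x))) (ennreal t)"
      unfolding level_integral_def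
    proof (intro mult_left_mono nn_integral_mono)
      fix \<sigma> :: real
      have "?D \<sigma> = top" if "\<sigma> \<le> s"
        using superlevel_antimono[of "\<lambda>x. ennreal (cmod (f x))" "completion M" \<sigma> s] that top by (simp add: top_unique)
      then show "ennreal t * indicator {0<..s} \<sigma> \<le> min (ennreal t) (?D \<sigma>) * indicator {0<..} \<sigma>"
        by (auto simp: indicator_def)
    qed simp
    also have "\<dots> = max_rearrangement M f t" using t by (simp add: max_rearrangement_level_integral)
    also have "\<dots> \<le> ennreal (C * t powr (- 1 / p))" by (rule C(2)[OF t])
    finally show ?thesis using C(1) by (simp add: ennreal_le_iff)
  qed
  have "\<forall>\<^sub>F t in at_top. s \<le> C * t powr (- 1 / p)"
    by (rule eventually_mono[OF eventually_gt_at_top[of 0] bound])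
  moreover have "((\<lambda>t. C * t powr (- 1 / p)) \<longlongrightarrow> C * 0) at_top"
    using pq by (intro tendsto_mult_left tendsto_neg_powr filterlim_ident) auto
  ultimately have "s \<le> C * 0"
    by (intro tendsto_lowerbound[where f = "\<lambda>t. C * t powr (- 1 / p)"]) auto
  then show False using s by simp
qed

text \<open>The two power bounds multiply to u^(-1/p1 - 1/p2), integrable at infinity because 1 / p1
  + 1 / p2 > 1. This finiteness gives the existence of the convolution almost everywhere.\<close>

lemma max_rearrangement_product_integral_finite:
  assumes f: "f \<in> lorentz_space M p1 q1" and g: "g \<in> lorentz_space M p2 q2"
    and pq: "1 \<le> p1" "1 \<le> q1" "1 \<le> p2" "1 \<le> q2" "1 < 1 / p1 + 1 / p2" and t: "0 < t"
  shows "(\<integral>\<^sup>+u\<in>{t..}. max_rearrangement M f u * max_rearrangement M g u \<partial>lborel) < \<infinity>"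
proof -
  define a where "a = 1 / p1 + 1 / p2 - 1"
  have a: "0 < a" using pq by (simp add: a_def)
  obtain C where C: "0 \<le> C" "\<And>t. 0 < t \<Longrightarrow> max_rearrangement M f t \<le> ennreal (C * t powr (- 1 / p1))"
    using lorentz_space_decay[OF f pq(1,2)] by blast
  obtain D where D: "0 \<le> D" "\<And>t. 0 < t \<Longrightarrow> max_rearrangement M g t \<le> ennreal (D * t powr (- 1 / p2))"
    using lorentz_space_decay[OF g pq(3,4)] by blast
  \<comment> \<open>Chosen so that C D u^(-a-1) is c times the probability density of
    \<open>nn_integral_powr_tail\<close>; the majorant then integrates to c.\<close>
  define c where "c = C * D / (a * t powr a)"
  have c: "0 \<le> c" "C * D = c * (a * t powr a)" using a t C D by (auto simp: c_def)
  have "(\<integral>\<^sup>+u\<in>{t..}. max_rearrangement M f u * max_rearrangement M g u \<partial>lborel) \<le>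
     (\<integral>\<^sup>+u. ennreal c * (ennreal (a * t powr a * u powr (- a - 1)) * indicator {t..} u) \<partial>lborel)"
  proof (intro nn_integral_mono)
    fix u :: real
    show "max_rearrangement M f u * max_rearrangement M g u * indicator {t..} u \<le>
      ennreal c * (ennreal (a * t powr a * u powr (- a - 1)) * indicator {t..} u)"
    proof (cases "t \<le> u")
      case True
      then have u: "0 < u" using t by simp
      have "max_rearrangement M f u * max_rearrangement M g u \<le>
         ennreal (C * u powr (- 1 / p1)) * ennreal (D * u powr (- 1 / p2))"
        by (intro mult_mono C D u) auto
      also have "\<dots> = ennreal ((C * D) * (u powr (- 1 / p1) * u powr (- 1 / p2)))"
        using C D by (simp add: ennreal_mult[symmetric] mult_ac)
      also have "u powr (- 1 / p1) * u powr (- 1 / p2) = u powr (- a - 1)"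
        by (simp add: powr_add[symmetric] a_def)
      also have "(C * D) * u powr (- a - 1) = c * (a * t powr a * u powr (- a - 1))"
        unfolding c(2) by (simp add: mult_ac)
      finally show ?thesis using True c(1) a by (simp add: ennreal_mult)
    qed auto
  qed
  also have "\<dots> = ennreal c"
    using nn_integral_powr_tail[OF a t] by (subst nn_integral_cmult) auto
  finally show ?thesis by (auto intro: le_less_trans)
qed

section \<open>The weak topology on positive measures\<close>

lemma sets_to_measure [simp, measurable_cong]: "sets (to_measure \<mu>) = sets borel"
  unfolding to_measure_def by (subst sets_measure_of) (auto simp: sets.sigma_sets_eq[of borel, simplified])

lemma space_to_measure [simp]: "space (to_measure \<mu>) = UNIV"
  by (simp add: to_measure_def)

lemma positive_measures_bounded_regular: "\<mu> \<in> positive_measures \<Longrightarrow> \<mu> \<in> bounded_regular_measures"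
  by (simp add: positive_measures_def)

lemma positive_measures_nonneg:
  "\<mu> \<in> positive_measures \<Longrightarrow> 0 \<le> Re (\<mu> A)" "\<mu> \<in> positive_measures \<Longrightarrow> Im (\<mu> A) = 0"
  by (auto simp: positive_measures_def complex_nonneg_Reals_iff)

lemma emeasure_to_measure:
  assumes \<mu>: "\<mu> \<in> positive_measures" and A: "A \<in> sets borel"
  shows "emeasure (to_measure \<mu>) A = ennreal (Re (\<mu> A))"
proof (rule emeasure_measure_of[OF to_measure_def])
  have add: "(\<lambda>i. \<mu> (A i)) sums \<mu> (\<Union>i. A i)"
    if "range A \<subseteq> sets borel" "disjoint_family A" for A :: "nat \<Rightarrow> 'a set"
    using \<mu> that by (auto simp: positive_measures_def bounded_regular_measures_def)
  \<comment> \<open>Additivity on the constant sequence of empty sets forces \<mu>({}) = 0, since a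
    convergent series of equal terms has zero terms.\<close>
  have "(\<lambda>i::nat. \<mu> {}) sums \<mu> (\<Union>i::nat. {})"
    by (rule add) (auto simp: disjoint_family_on_def)
  then have "\<mu> {} = 0" by (auto dest: sums_summable simp: summable_const_iff)
  then show "positive (sets (to_measure \<mu>)) (\<lambda>A. ennreal (Re (\<mu> A)))"
    by (simp add: positive_def)
  show "countably_additive (sets (to_measure \<mu>)) (\<lambda>A. ennreal (Re (\<mu> A)))"
  proof (rule countably_additiveI)
    fix A :: "nat \<Rightarrow> 'a set"
    assume "range A \<subseteq> sets (to_measure \<mu>)" "disjoint_family A"
    then have "(\<lambda>i. Re (\<mu> (A i))) sums Re (\<mu> (\<Union>i. A i))"
      by (intro sums_Re add) auto
    then have "(\<lambda>i. ennreal (Re (\<mu> (A i)))) sums ennreal (Re (\<mu> (\<Union>i. A i)))"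
      using positive_measures_nonneg(1)[OF \<mu>] by (subst sums_ennreal) auto
    then show "(\<Sum>i. ennreal (Re (\<mu> (A i)))) = ennreal (Re (\<mu> (\<Union>i. A i)))"
      by (rule sums_unique[symmetric])
  qed
qed (use A in auto)

lemma finite_measure_to_measure:
  assumes "\<mu> \<in> positive_measures" shows "finite_measure (to_measure \<mu>)"
  by (rule finite_measureI) (simp add: emeasure_to_measure assms)

lemma bounded_regular_measures_regular:
  assumes "\<mu> \<in> bounded_regular_measures" "A \<in> sets borel" "0 < \<epsilon>"
  obtains C U where "compact C" "open U" "C \<subseteq> A" "A \<subseteq> U"
    "\<And>B. B \<in> sets borel \<Longrightarrow> B \<subseteq> U - C \<Longrightarrow> cmod (\<mu> B) < \<epsilon>"
proof -
  have "\<forall>A\<in>sets borel. \<forall>\<epsilon>>0. \<exists>C U. compact C \<and> open U \<and> C \<subseteq> A \<and> A \<subseteq> U \<and>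
      (\<forall>B\<in>sets borel. B \<subseteq> U - C \<longrightarrow> cmod (\<mu> B) < \<epsilon>)"
    using assms(1) by (simp add: bounded_regular_measures_def)
  then have "\<exists>C U. compact C \<and> open U \<and> C \<subseteq> A \<and> A \<subseteq> U \<and>
      (\<forall>B\<in>sets borel. B \<subseteq> U - C \<longrightarrow> cmod (\<mu> B) < \<epsilon>)"
    using assms(2,3) by simp
  then show thesis using that by metis
qed

lemma bounded_regular_measures_lincomb:
  assumes \<mu>: "\<mu> \<in> bounded_regular_measures" and \<nu>: "\<nu> \<in> bounded_regular_measures"
  shows "(\<lambda>A. a * \<mu> A + b * \<nu> A) \<in> bounded_regular_measures"
proof -
  have reg: "\<exists>C U. compact C \<and> open U \<and> C \<subseteq> A \<and> A \<subseteq> U \<and>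
      (\<forall>B\<in>sets borel. B \<subseteq> U - C \<longrightarrow> cmod (a * \<mu> B + b * \<nu> B) < \<epsilon>)"
    if A: "A \<in> sets borel" and \<epsilon>: "0 < \<epsilon>" for A and \<epsilon> :: real
  proof -
    \<comment> \<open>The summand 1 keeps the denominator positive and makes the final estimate
      strict.\<close>
    define d where "d = \<epsilon> / (cmod a + cmod b + 1)"
    have d: "0 < d" using \<epsilon> by (simp add: d_def add_nonneg_pos)
    obtain C1 U1 where 1: "compact C1" "open U1" "C1 \<subseteq> A" "A \<subseteq> U1"
      "\<And>B. B \<in> sets borel \<Longrightarrow> B \<subseteq> U1 - C1 \<Longrightarrow> cmod (\<mu> B) < d"
      using bounded_regular_measures_regular[OF \<mu> A d] by metis
    obtain C2 U2 where 2: "compact C2" "open U2" "C2 \<subseteq> A" "A \<subseteq> U2"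
      "\<And>B. B \<in> sets borel \<Longrightarrow> B \<subseteq> U2 - C2 \<Longrightarrow> cmod (\<nu> B) < d"
      using bounded_regular_measures_regular[OF \<nu> A d] by metis
    have "cmod (a * \<mu> B + b * \<nu> B) < \<epsilon>" if B: "B \<in> sets borel" "B \<subseteq> (U1 \<inter> U2) - (C1 \<union> C2)" for B
    proof -
      have "cmod (a * \<mu> B + b * \<nu> B) \<le> cmod a * cmod (\<mu> B) + cmod b * cmod (\<nu> B)"
        by (rule norm_triangle_le) (simp add: norm_mult)
      also have "\<dots> \<le> cmod a * d + cmod b * d"
      proof (intro add_mono mult_left_mono)
        have "B \<subseteq> U1 - C1" "B \<subseteq> U2 - C2" using B(2) by auto
        then show "cmod (\<mu> B) \<le> d" "cmod (\<nu> B) \<le> d"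
          using 1(5)[OF B(1)] 2(5)[OF B(1)] by (auto intro: less_imp_le)
      qed auto
      also have "\<dots> < (cmod a + cmod b + 1) * d" using d by (simp add: algebra_simps)
      also have "\<dots> = \<epsilon>" using add_nonneg_pos[of "cmod a + cmod b" 1] by (simp add: d_def)
      finally show ?thesis .
    qed
    moreover have "compact (C1 \<union> C2)" "open (U1 \<inter> U2)" "C1 \<union> C2 \<subseteq> A" "A \<subseteq> U1 \<inter> U2"
      using 1(1-4) 2(1-4) by auto
    ultimately show ?thesis by blast
  qed
  show ?thesis
    unfolding bounded_regular_measures_def
  proof (intro CollectI conjI allI impI ballI)
    fix A :: "nat \<Rightarrow> 'a set" assume "range A \<subseteq> sets borel" "disjoint_family A"
    then show "(\<lambda>i. a * \<mu> (A i) + b * \<nu> (A i)) sums (a * \<mu> (\<Union>i. A i) + b * \<nu> (\<Union>i. A i))"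
      using \<mu> \<nu> unfolding bounded_regular_measures_def by (intro sums_add sums_mult) auto
  next
    fix A :: "'a set" assume "A \<notin> sets borel"
    then show "a * \<mu> A + b * \<nu> A = 0" using \<mu> \<nu> by (auto simp: bounded_regular_measures_def)
  qed (rule reg)
qed

lemma dirac_measure_positive: "dirac_measure x \<in> positive_measures"
proof -
  have reg: "\<exists>C U. compact C \<and> open U \<and> C \<subseteq> A \<and> A \<subseteq> U \<and>
      (\<forall>B\<in>sets borel. B \<subseteq> U - C \<longrightarrow> cmod (dirac_measure x B) < \<epsilon>)" if "0 < \<epsilon>" for A and \<epsilon> :: real
  proof (cases "x \<in> A")
    case True
    then show ?thesis using that
      by (intro exI[of _ "{x}"] exI[of _ UNIV]) (auto simp: dirac_measure_def)
  next
    case False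
    then show ?thesis using that
      by (intro exI[of _ "{}"] exI[of _ "- {x}"]) (auto simp: dirac_measure_def)
  qed
  have add: "(\<lambda>i. dirac_measure x (A i)) sums dirac_measure x (\<Union>i. A i)"
    if A: "range A \<subseteq> sets borel" "disjoint_family A" for A :: "nat \<Rightarrow> 'a set"
  proof (cases "x \<in> (\<Union>i. A i)")
    case True
    then obtain i where i: "x \<in> A i" by auto
    then have "x \<notin> A j" if "j \<noteq> i" for j using A(2) that by (auto simp: disjoint_family_on_def)
    then have "(\<lambda>j. dirac_measure x (A j)) = (\<lambda>j. if j = i then 1 else 0)"
      using A(1) i by (auto simp: dirac_measure_def fun_eq_iff)
    moreover have "dirac_measure x (\<Union>i. A i) = 1"
      using True A(1) by (auto simp: dirac_measure_def)
    ultimately show ?thesis using sums_single[of i "\<lambda>_. 1::complex"] by simp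
  qed (auto simp: dirac_measure_def)
  have "dirac_measure x \<in> bounded_regular_measures"
    unfolding bounded_regular_measures_def using reg add by (auto simp: dirac_measure_def)
  then show ?thesis
    by (auto simp: positive_measures_def dirac_measure_def)
qed

lemma dirac_measure_bounded_regular: "dirac_measure x \<in> bounded_regular_measures"
  by (intro positive_measures_bounded_regular dirac_measure_positive)

lemma to_measure_dirac: "to_measure (dirac_measure x) = return borel x"
  by (rule measure_eqI) (simp, simp add: emeasure_to_measure[OF dirac_measure_positive], auto simp: dirac_measure_def indicator_def)

lemma nn_integral_to_measure_lincomb:
  assumes \<mu>: "\<mu> \<in> positive_measures" and \<nu>: "\<nu> \<in> positive_measures" and ab: "0 \<le> a" "0 \<le> b"
    and lc: "(\<lambda>A. of_real a * \<mu> A + of_real b * \<nu> A) \<in> positive_measures"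
    and f: "f \<in> borel_measurable borel"
  shows "(\<integral>\<^sup>+x. f x \<partial>to_measure (\<lambda>A. of_real a * \<mu> A + of_real b * \<nu> A)) =
    ennreal a * (\<integral>\<^sup>+x. f x \<partial>to_measure \<mu>) + ennreal b * (\<integral>\<^sup>+x. f x \<partial>to_measure \<nu>)"
  using f
proof (induction rule: borel_measurable_induct)
  case (cong f g)
  then show ?case by (simp cong: nn_integral_cong)
next
  case (set A)
  then show ?case
    using positive_measures_nonneg[OF \<mu>, of A] positive_measures_nonneg[OF \<nu>, of A] ab
    by (simp add: emeasure_to_measure[OF lc] emeasure_to_measure[OF \<mu>] emeasure_to_measure[OF \<nu>]
        ennreal_mult[symmetric] ennreal_plus[symmetric] del: ennreal_plus)
next
  case (mult u c)
  have "c * (ennreal a * x + ennreal b * y) = ennreal a * (c * x) + ennreal b * (c * y)" for x y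
    by (simp add: algebra_simps)
  with mult show ?case by (simp add: nn_integral_cmult)
next
  case (add u v)
  then show ?case by (simp add: nn_integral_add algebra_simps)
next
  case (seq U)
  have eq: "(\<integral>\<^sup>+x. (SUP i. U i) x \<partial>to_measure \<kappa>) = (SUP i. \<integral>\<^sup>+x. U i x \<partial>to_measure \<kappa>)" for \<kappa> :: "'a set \<Rightarrow> complex"
    unfolding SUP_apply using seq by (intro nn_integral_monotone_convergence_SUP) auto
  have inc: "incseq (\<lambda>i. ennreal c * (\<integral>\<^sup>+x. U i x \<partial>to_measure \<kappa>))" for \<kappa> :: "'a set \<Rightarrow> complex" and c
    using seq(3) by (auto simp: incseq_def le_fun_def intro!: mult_left_mono nn_integral_mono)
  show ?case
    unfolding eq using seq inc by (simp add: SUP_mult_left_ennreal[symmetric] ennreal_SUP_add)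
qed

text \<open>Nonnegative bounded integrands reduce to the nonnegative integral. A bounded f becomes
  nonnegative after adding B, and the total masses, obtained from the constant 1, show that the
  added terms combine in the same way.\<close>

lemma integral_to_measure_lincomb:
  fixes f :: "'a::t2_space \<Rightarrow> real"
  assumes \<mu>: "\<mu> \<in> positive_measures" and \<nu>: "\<nu> \<in> positive_measures" and ab: "0 \<le> a" "0 \<le> b"
    and [measurable]: "f \<in> borel_measurable borel" and bdd: "\<And>x. \<bar>f x\<bar> \<le> B"
  shows "(LINT x|to_measure (\<lambda>A. of_real a * \<mu> A + of_real b * \<nu> A). f x) =
    a * (LINT x|to_measure \<mu>. f x) + b * (LINT x|to_measure \<nu>. f x)"
proof -
  let ?\<kappa> = "\<lambda>A. of_real a * \<mu> A + of_real b * \<nu> A"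
  have lc: "?\<kappa> \<in> positive_measures"
    using bounded_regular_measures_lincomb[of \<mu> \<nu> "of_real a" "of_real b"] \<mu> \<nu> ab
    by (auto simp: positive_measures_def complex_nonneg_Reals_iff)
  have int: "integrable (to_measure \<kappa>) g" if \<kappa>: "\<kappa> \<in> positive_measures" and [measurable]: "g \<in> borel_measurable borel"
      and "\<And>x. \<bar>g x\<bar> \<le> C" for \<kappa> and g :: "'a \<Rightarrow> real" and C
  proof -
    interpret finite_measure "to_measure \<kappa>" by (rule finite_measure_to_measure[OF \<kappa>])
    show ?thesis using that by (intro integrable_const_bound[of _ C]) auto
  qed
  have nn: "(LINT x|to_measure ?\<kappa>. g x) = a * (LINT x|to_measure \<mu>. g x) + b * (LINT x|to_measure \<nu>. g x)"
    if [measurable]: "g \<in> borel_measurable borel" and g: "\<And>x. 0 \<le> g x" "\<And>x. g x \<le> C" for g :: "'a \<Rightarrow> real" and C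
  proof -
    have I: "ennreal (LINT x|to_measure \<kappa>. g x) = (\<integral>\<^sup>+x. ennreal (g x) \<partial>to_measure \<kappa>)"
      if "\<kappa> \<in> positive_measures" for \<kappa>
      using that g by (intro nn_integral_eq_integral[symmetric] int[where C = C]) (auto simp: abs_le_iff order.trans[of _ 0])
    have nonneg: "0 \<le> (LINT x|to_measure \<kappa>. g x)" for \<kappa> by (intro integral_nonneg_AE) (auto simp: g)
    have "ennreal (LINT x|to_measure ?\<kappa>. g x) = ennreal (a * (LINT x|to_measure \<mu>. g x) + b * (LINT x|to_measure \<nu>. g x))"
      using nn_integral_to_measure_lincomb[OF \<mu> \<nu> ab lc, of "\<lambda>x. ennreal (g x)"] ab nonneg
      by (simp add: I[symmetric] \<mu> \<nu> lc ennreal_mult)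
    then show ?thesis using ab nonneg by (subst (asm) ennreal_inj) auto
  qed
  have B: "0 \<le> B" using bdd[of undefined] by linarith
  have mass: "measure (to_measure ?\<kappa>) UNIV = a * measure (to_measure \<mu>) UNIV + b * measure (to_measure \<nu>) UNIV"
    using nn[of "\<lambda>_. 1" 1] by simp
  have shift: "(LINT x|to_measure \<kappa>. f x + B) = (LINT x|to_measure \<kappa>. f x) + measure (to_measure \<kappa>) UNIV * B"
    if "\<kappa> \<in> positive_measures" for \<kappa>
    using that B bdd int[OF that, of f B] int[OF that, of "\<lambda>_. B" B]
    by (subst Bochner_Integration.integral_add) auto
  have "(LINT x|to_measure ?\<kappa>. f x + B) = a * (LINT x|to_measure \<mu>. f x + B) + b * (LINT x|to_measure \<nu>. f x + B)"
  proof (rule nn[where C = "2 * B"])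
    fix x show "0 \<le> f x + B" "f x + B \<le> 2 * B" using bdd[of x] by auto
  qed measurable
  then show ?thesis unfolding shift[OF \<mu>] shift[OF \<nu>] shift[OF lc] mass by (simp add: algebra_simps)
qed

lemma topspace_positive_weak_topology [simp]: "topspace positive_weak_topology = positive_measures"
proof -
  have "positive_measures = {\<mu> \<in> positive_measures. (LINT z|to_measure \<mu>. (\<lambda>_. 0::real) z) \<in> UNIV}" by simp
  moreover have "continuous_on UNIV (\<lambda>_::'a. 0::real)" "bounded (range (\<lambda>_::'a. 0::real))" "open (UNIV :: real set)" by auto
  ultimately show ?thesis
    unfolding positive_weak_topology_def topology_generated_by_topspace by blast
qed

lemma openin_positive_weak_topology:
  assumes "continuous_on UNIV f" "bounded (range f)" "open (U :: real set)"
  shows "openin positive_weak_topology {\<mu> \<in> positive_measures. (LINT z|to_measure \<mu>. f z) \<in> U}"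
  unfolding positive_weak_topology_def using assms by (intro topology_generated_by_Basis) auto

text \<open>The generating sets are only a subbasis; induction over the generated topology yields
  neighbourhoods given by finitely many test functions and one common \<epsilon>.\<close>

lemma positive_weak_topology_neighbourhood:
  assumes G: "openin positive_weak_topology G" and \<nu>: "\<nu> \<in> G"
  shows "\<exists>(\<F> :: ('a::t2_space \<Rightarrow> real) set) \<epsilon>. finite \<F> \<and> 0 < \<epsilon> \<and> (\<forall>f\<in>\<F>. continuous_on UNIV f \<and> bounded (range f)) \<and>
    (\<forall>\<kappa>\<in>positive_measures. (\<forall>f\<in>\<F>. \<bar>(LINT z|to_measure \<kappa>. f z) - (LINT z|to_measure \<nu>. f z)\<bar> < \<epsilon>) \<longrightarrow> \<kappa> \<in> G)"
proof -
  define N where "N \<F> \<epsilon> G \<longleftrightarrow> finite \<F> \<and> 0 < \<epsilon> \<and> (\<forall>f\<in>\<F>. continuous_on UNIV f \<and> bounded (range f)) \<and>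
    (\<forall>\<kappa>\<in>positive_measures. (\<forall>f\<in>\<F>. \<bar>(LINT z|to_measure \<kappa>. f z) - (LINT z|to_measure \<nu>. f z)\<bar> < \<epsilon>) \<longrightarrow> \<kappa> \<in> G)"
    for \<F> :: "('a \<Rightarrow> real) set" and \<epsilon> :: real and G
  have "generate_topology_on {{\<mu> \<in> positive_measures. (LINT z|to_measure \<mu>. f z) \<in> U} | (f :: 'a \<Rightarrow> real) U.
        continuous_on UNIV f \<and> bounded (range f) \<and> open U} G"
    using G unfolding positive_weak_topology_def by (rule openin_topology_generated_by)
  then have "\<exists>\<F> \<epsilon>. N \<F> \<epsilon> G"
    using \<nu>
  proof induction
    case (Int a b)
    then obtain \<F>1 \<epsilon>1 \<F>2 \<epsilon>2 where "N \<F>1 \<epsilon>1 a" "N \<F>2 \<epsilon>2 b" by blast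
    then have "N (\<F>1 \<union> \<F>2) (min \<epsilon>1 \<epsilon>2) (a \<inter> b)" by (auto simp: N_def)
    then show ?case by blast
  next
    case (UN K)
    then obtain k where "k \<in> K" "\<nu> \<in> k" by auto
    then obtain \<F> \<epsilon> where "N \<F> \<epsilon> k" using UN.IH by blast
    then have "N \<F> \<epsilon> (\<Union>K)" using \<open>k \<in> K\<close> by (auto simp: N_def)
    then show ?case by blast
  next
    case (Basis s)
    from Basis.hyps obtain f :: "'a \<Rightarrow> real" where "\<exists>U. s = {\<mu> \<in> positive_measures. (LINT z|to_measure \<mu>. f z) \<in> U} \<and>
        continuous_on UNIV f \<and> bounded (range f) \<and> open U"
      unfolding mem_Collect_eq ..
    then obtain U where *: "s = {\<mu> \<in> positive_measures. (LINT z|to_measure \<mu>. f z) \<in> U} \<and>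
        continuous_on UNIV f \<and> bounded (range f) \<and> open U" ..
    then have f: "continuous_on UNIV f" "bounded (range f)" "open U"
        and s: "s = {\<mu> \<in> positive_measures. (LINT z|to_measure \<mu>. f z) \<in> U}"
      by simp_all
    then obtain \<epsilon> where "0 < \<epsilon>" "ball (LINT z|to_measure \<nu>. f z) \<epsilon> \<subseteq> U"
      using Basis openE by blast
    then have "N {f} \<epsilon> s" using f by (auto simp: N_def s dist_real_def abs_minus_commute subset_iff)
    then show ?case by blast
  qed auto
  then show ?thesis unfolding N_def .
qed

lemma continuous_map_dirac_measure: "continuous_map euclidean positive_weak_topology dirac_measure"
proof -
  have "open {x. (LINT z|to_measure (dirac_measure x). f z) \<in> U}"
    if f: "continuous_on UNIV f" and U: "open U" for f :: "'a \<Rightarrow> real" and U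
  proof -
    have [measurable]: "f \<in> borel_measurable borel" using f by (rule borel_measurable_continuous_onI)
    have "{x. (LINT z|to_measure (dirac_measure x). f z) \<in> U} = f -` U"
      by (auto simp: to_measure_dirac integral_return)
    then show ?thesis using f U by (simp add: continuous_on_open_vimage)
  qed
  then show ?thesis
    unfolding positive_weak_topology_def continuous_on_generated_topo_iff
    unfolding topology_generated_by_topspace[symmetric] positive_weak_topology_def[symmetric]
    by (auto simp: dirac_measure_positive vimage_def)
qed

section \<open>Approximation by finitely supported measures\<close>

lemma lincomb_sum_bounded_regular:
  assumes "finite J" "\<And>j. j \<in> J \<Longrightarrow> \<mu> j \<in> bounded_regular_measures"
  shows "(\<lambda>A. \<Sum>j\<in>J. c j * \<mu> j A) \<in> bounded_regular_measures"
  using assms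
proof (induction J rule: finite_induct)
  case empty
  \<comment> \<open>The zero measure is written as a combination of point masses, which makes
    linearity cover the empty sum.\<close>
  have "(\<lambda>A. 0 * dirac_measure undefined A + 0 * dirac_measure undefined A) \<in> bounded_regular_measures"
    by (intro bounded_regular_measures_lincomb dirac_measure_bounded_regular)
  then show ?case by simp
next
  case (insert j J)
  then have "(\<lambda>A. c j * \<mu> j A + 1 * (\<Sum>j\<in>J. c j * \<mu> j A)) \<in> bounded_regular_measures"
    by (intro bounded_regular_measures_lincomb) auto
  then show ?case using insert by simp
qed

lemma lincomb_sum_positive:
  assumes "finite J" "\<And>j. j \<in> J \<Longrightarrow> \<mu> j \<in> positive_measures" "\<And>j. j \<in> J \<Longrightarrow> 0 \<le> c j"
  shows "(\<lambda>A. \<Sum>j\<in>J. of_real (c j) * \<mu> j A) \<in> positive_measures"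
proof -
  have "(\<lambda>A. \<Sum>j\<in>J. of_real (c j) * \<mu> j A) \<in> bounded_regular_measures"
    using assms by (intro lincomb_sum_bounded_regular positive_measures_bounded_regular)
  moreover have "(\<Sum>j\<in>J. of_real (c j) * \<mu> j A) \<in> \<real>\<^sub>\<ge>\<^sub>0" for A
    using assms positive_measures_nonneg[OF assms(2)]
    by (auto simp: complex_nonneg_Reals_iff intro!: sum_nonneg mult_nonneg_nonneg sum.neutral)
  ultimately show ?thesis by (simp add: positive_measures_def)
qed

lemma integral_to_measure_lincomb_sum:
  fixes f :: "'a::t2_space \<Rightarrow> real"
  assumes "finite J" "\<And>j. j \<in> J \<Longrightarrow> \<mu> j \<in> positive_measures" "\<And>j. j \<in> J \<Longrightarrow> 0 \<le> c j"
    and f: "f \<in> borel_measurable borel" "\<And>x. \<bar>f x\<bar> \<le> B"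
  shows "(LINT x|to_measure (\<lambda>A. \<Sum>j\<in>J. of_real (c j) * \<mu> j A). f x) = (\<Sum>j\<in>J. c j * (LINT x|to_measure (\<mu> j). f x))"
  using assms(1-3)
proof (induction J rule: finite_induct)
  case empty
  have "(LINT x|to_measure (\<lambda>A. of_real 0 * dirac_measure undefined A + of_real 0 * dirac_measure undefined A). f x) =
     0 * (LINT x|to_measure (dirac_measure undefined). f x) + 0 * (LINT x|to_measure (dirac_measure undefined). f x)"
    by (rule integral_to_measure_lincomb[OF dirac_measure_positive dirac_measure_positive _ _ f]) auto
  then show ?case by simp
next
  case (insert j J)
  have "(LINT x|to_measure (\<lambda>A. of_real (c j) * \<mu> j A + of_real 1 * (\<Sum>j\<in>J. of_real (c j) * \<mu> j A)). f x) =
     c j * (LINT x|to_measure (\<mu> j). f x) + 1 * (LINT x|to_measure (\<lambda>A. \<Sum>j\<in>J. of_real (c j) * \<mu> j A). f x)"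
    using insert.prems insert.hyps
    by (intro integral_to_measure_lincomb[OF _ lincomb_sum_positive _ _ f]) auto
  then show ?case using insert by simp
qed

text \<open>Round the values of all test functions to multiples of d. Boundedness leaves finitely
  many cells, and the mass of each is moved to one of its points. Every test function varies by at
  most d on a cell, so the error is at most d times the total mass, which is below
  \<epsilon>.\<close>

lemma finite_support_approximation:
  fixes \<nu> :: "'a::t2_space set \<Rightarrow> complex" and \<F> :: "('a \<Rightarrow> real) set"
  assumes \<nu>: "\<nu> \<in> positive_measures" and \<F>: "finite \<F>" "\<And>f. f \<in> \<F> \<Longrightarrow> continuous_on UNIV f \<and> bounded (range f)"
    and \<epsilon>: "0 < \<epsilon>"
  obtains J :: "'a set" and c :: "'a \<Rightarrow> real" where "finite J" "\<And>w. w \<in> J \<Longrightarrow> 0 \<le> c w"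
    "\<And>f. f \<in> \<F> \<Longrightarrow> \<bar>(\<Sum>w\<in>J. c w * f w) - (LINT z|to_measure \<nu>. f z)\<bar> < \<epsilon>"
proof -
  interpret finite_measure "to_measure \<nu>" by (rule finite_measure_to_measure[OF \<nu>])
  let ?m = "measure (to_measure \<nu>)"
  define d where "d = \<epsilon> / (?m UNIV + 1)"
  have d: "0 < d" using \<epsilon> by (simp add: d_def add_nonneg_pos)
  have [measurable]: "f \<in> borel_measurable borel" if "f \<in> \<F>" for f
    using \<F>(2)[OF that] by (intro borel_measurable_continuous_onI) auto
  \<comment> \<open>The rounded values of all test functions at w; \<open>r\<close> below picks one
    representative of each cell, and \<open>J\<close> collects the representatives.\<close>
  define cell where "cell w = (\<lambda>f\<in>\<F>. \<lfloor>f w / d\<rfloor>)" for w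
  have "finite (range cell)"
  proof (rule finite_subset)
    show "range cell \<subseteq> (\<Pi>\<^sub>E f\<in>\<F>. (\<lambda>w. \<lfloor>f w / d\<rfloor>) ` UNIV)" by (auto simp: cell_def)
    have "finite ((\<lambda>w. \<lfloor>f w / d\<rfloor>) ` UNIV)" if f: "f \<in> \<F>" for f
    proof -
      obtain B where B: "\<And>x. \<bar>f x\<bar> \<le> B" using \<F>(2)[OF f] by (auto simp: bounded_iff)
      have "\<lfloor>f w / d\<rfloor> \<in> {\<lfloor>- B / d\<rfloor>..\<lfloor>B / d\<rfloor>}" for w
      proof -
        have "- B \<le> f w" "f w \<le> B" using B[of w] by auto
        then show ?thesis using d
          unfolding atLeastAtMost_iff by (intro conjI floor_mono divide_right_mono) auto
      qed
      then have "(\<lambda>w. \<lfloor>f w / d\<rfloor>) ` UNIV \<subseteq> {\<lfloor>- B / d\<rfloor>..\<lfloor>B / d\<rfloor>}" by blast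
      then show ?thesis by (rule finite_subset) simp
    qed
    then show "finite (\<Pi>\<^sub>E f\<in>\<F>. (\<lambda>w. \<lfloor>f w / d\<rfloor>) ` UNIV)" by (intro finite_PiE \<F>) auto
  qed
  define r where "r w = (SOME w'. cell w' = cell w)" for w
  have cr: "cell (r w) = cell w" for w unfolding r_def by (rule someI) simp
  have r_cong: "r w = r w'" if "cell w = cell w'" for w w' using that by (simp add: r_def)
  define J where "J = range r"
  have rJ: "r w = w" if "w \<in> J" for w using that r_cong[OF cr] by (auto simp: J_def)
  have finJ: "finite J"
  proof -
    have "J = (\<lambda>k. SOME w'. cell w' = k) ` range cell" by (auto simp: J_def r_def)
    then show ?thesis using \<open>finite (range cell)\<close> by simp
  qed
  define A where "A w = {v. cell v = cell w}" for w
  have A_eq: "A w = (\<Inter>f\<in>\<F>. {v. \<lfloor>f v / d\<rfloor> = \<lfloor>f w / d\<rfloor>})" for w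
    by (auto simp: A_def cell_def restrict_def fun_eq_iff)
  have A [measurable]: "A w \<in> sets borel" for w
  proof -
    have "{v. \<lfloor>f v / d\<rfloor> = \<lfloor>f w / d\<rfloor>} \<in> sets borel" if [simp]: "f \<in> \<F>" for f
    proof -
      have "{v\<in>space borel. \<lfloor>f v / d\<rfloor> = \<lfloor>f w / d\<rfloor>} \<in> sets borel" by measurable
      then show ?thesis by simp
    qed
    then show ?thesis unfolding A_eq using \<F>(1)
      by (cases "\<F> = {}") (auto intro!: sets.finite_INT)
  qed
  have in_A: "v \<in> A w \<longleftrightarrow> w = r v" if "w \<in> J" for v w
    using that rJ[OF that] cr[of v] r_cong[of v w] by (auto simp: A_def)
  define c where "c w = ?m (A w)" for w
  have simple: "f (r v) = (\<Sum>w\<in>J. f w * indicator (A w) v)" for f :: "'a \<Rightarrow> real" and v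
  proof -
    have "(\<Sum>w\<in>J. f w * indicator (A w) v) = (\<Sum>w\<in>J. if w = r v then f w else 0)"
      by (intro sum.cong) (auto simp: in_A indicator_def)
    then show ?thesis using finJ by (simp add: J_def)
  qed
  have step: "(LINT v|to_measure \<nu>. f (r v)) = (\<Sum>w\<in>J. c w * f w)" for f :: "'a \<Rightarrow> real"
  proof -
    have "(LINT v|to_measure \<nu>. f (r v)) = (\<Sum>w\<in>J. LINT v|to_measure \<nu>. f w * indicator (A w) v)"
      unfolding simple by (simp add: Bochner_Integration.integral_sum emeasure_eq_measure)
    then show ?thesis by (simp add: c_def mult.commute)
  qed
  show thesis
  proof (rule that[OF finJ, of c])
    show "0 \<le> c w" for w by (simp add: c_def)
    fix f assume f: "f \<in> \<F>"
    obtain B where B: "\<And>x. \<bar>f x\<bar> \<le> B" using \<F>(2)[OF f] by (auto simp: bounded_iff)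
    have int1: "integrable (to_measure \<nu>) f" using f B by (intro integrable_const_bound[of _ B]) auto
    have rm: "(\<lambda>v. f (r v)) \<in> borel_measurable (to_measure \<nu>)"
      unfolding simple by simp
    then have int2: "integrable (to_measure \<nu>) (\<lambda>v. f (r v))"
      using B by (intro integrable_const_bound[of _ B]) auto
    have close: "\<bar>f (r v) - f v\<bar> \<le> d" for v
    proof -
      have "\<lfloor>f (r v) / d\<rfloor> = \<lfloor>f v / d\<rfloor>"
        using fun_cong[OF cr[of v], of f] f by (simp add: cell_def)
      then have "\<bar>f (r v) / d - f v / d\<bar> \<le> 1" by linarith
      then have "\<bar>(f (r v) - f v) / d\<bar> \<le> 1" by (simp add: diff_divide_distrib)
      then show ?thesis using d by (simp add: abs_divide)
    qed
    have "\<bar>(\<Sum>w\<in>J. c w * f w) - (LINT z|to_measure \<nu>. f z)\<bar> = \<bar>LINT v|to_measure \<nu>. f (r v) - f v\<bar>"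
      unfolding step[symmetric] using int1 int2 by simp
    also have "\<dots> \<le> (LINT v|to_measure \<nu>. \<bar>f (r v) - f v\<bar>)"
      by (rule integral_abs_bound)
    also have "\<dots> \<le> (LINT v|to_measure \<nu>. d)"
      using int1 int2 close by (intro integral_mono) auto
    also have "\<dots> = ?m UNIV * d" by simp
    also have "\<dots> < (?m UNIV + 1) * d" using d by simp
    also have "\<dots> = \<epsilon>" using add_nonneg_pos[of "?m UNIV" 1] by (simp add: d_def)
    finally show "\<bar>(\<Sum>w\<in>J. c w * f w) - (LINT z|to_measure \<nu>. f z)\<bar> < \<epsilon>" .
  qed
qed

section \<open>Weakly continuous linear maps on positive measures\<close>

context
  fixes L :: "('a::t2_space set \<Rightarrow> complex) \<Rightarrow> 'a set \<Rightarrow> complex"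
  assumes linear: "\<And>\<mu> \<nu> a b. \<mu> \<in> bounded_regular_measures \<Longrightarrow> \<nu> \<in> bounded_regular_measures \<Longrightarrow>
      L (\<lambda>A. a * \<mu> A + b * \<nu> A) = (\<lambda>A. a * L \<mu> A + b * L \<nu> A)"
    and cont: "continuous_map positive_weak_topology positive_weak_topology L"
    and mass: "\<And>w. L (dirac_measure w) UNIV = 1"
begin

lemma weakly_continuous_positive: "\<mu> \<in> positive_measures \<Longrightarrow> L \<mu> \<in> positive_measures"
  using cont by (auto simp: continuous_map_def)

lemma linear_sum:
  assumes "finite J" "\<And>j. j \<in> J \<Longrightarrow> \<mu> j \<in> bounded_regular_measures"
  shows "L (\<lambda>A. \<Sum>j\<in>J. c j * \<mu> j A) = (\<lambda>A. \<Sum>j\<in>J. c j * L (\<mu> j) A)"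
  using assms
proof (induction J rule: finite_induct)
  case empty
  have "L (\<lambda>A. 0 * dirac_measure undefined A + 0 * dirac_measure undefined A) =
    (\<lambda>A. 0 * L (dirac_measure undefined) A + 0 * L (dirac_measure undefined) A)"
    by (intro linear dirac_measure_bounded_regular)
  then show ?case by simp
next
  case (insert j J)
  then have "L (\<lambda>A. c j * \<mu> j A + 1 * (\<Sum>j\<in>J. c j * \<mu> j A)) =
    (\<lambda>A. c j * L (\<mu> j) A + 1 * L (\<lambda>A. \<Sum>j\<in>J. c j * \<mu> j A) A)"
    by (intro linear lincomb_sum_bounded_regular) auto
  then show ?case using insert by simp
qed

lemma continuous_integral_dirac_image:
  assumes f: "continuous_on UNIV f" "bounded (range f)"
  shows "continuous_on UNIV (\<lambda>w. LINT z|to_measure (L (dirac_measure w)). f z :: real)"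
proof (subst continuous_on_open_vimage, simp, intro allI impI)
  fix U :: "real set" assume U: "open U"
  have "continuous_map euclidean positive_weak_topology (L \<circ> dirac_measure)"
    by (rule continuous_map_compose[OF continuous_map_dirac_measure cont])
  then have "openin euclidean {w \<in> topspace euclidean. (L \<circ> dirac_measure) w \<in>
      {\<mu> \<in> positive_measures. (LINT z|to_measure \<mu>. f z) \<in> U}}"
    using openin_positive_weak_topology[OF f U] by (rule openin_continuous_map_preimage)
  moreover have "{w \<in> topspace euclidean. (L \<circ> dirac_measure) w \<in>
      {\<mu> \<in> positive_measures. (LINT z|to_measure \<mu>. f z) \<in> U}} = (\<lambda>w. LINT z|to_measure (L (dirac_measure w)). f z) -` U"
    by (auto simp: weakly_continuous_positive dirac_measure_positive)
  ultimately show "open ((\<lambda>w. LINT z|to_measure (L (dirac_measure w)). f z) -` U \<inter> UNIV)" by simp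
qed

text \<open>Weak continuity reduces the identity to finitely supported measures, where it is linearity.\<close>

lemma integral_weakly_continuous_image:
  assumes \<nu>: "\<nu> \<in> positive_measures" and f: "continuous_on UNIV f" "bounded (range (f :: 'a \<Rightarrow> real))"
  shows "(LINT z|to_measure (L \<nu>). f z) = (LINT w|to_measure \<nu>. LINT z|to_measure (L (dirac_measure w)). f z)"
proof (rule ccontr)
  define F where "F w = (LINT z|to_measure (L (dirac_measure w)). f z)" for w
  have [measurable]: "f \<in> borel_measurable borel" using f(1) by (rule borel_measurable_continuous_onI)
  obtain B where B: "\<And>x. \<bar>f x\<bar> \<le> B" using f(2) by (auto simp: bounded_iff)
  have pos: "L (dirac_measure w) \<in> positive_measures" for w
    by (intro weakly_continuous_positive dirac_measure_positive)
  have F: "continuous_on UNIV F" "bounded (range F)"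
  proof -
    show "continuous_on UNIV F" unfolding F_def[abs_def] by (rule continuous_integral_dirac_image[OF f])
    have "0 \<le> B" using B[of undefined] by linarith
    have "\<bar>F w\<bar> \<le> B" for w
    proof -
      interpret prob_space "to_measure (L (dirac_measure w))"
        by (rule prob_spaceI) (simp add: emeasure_to_measure[OF pos] mass)
      have "\<bar>F w\<bar> \<le> expectation (\<lambda>z. \<bar>f z\<bar>)" unfolding F_def by (rule integral_abs_bound)
      also have "\<dots> \<le> expectation (\<lambda>_. B)"
        using B \<open>0 \<le> B\<close> by (intro integral_mono integrable_const_bound[of _ B]) auto
      finally show ?thesis by (simp add: prob_space[simplified])
    qed
    then show "bounded (range F)" by (auto simp: bounded_iff)
  qed
  \<comment> \<open>Half the supposed discrepancy: one \<epsilon> for the distance between the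
    images of \<nu> and \<kappa> tested on f, one for the distance between \<nu> and \<kappa> tested
    on \<open>F\<close>.\<close>
  define \<epsilon> where "\<epsilon> = \<bar>(LINT z|to_measure (L \<nu>). f z) - (LINT w|to_measure \<nu>. F w)\<bar> / 2"
  assume "(LINT z|to_measure (L \<nu>). f z) \<noteq> (LINT w|to_measure \<nu>. LINT z|to_measure (L (dirac_measure w)). f z)"
  then have \<epsilon>: "0 < \<epsilon>" by (simp add: \<epsilon>_def F_def)
  let ?O = "{\<mu> \<in> positive_measures. (LINT z|to_measure \<mu>. f z) \<in> ball (LINT z|to_measure (L \<nu>). f z) \<epsilon>}"
  let ?G = "{\<mu> \<in> topspace positive_weak_topology. L \<mu> \<in> ?O}"
  have "openin positive_weak_topology ?G"
    using cont openin_positive_weak_topology[OF f] by (rule openin_continuous_map_preimage) simp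
  moreover have "\<nu> \<in> ?G" using \<nu> \<epsilon> by (simp add: weakly_continuous_positive)
  ultimately have "\<exists>(\<F> :: ('a \<Rightarrow> real) set) \<epsilon>. finite \<F> \<and> 0 < \<epsilon> \<and> (\<forall>f\<in>\<F>. continuous_on UNIV f \<and> bounded (range f)) \<and>
    (\<forall>\<kappa>\<in>positive_measures. (\<forall>f\<in>\<F>. \<bar>(LINT z|to_measure \<kappa>. f z) - (LINT z|to_measure \<nu>. f z)\<bar> < \<epsilon>) \<longrightarrow> \<kappa> \<in> ?G)"
    by (rule positive_weak_topology_neighbourhood)
  then obtain \<F> :: "('a \<Rightarrow> real) set" where "\<exists>\<epsilon>. finite \<F> \<and> 0 < \<epsilon> \<and> (\<forall>f\<in>\<F>. continuous_on UNIV f \<and> bounded (range f)) \<and>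
    (\<forall>\<kappa>\<in>positive_measures. (\<forall>f\<in>\<F>. \<bar>(LINT z|to_measure \<kappa>. f z) - (LINT z|to_measure \<nu>. f z)\<bar> < \<epsilon>) \<longrightarrow> \<kappa> \<in> ?G)" ..
  then obtain \<delta> where "finite \<F> \<and> 0 < \<delta> \<and> (\<forall>f\<in>\<F>. continuous_on UNIV f \<and> bounded (range f)) \<and>
    (\<forall>\<kappa>\<in>positive_measures. (\<forall>f\<in>\<F>. \<bar>(LINT z|to_measure \<kappa>. f z) - (LINT z|to_measure \<nu>. f z)\<bar> < \<delta>) \<longrightarrow> \<kappa> \<in> ?G)" ..
  then have \<F>: "finite \<F>" "0 < \<delta>" "\<And>f. f \<in> \<F> \<Longrightarrow> continuous_on UNIV f \<and> bounded (range f)"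
    "\<And>\<kappa>. \<kappa> \<in> positive_measures \<Longrightarrow>
       (\<forall>f\<in>\<F>. \<bar>(LINT z|to_measure \<kappa>. f z) - (LINT z|to_measure \<nu>. f z)\<bar> < \<delta>) \<Longrightarrow> \<kappa> \<in> ?G"
    by simp_all
  \<comment> \<open>\<open>F\<close> joins the test functions of the neighbourhood, so that a single
    finitely supported measure serves both estimates.\<close>
  obtain J c where J: "finite J" "\<And>w. w \<in> J \<Longrightarrow> 0 \<le> c w"
    "\<And>g. g \<in> insert F \<F> \<Longrightarrow> \<bar>(\<Sum>w\<in>J. c w * g w) - (LINT z|to_measure \<nu>. g z)\<bar> < min \<epsilon> \<delta>"
    using finite_support_approximation[OF \<nu>, of "insert F \<F>" "min \<epsilon> \<delta>"] \<F>(1-3) F \<epsilon> by auto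
  define \<kappa> where "\<kappa> = (\<lambda>A. \<Sum>w\<in>J. of_real (c w) * dirac_measure w A)"
  have \<kappa>: "\<kappa> \<in> positive_measures" unfolding \<kappa>_def using J by (intro lincomb_sum_positive dirac_measure_positive)
  have "\<kappa> \<in> ?G"
  proof (rule \<F>(4)[OF \<kappa>], rule ballI)
    fix g assume g: "g \<in> \<F>"
    have [measurable]: "g \<in> borel_measurable borel" using \<F>(3)[OF g] by (intro borel_measurable_continuous_onI) auto
    obtain C where C: "\<And>x. \<bar>g x\<bar> \<le> C" using \<F>(3)[OF g] by (auto simp: bounded_iff)
    have "(LINT z|to_measure \<kappa>. g z) = (\<Sum>w\<in>J. c w * g w)"
      unfolding \<kappa>_def using J C
      by (subst integral_to_measure_lincomb_sum[where B = C]) (auto simp: dirac_measure_positive to_measure_dirac integral_return)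
    then show "\<bar>(LINT z|to_measure \<kappa>. g z) - (LINT z|to_measure \<nu>. g z)\<bar> < \<delta>"
      using J(3)[of g] g by simp
  qed
  then have "\<bar>(LINT z|to_measure (L \<nu>). f z) - (LINT z|to_measure (L \<kappa>). f z)\<bar> < \<epsilon>"
    by (simp add: dist_real_def)
  moreover have "(LINT z|to_measure (L \<kappa>). f z) = (\<Sum>w\<in>J. c w * F w)"
  proof -
    have "L \<kappa> = (\<lambda>A. \<Sum>w\<in>J. of_real (c w) * L (dirac_measure w) A)"
      unfolding \<kappa>_def using J by (intro linear_sum dirac_measure_bounded_regular)
    then show ?thesis unfolding F_def using J B
      by (simp add: integral_to_measure_lincomb_sum[where B = B] pos)
  qed
  moreover have "\<bar>(\<Sum>w\<in>J. c w * F w) - (LINT z|to_measure \<nu>. F z)\<bar> < \<epsilon>"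
    using J(3)[of F] by simp
  ultimately show False by (simp add: \<epsilon>_def abs_if split: if_splits)
qed

end

text \<open>The complement is a possibly uncountable union of null open sets, so its nullity rests
  on regularity: a compact part is covered by finitely many of them, and what remains is
  small.\<close>

lemma null_complement_supp_measure:
  assumes \<mu>: "\<mu> \<in> positive_measures"
  shows "open (- supp_measure \<mu>)" "emeasure (to_measure \<mu>) (- supp_measure \<mu>) = 0"
proof -
  have null: "\<exists>U. open U \<and> x \<in> U \<and> U \<inter> supp_measure \<mu> = {} \<and> emeasure (to_measure \<mu>) U = 0"
    if "x \<notin> supp_measure \<mu>" for x
  proof -
    have "\<exists>U. open U \<and> x \<in> U \<and> (\<forall>B. B \<in> sets borel \<longrightarrow> B \<subseteq> U \<longrightarrow> \<mu> B = 0)"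
      using that by (auto simp: supp_measure_def)
    then obtain U where U: "open U" "x \<in> U" "\<And>B. B \<in> sets borel \<Longrightarrow> B \<subseteq> U \<Longrightarrow> \<mu> B = 0"
      by metis
    then have "emeasure (to_measure \<mu>) U = 0" by (simp add: emeasure_to_measure[OF \<mu>])
    moreover have "y \<notin> supp_measure \<mu>" if yU: "y \<in> U" for y
    proof
      assume "y \<in> supp_measure \<mu>"
      then have *: "\<forall>U. open U \<and> y \<in> U \<longrightarrow> (\<exists>B\<in>sets borel. B \<subseteq> U \<and> \<mu> B \<noteq> 0)"
        by (simp add: supp_measure_def)
      obtain B where "B \<in> sets borel" "B \<subseteq> U" "\<mu> B \<noteq> 0"
        using *[rule_format, of U] U(1) yU by auto
      then show False using U(3) by simp
    qed
    ultimately show ?thesis using U(1,2) by (intro exI[of _ U]) auto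
  qed
  show op: "open (- supp_measure \<mu>)"
  proof (subst open_subopen, rule ballI)
    fix x assume "x \<in> - supp_measure \<mu>"
    then obtain U where "open U" "x \<in> U" "U \<inter> supp_measure \<mu> = {}" using null[of x] by auto
    then show "\<exists>T. open T \<and> x \<in> T \<and> T \<subseteq> - supp_measure \<mu>" by (intro exI[of _ U]) auto
  qed
  show "emeasure (to_measure \<mu>) (- supp_measure \<mu>) = 0"
  proof (rule ccontr)
    assume "emeasure (to_measure \<mu>) (- supp_measure \<mu>) \<noteq> 0"
    then have pos: "0 < Re (\<mu> (- supp_measure \<mu>))"
      using op positive_measures_nonneg(1)[OF \<mu>] by (auto simp: emeasure_to_measure[OF \<mu>] less_le)
    have br: "\<mu> \<in> bounded_regular_measures" by (rule positive_measures_bounded_regular[OF \<mu>])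
    \<comment> \<open>Regularity is applied with \<epsilon> equal to the measure of the complement
      itself, so that the part outside the null compact set \<open>C\<close> is already too
      small.\<close>
    obtain C U where C: "compact C" "open U" "C \<subseteq> - supp_measure \<mu>" "- supp_measure \<mu> \<subseteq> U"
      "\<And>B. B \<in> sets borel \<Longrightarrow> B \<subseteq> U - C \<Longrightarrow> cmod (\<mu> B) < Re (\<mu> (- supp_measure \<mu>))"
      using bounded_regular_measures_regular[OF br _ pos] op by (metis borel_open)
    have Cb: "C \<in> sets borel" using C(1) by (simp add: borel_compact)
    have "\<exists>\<U>. (\<forall>U\<in>\<U>. open U \<and> emeasure (to_measure \<mu>) U = 0) \<and> finite \<U> \<and> C \<subseteq> \<Union>\<U>"
    proof -
      let ?\<U> = "{U. open U \<and> emeasure (to_measure \<mu>) U = 0}"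
      have "C \<subseteq> \<Union>?\<U>"
      proof
        fix x assume "x \<in> C"
        then have "x \<notin> supp_measure \<mu>" using C(3) by auto
        from null[OF this] obtain U where "open U" "x \<in> U" "emeasure (to_measure \<mu>) U = 0" by blast
        then show "x \<in> \<Union>?\<U>" by auto
      qed
      then obtain \<U> where "\<U> \<subseteq> ?\<U>" "finite \<U>" "C \<subseteq> \<Union>\<U>"
        using compactE[OF C(1), of ?\<U>] by (metis (no_types, lifting) mem_Collect_eq)
      then show ?thesis by (intro exI[of _ \<U>]) auto
    qed
    then obtain \<U> where \<U>: "\<And>U. U \<in> \<U> \<Longrightarrow> open U" "\<And>U. U \<in> \<U> \<Longrightarrow> emeasure (to_measure \<mu>) U = 0"
      "finite \<U>" "C \<subseteq> \<Union>\<U>" by blast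
    have "emeasure (to_measure \<mu>) C \<le> emeasure (to_measure \<mu>) (\<Union>\<U>)"
      using \<U> by (intro emeasure_mono) auto
    also have "\<dots> \<le> (\<Sum>U\<in>\<U>. emeasure (to_measure \<mu>) U)"
      using emeasure_subadditive_finite[of \<U> "\<lambda>U. U" "to_measure \<mu>"] \<U>(1,3)
      by (simp add: subset_iff borel_open)
    finally have C0: "emeasure (to_measure \<mu>) C = 0" using \<U> by simp
    have "emeasure (to_measure \<mu>) (- supp_measure \<mu>) \<le> emeasure (to_measure \<mu>) C + emeasure (to_measure \<mu>) (- supp_measure \<mu> - C)"
      using C(3) Cb op by (subst plus_emeasure) (auto intro!: emeasure_mono)
    also have "\<dots> = ennreal (Re (\<mu> (- supp_measure \<mu> - C)))"
      using C0 Cb op by (simp add: emeasure_to_measure[OF \<mu>])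
    also have "\<dots> \<le> ennreal (cmod (\<mu> (- supp_measure \<mu> - C)))"
      by (intro ennreal_leI complex_Re_le_cmod)
    also have "\<dots> < ennreal (Re (\<mu> (- supp_measure \<mu>)))"
      using C(4) Cb op pos by (intro ennreal_lessI C(5)) auto
    finally show False using op by (simp add: emeasure_to_measure[OF \<mu>])
  qed
qed

lemma AE_supp_measure:
  assumes \<mu>: "\<mu> \<in> positive_measures"
  shows "AE x in to_measure \<mu>. x \<in> supp_measure \<mu>"
  by (rule AE_I[of _ _ "- supp_measure \<mu>"]) (use null_complement_supp_measure[OF \<mu>] in auto)

lemma emeasure_pos_supp_measure:
  assumes \<mu>: "\<mu> \<in> positive_measures" and "x \<in> supp_measure \<mu>" "open U" "x \<in> U"
  shows "0 < emeasure (to_measure \<mu>) U"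
proof -
  obtain B where B: "B \<in> sets borel" "B \<subseteq> U" "\<mu> B \<noteq> 0"
    using assms by (auto simp: supp_measure_def)
  then have "0 < Re (\<mu> B)"
    using positive_measures_nonneg[OF \<mu>, of B] by (auto simp: complex_eq_iff less_le)
  then have "0 < emeasure (to_measure \<mu>) B" by (simp add: emeasure_to_measure[OF \<mu> B(1)])
  also have "\<dots> \<le> emeasure (to_measure \<mu>) U" using B assms by (intro emeasure_mono) auto
  finally show ?thesis .
qed

section \<open>Supports in a hypergroup\<close>

lemma emeasure_pos_not_AE:
  assumes "0 < emeasure M A" "A \<in> sets M" "\<And>x. x \<in> A \<Longrightarrow> \<not> Q x"
  shows "\<not> (AE x in M. Q x)"
proof
  assume "AE x in M. Q x"
  then have "AE x in M. x \<notin> A" by eventually_elim (use assms(3) in blast)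
  then have "A \<in> null_sets M" using assms(2) by (simp add: AE_iff_null_sets)
  then show False using assms(1) by auto
qed

lemma Hausdorff_space_t2: "Hausdorff_space (euclidean :: 'a::t2_space topology)"
  unfolding Hausdorff_space_def using hausdorff by (auto simp: disjnt_def)

context hypergroup
begin

abbreviation point_conv :: "'a \<Rightarrow> 'a \<Rightarrow> 'a measure" where
  "point_conv x y \<equiv> to_measure (conv (dirac_measure x) (dirac_measure y))"

abbreviation point_supp :: "'a \<Rightarrow> 'a \<Rightarrow> 'a set" where
  "point_supp x y \<equiv> supp_measure (conv (dirac_measure x) (dirac_measure y))"

lemma prob_space_point_conv: "prob_space (point_conv x y)"
  by (rule prob_spaceI) (simp add: emeasure_to_measure[OF conv_point_prob(1)] conv_point_prob(2))

lemma conv_continuous_right: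
  assumes "\<mu> \<in> positive_measures"
  shows "continuous_map positive_weak_topology positive_weak_topology (conv \<mu>)"
proof -
  have "continuous_map positive_weak_topology (prod_topology positive_weak_topology positive_weak_topology) (\<lambda>\<nu>. (\<mu>, \<nu>))"
    using assms by (simp add: continuous_map_paired)
  from continuous_map_compose[OF this conv_weakly_continuous] show ?thesis by (simp add: o_def)
qed

lemma conv_continuous_left:
  assumes "\<mu> \<in> positive_measures"
  shows "continuous_map positive_weak_topology positive_weak_topology (\<lambda>\<nu>. conv \<nu> \<mu>)"
proof -
  have "continuous_map positive_weak_topology (prod_topology positive_weak_topology positive_weak_topology) (\<lambda>\<nu>. (\<nu>, \<mu>))"
    using assms by (simp add: continuous_map_paired)
  from continuous_map_compose[OF this conv_weakly_continuous] show ?thesis by (simp add: o_def)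
qed

lemma continuous_integral_point_conv:
  assumes f: "continuous_on UNIV f" "bounded (range f)"
  shows "continuous_on UNIV (\<lambda>z. LINT w|point_conv (fst z) (snd z). f w :: real)"
proof (subst continuous_on_open_vimage, simp, intro allI impI)
  fix U :: "real set" assume U: "open U"
  have "continuous_map (euclidean :: ('a \<times> 'a) topology) positive_weak_topology (\<lambda>z. dirac_measure (fst z))"
    "continuous_map (euclidean :: ('a \<times> 'a) topology) positive_weak_topology (\<lambda>z. dirac_measure (snd z))"
    by (intro continuous_map_compose[of _ euclidean, OF _ continuous_map_dirac_measure, unfolded o_def];
        simp add: continuous_on_fst continuous_on_snd continuous_on_id)+
  then have "continuous_map (euclidean :: ('a \<times> 'a) topology) (prod_topology positive_weak_topology positive_weak_topology)
      (\<lambda>z. (dirac_measure (fst z), dirac_measure (snd z)))"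
    by (simp add: continuous_map_paired)
  from continuous_map_compose[OF this conv_weakly_continuous]
  have "continuous_map (euclidean :: ('a \<times> 'a) topology) positive_weak_topology
      (\<lambda>z. conv (dirac_measure (fst z)) (dirac_measure (snd z)))" by (simp add: o_def)
  then have "openin euclidean {z \<in> topspace euclidean. conv (dirac_measure (fst z)) (dirac_measure (snd z)) \<in>
      {\<mu> \<in> positive_measures. (LINT z|to_measure \<mu>. f z) \<in> U}}"
    using openin_positive_weak_topology[OF f U] by (rule openin_continuous_map_preimage)
  moreover have "{z \<in> topspace euclidean. conv (dirac_measure (fst z)) (dirac_measure (snd z)) \<in>
      {\<mu> \<in> positive_measures. (LINT z|to_measure \<mu>. f z) \<in> U}} = (\<lambda>z. LINT w|point_conv (fst z) (snd z). f w) -` U"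
    by (auto simp: conv_point_prob)
  ultimately show "open ((\<lambda>z. LINT w|point_conv (fst z) (snd z). f w) -` U \<inter> UNIV)" by simp
qed

lemma integral_conv_right:
  assumes "\<nu> \<in> positive_measures" "continuous_on UNIV f" "bounded (range (f :: 'a \<Rightarrow> real))"
  shows "(LINT z|to_measure (conv (dirac_measure x) \<nu>). f z) = (LINT w|to_measure \<nu>. LINT z|point_conv x w. f z)"
  by (intro integral_weakly_continuous_image assms conv_linear_right conv_continuous_right
      dirac_measure_bounded_regular dirac_measure_positive conv_point_prob)

lemma integral_conv_left:
  assumes "\<nu> \<in> positive_measures" "continuous_on UNIV f" "bounded (range (f :: 'a \<Rightarrow> real))"
  shows "(LINT z|to_measure (conv \<nu> (dirac_measure x)). f z) = (LINT w|to_measure \<nu>. LINT z|point_conv w x. f z)"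
  by (intro integral_weakly_continuous_image[where L = "\<lambda>\<nu>. conv \<nu> (dirac_measure x)"] assms conv_linear_left conv_continuous_left
      dirac_measure_bounded_regular dirac_measure_positive conv_point_prob)

lemma compact_nonempty_point_supp: "compact (point_supp x y)" "point_supp x y \<noteq> {}"
proof -
  show "compact (point_supp x y)" by (rule conv_point_supp)
  show "point_supp x y \<noteq> {}"
    using null_complement_supp_measure(2)[OF conv_point_prob(1), of x y]
      prob_space.emeasure_space_1[OF prob_space_point_conv, of x y] by auto
qed

text \<open>A generating set of the Michael topology with V the whole space expresses upper
  semicontinuity of the supports.\<close>

lemma open_point_supp_subset:
  assumes W: "open W"
  shows "open {z. point_supp (fst z) (snd z) \<subseteq> W}"
proof -
  have "openin michael_topology {L. compact L \<and> L \<noteq> {} \<and> L \<inter> UNIV \<noteq> {} \<and> L \<subseteq> W}"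
    unfolding michael_topology_def using W by (intro topology_generated_by_Basis) blast
  then have "openin euclidean {z \<in> topspace euclidean. (case z of (x, y) \<Rightarrow> point_supp x y) \<in>
      {L. compact L \<and> L \<noteq> {} \<and> L \<inter> UNIV \<noteq> {} \<and> L \<subseteq> W}}"
    by (rule openin_continuous_map_preimage[OF supp_continuous])
  moreover have "{z \<in> topspace euclidean. (case z of (x, y) \<Rightarrow> point_supp x y) \<in>
      {L. compact L \<and> L \<noteq> {} \<and> L \<inter> UNIV \<noteq> {} \<and> L \<subseteq> W}} = {z. point_supp (fst z) (snd z) \<subseteq> W}"
    using compact_nonempty_point_supp by auto
  ultimately show ?thesis by simp
qed

lemma completely_regular: "completely_regular_space (euclidean :: 'a topology)"
  using locally_compact by (rule locally_compact_regular_imp_completely_regular_space) (simp add: Hausdorff_space_t2)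

lemma Urysohn_compact_open:
  assumes C: "compact C" and U: "open U" "C \<subseteq> U"
  obtains k :: "'a \<Rightarrow> real" where "continuous_on UNIV k" "\<And>x. 0 \<le> k x" "\<And>x. k x \<le> 1"
    "\<And>x. x \<in> C \<Longrightarrow> k x = 1" "\<And>x. x \<notin> U \<Longrightarrow> k x = 0"
proof -
  obtain k where k: "continuous_map euclidean (top_of_set {0..1::real}) k" "k ` (- U) \<subseteq> {0}" "k ` C \<subseteq> {1}"
    using C U by (rule_tac Urysohn_completely_regular_compact_closed[OF zero_le_one completely_regular, of "C" "- U"])
      (auto simp: compactin_euclidean_iff disjnt_def)
  show thesis
    by (rule that[of k]) (use k in \<open>auto simp: continuous_map_in_subtopology image_subset_iff\<close>)
qed

lemma compact_neighbourhood:
  assumes "compact (C :: 'a set)"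
  obtains V L where "open V" "compact L" "C \<subseteq> V" "V \<subseteq> L"
proof -
  have "\<exists>V L. open V \<and> compact L \<and> C \<subseteq> V \<and> V \<subseteq> L"
    using locally_compact assms locally_compact_space_compact_closed_compact[of "euclidean :: 'a topology"]
      Hausdorff_space_t2 by (fastforce simp: compactin_euclidean_iff)
  then show thesis using that by blast
qed

text \<open>Upper semicontinuity gives each w a neighbourhood whose supports avoid a common
  neighbourhood of v; by compactness finitely many of these cover \<open>Y\<close>, and the finite
  intersection of the neighbourhoods of v serves for all.\<close>

lemma point_supp_avoids:
  assumes Y: "compact Y" and "\<And>w. w \<in> Y \<Longrightarrow> v \<notin> point_supp x w"
  obtains N where "open N" "v \<in> N" "\<And>w. w \<in> Y \<Longrightarrow> point_supp x w \<inter> N = {}"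
proof -
  have "\<exists>W N. open W \<and> w \<in> W \<and> open N \<and> v \<in> N \<and> (\<forall>w'\<in>W. point_supp x w' \<inter> N = {})" if w: "w \<in> Y" for w
  proof -
    obtain G N where GN: "open G" "open N" "point_supp x w \<subseteq> G" "v \<in> N" "G \<inter> N = {}"
    proof -
      from Hausdorff_space_compact_separation[OF Hausdorff_space_t2, of "point_supp x w" "{v}"]
      show thesis using that assms(2)[OF w] conv_point_supp[of x w]
        by (auto simp: compactin_euclidean_iff disjnt_def)
    qed
    have "open {z. point_supp (fst z) (snd z) \<subseteq> G}" by (rule open_point_supp_subset[OF GN(1)])
    then have "open ((\<lambda>w. (x, w)) -` {z. point_supp (fst z) (snd z) \<subseteq> G})"
      by (intro open_vimage continuous_intros)
    then have "open {w. point_supp x w \<subseteq> G}" by (simp add: vimage_def)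
    then show ?thesis using GN by (intro exI[of _ "{w. point_supp x w \<subseteq> G}"] exI[of _ N]) auto
  qed
  then obtain W N where WN: "\<And>w. w \<in> Y \<Longrightarrow> open (W w) \<and> w \<in> W w \<and> open (N w) \<and> v \<in> N w \<and>
      (\<forall>w'\<in>W w. point_supp x w' \<inter> N w = {})" by metis
  have "\<And>w. w \<in> Y \<Longrightarrow> open (W w)" using WN by blast
  moreover have "Y \<subseteq> (\<Union>w\<in>Y. W w)" using WN by blast
  ultimately obtain D where D: "D \<subseteq> Y" "finite D" "Y \<subseteq> (\<Union>w\<in>D. W w)"
    by (rule compactE_image[OF Y])
  show thesis
  proof (rule that[of "\<Inter>w\<in>D. N w"])
    show "open (\<Inter>w\<in>D. N w)" using D WN by (intro open_INT) auto
    show "v \<in> (\<Inter>w\<in>D. N w)" using D WN by auto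
    show "point_supp x w \<inter> (\<Inter>w\<in>D. N w) = {}" if "w \<in> Y" for w
      using that D WN by blast
  qed
qed

lemma invol_vimage_sets [simp]: "B \<in> sets borel \<Longrightarrow> invol -` B \<in> sets borel"
  using measurable_sets[OF borel_measurable_continuous_onI[OF invol_continuous], of B] by simp

lemma invol_vimage_invol [simp]: "invol -` invol -` B = B"
  by (auto simp: invol_invol)

lemma invol_image: "invol ` B = invol -` B"
  by (auto simp: invol_invol image_iff) (metis invol_invol)

lemma point_supp_invol:
  assumes "v \<in> point_supp x y"
  shows "invol v \<in> point_supp (invol y) (invol x)"
  unfolding supp_measure_def mem_Collect_eq
proof (intro allI impI, elim conjE)
  fix U assume U: "open U" "invol v \<in> U"
  have "open (invol -` U)" using U(1) invol_continuous by (simp add: continuous_on_open_vimage)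
  then have "\<exists>B\<in>sets borel. B \<subseteq> invol -` U \<and> conv (dirac_measure x) (dirac_measure y) B \<noteq> 0"
    using assms U(2) by (simp add: supp_measure_def)
  then obtain B where B: "B \<in> sets borel" "B \<subseteq> invol -` U" "conv (dirac_measure x) (dirac_measure y) B \<noteq> 0" by auto
  have "conv (dirac_measure (invol y)) (dirac_measure (invol x)) (invol -` B) = conv (dirac_measure x) (dirac_measure y) B"
    using fun_cong[OF conv_invol[of x y], of "invol -` B"] by simp
  then show "\<exists>B\<in>sets borel. B \<subseteq> U \<and> conv (dirac_measure (invol y)) (dirac_measure (invol x)) B \<noteq> 0"
    using B by (intro bexI[of _ "invol -` B"]) (auto simp: invol_invol)
qed

text \<open>Both bracketings of \<open>y\<^sup>~ * u * v\<close> are tested against a bump function at the identity.\<close>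

lemma point_supp_cancel:
  assumes v: "v \<in> point_supp (invol u) y"
  shows "y \<in> point_supp u v"
proof (rule ccontr)
  assume y: "y \<notin> point_supp u v"
  \<comment> \<open>The identity lies in supp(y~ * w) only if w = y, and y is assumed outside supp(u
    * v).\<close>
  have "e \<notin> point_supp (invol y) w" if "w \<in> point_supp u v" for w
    using that y identity_in_supp[of "invol y" w] by (metis invol_invol)
  then obtain N where N: "open N" "e \<in> N" "\<And>w. w \<in> point_supp u v \<Longrightarrow> point_supp (invol y) w \<inter> N = {}"
    using point_supp_avoids[OF conv_point_supp, of u v e "invol y"] by blast
  obtain k :: "'a \<Rightarrow> real" where k: "continuous_on UNIV k" "\<And>x. 0 \<le> k x" "\<And>x. k x \<le> 1" "k e = 1" "\<And>x. x \<notin> N \<Longrightarrow> k x = 0"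
    using Urysohn_compact_open[of "{e}" N] N by auto
  have bk: "bounded (range k)" using k(2,3) by (auto simp: bounded_iff abs_le_iff intro!: exI[of _ 1] order.trans[OF _ k(2)])
  have [measurable]: "k \<in> borel_measurable borel" using k(1) by (rule borel_measurable_continuous_onI)
  let ?y = "dirac_measure (invol y)" and ?u = "dirac_measure u" and ?v = "dirac_measure v"
  have "conv (conv ?y ?u) ?v = conv ?y (conv ?u ?v)"
    by (intro conv_assoc dirac_measure_bounded_regular)
  \<comment> \<open>\<open>k\<close> vanishes off \<open>N\<close>, and \<open>N\<close> misses
    supp(y~ * w) for every w in supp(u * v).\<close>
  moreover have "(LINT z|to_measure (conv ?y (conv ?u ?v)). k z) = 0"
  proof -
    have "(LINT z|point_conv (invol y) w. k z) = 0" if w: "w \<in> point_supp u v" for w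
    proof -
      have "AE z in point_conv (invol y) w. k z = 0"
        using AE_supp_measure[OF conv_point_prob(1), of "invol y" w] by eventually_elim (use N(3)[OF w] k(5) in blast)
      then show ?thesis by (simp add: integral_eq_zero_AE)
    qed
    then have "AE w in point_conv u v. (LINT z|point_conv (invol y) w. k z) = 0"
      using AE_supp_measure[OF conv_point_prob(1), of u v] by (auto elim: eventually_mono)
    then show ?thesis
      by (subst integral_conv_right[OF conv_point_prob(1) k(1) bk]) (rule integral_eq_zero_AE)
  qed
  \<comment> \<open>\<open>F\<close> is positive at v~ because e \<in> supp(v~ * v), and v~ \<in>
    supp(y~ * u) by applying the involution to the hypothesis. By continuity \<open>F\<close> is
    then positive on a set of positive measure.\<close>
  moreover have "0 < (LINT z|to_measure (conv (conv ?y ?u) ?v). k z)"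
  proof -
    define F where "F w = (LINT z|point_conv w v. k z)" for w
    have F0: "0 \<le> F w" for w unfolding F_def by (intro integral_nonneg_AE) (simp add: k)
    have intk: "integrable (point_conv x y) k" for x y
    proof -
      interpret prob_space "point_conv x y" by (rule prob_space_point_conv)
      show ?thesis using k by (intro integrable_const_bound[of _ 1]) auto
    qed
    have F1: "F w \<le> 1" for w
    proof -
      interpret prob_space "point_conv w v" by (rule prob_space_point_conv)
      have "F w \<le> expectation (\<lambda>_. 1)" unfolding F_def using intk k by (intro integral_mono) auto
      then show ?thesis by (simp add: prob_space[simplified])
    qed
    have cF: "continuous_on UNIV F"
    proof -
      have "continuous_on UNIV ((\<lambda>z. LINT w|point_conv (fst z) (snd z). k w) \<circ> (\<lambda>w. (w, v)))"
        by (intro continuous_on_compose continuous_intros continuous_on_subset[OF continuous_integral_point_conv[OF k(1) bk]]) auto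
      then show ?thesis by (simp add: F_def[abs_def] o_def)
    qed
    have [measurable]: "F \<in> borel_measurable borel" using cF by (rule borel_measurable_continuous_onI)
    have "0 < F (invol v)"
    proof -
      have "e \<in> point_supp (invol v) v" using identity_in_supp by simp
      moreover have "open {z. 1 / 2 < k z}" using k(1) by (intro open_Collect_less continuous_intros) auto
      ultimately have "0 < emeasure (point_conv (invol v) v) {z. 1 / 2 < k z}"
        using k(4) by (intro emeasure_pos_supp_measure[OF conv_point_prob(1)]) auto
      then have "\<not> (AE z in point_conv (invol v) v. k z = 0)"
        by (rule emeasure_pos_not_AE) auto
      then have "F (invol v) \<noteq> 0"
        unfolding F_def by (subst integral_nonneg_eq_0_iff_AE[OF intk]) (auto simp: k)
      then show ?thesis using F0[of "invol v"] by simp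
    qed
    moreover have "invol v \<in> point_supp (invol y) u"
      using point_supp_invol[OF v] by (simp add: invol_invol)
    moreover have "open {w. F (invol v) / 2 < F w}" using cF by (intro open_Collect_less continuous_intros) auto
    ultimately have pos: "0 < emeasure (point_conv (invol y) u) {w. F (invol v) / 2 < F w}"
      by (intro emeasure_pos_supp_measure[OF conv_point_prob(1)]) auto
    interpret prob_space "point_conv (invol y) u" by (rule prob_space_point_conv)
    have intF: "integrable (point_conv (invol y) u) F" using F0 F1 by (intro integrable_const_bound[of _ 1]) auto
    have "\<not> (AE w in point_conv (invol y) u. F w = 0)"
      using pos \<open>0 < F (invol v)\<close>
      by (intro emeasure_pos_not_AE[OF pos]) auto
    then have "(LINT w|point_conv (invol y) u. F w) \<noteq> 0"
      by (subst integral_nonneg_eq_0_iff_AE[OF intF]) (auto simp: F0)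
    moreover have "0 \<le> (LINT w|point_conv (invol y) u. F w)" by (intro integral_nonneg_AE) (simp add: F0)
    ultimately show ?thesis
      by (subst integral_conv_left[OF conv_point_prob(1) k(1) bk]) (simp add: F_def)
  qed
  ultimately show False by simp
qed

text \<open>Near each pair the supports stay inside one compact neighbourhood of the support at that
  pair; finitely many pairs suffice for the compact rectangle.\<close>

lemma compact_superset_point_supp:
  assumes "compact C1" "compact C2"
  obtains Y where "compact Y" "\<And>x y. x \<in> C1 \<Longrightarrow> y \<in> C2 \<Longrightarrow> point_supp x y \<subseteq> Y"
proof -
  have "\<exists>V L. open V \<and> z \<in> V \<and> compact L \<and> (\<forall>z'\<in>V. point_supp (fst z') (snd z') \<subseteq> L)" for z :: "'a \<times> 'a"
  proof -
    obtain G L where G: "open G" "compact L" "point_supp (fst z) (snd z) \<subseteq> G" "G \<subseteq> L"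
      using compact_neighbourhood[OF conv_point_supp, of "fst z" "snd z"] by metis
    then show ?thesis
      using open_point_supp_subset[OF G(1)]
      by (intro exI[of _ "{z. point_supp (fst z) (snd z) \<subseteq> G}"] exI[of _ L]) auto
  qed
  then obtain V L where VL: "\<And>z. open (V z) \<and> z \<in> V z \<and> compact (L z) \<and> (\<forall>z'\<in>V z. point_supp (fst z') (snd z') \<subseteq> L z)"
    by metis
  have cmp: "compact (C1 \<times> C2)" using assms by (rule compact_Times)
  have opV: "open (V z)" for z using VL by blast
  have "C1 \<times> C2 \<subseteq> (\<Union>z\<in>C1 \<times> C2. V z)"
  proof
    fix z assume "z \<in> C1 \<times> C2"
    moreover have "z \<in> V z" using VL by blast
    ultimately show "z \<in> (\<Union>z\<in>C1 \<times> C2. V z)" by (rule UN_I)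
  qed
  then obtain D where D: "D \<subseteq> C1 \<times> C2" "finite D" "C1 \<times> C2 \<subseteq> (\<Union>z\<in>D. V z)"
    by (rule compactE_image[OF cmp opV])
  show thesis
  proof (rule that[of "\<Union>z\<in>D. L z"])
    show "compact (\<Union>z\<in>D. L z)" using D VL by (intro compact_UN) auto
    show "point_supp x y \<subseteq> (\<Union>z\<in>D. L z)" if "x \<in> C1" "y \<in> C2" for x y
    proof -
      have "(x, y) \<in> (\<Union>z\<in>D. V z)" using that D by auto
      then obtain z where "z \<in> D" "(x, y) \<in> V z" by auto
      then show ?thesis using VL[of z] by force
    qed
  qed
qed

text \<open>For u in C the support of u * e is contained in {u}, hence in U, and the tube lemma
  gives a \<open>V\<close> with supp(u * v) \<subseteq> U for all u in C and v in \<open>V\<close>.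
  If supp(u~ * y) met \<open>V\<close> in v, cancellation would place y in supp(u * v), hence in
  U.\<close>

lemma identity_neighbourhood:
  assumes C: "compact C" and U: "open U" "C \<subseteq> U"
  obtains V where "open V" "e \<in> V" "\<And>u y. u \<in> C \<Longrightarrow> y \<notin> U \<Longrightarrow> point_supp (invol u) y \<inter> V = {}"
proof -
  have supp_e: "point_supp u e \<subseteq> {u}" for u
  proof
    fix x assume x: "x \<in> point_supp u e"
    show "x \<in> {u}"
    proof (rule ccontr)
      assume "x \<notin> {u}"
      then have "0 < emeasure (point_conv u e) (- {u})"
        using x by (intro emeasure_pos_supp_measure[OF conv_point_prob(1)]) auto
      then show False by (simp add: conv_identity to_measure_dirac)
    qed
  qed
  \<comment> \<open>The coordinates are swapped because the tube lemma expects the compact factor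
    second.\<close>
  let ?W = "{z. point_supp (snd z) (fst z) \<subseteq> U}"
  have "?W = prod.swap -` {z. point_supp (fst z) (snd z) \<subseteq> U}" by auto
  then have "open ?W" using open_point_supp_subset[OF U(1)] by (simp only:) (intro open_vimage continuous_on_swap)
  moreover have "{e} \<times> C \<subseteq> ?W" using supp_e U(2) by fastforce
  ultimately have "\<exists>V. e \<in> V \<and> open V \<and> V \<times> C \<subseteq> ?W"
    by (rule Elementary_Topology.tube_lemma[OF C])
  then obtain V where "e \<in> V \<and> open V \<and> V \<times> C \<subseteq> ?W" ..
  then have V: "e \<in> V" "open V" "V \<times> C \<subseteq> ?W" by simp_all
  show thesis
  proof (rule that[OF V(2,1)])
    fix u y assume "u \<in> C" "y \<notin> U"
    show "point_supp (invol u) y \<inter> V = {}"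
    proof (rule ccontr)
      assume "point_supp (invol u) y \<inter> V \<noteq> {}"
      then obtain v where v: "v \<in> V" "v \<in> point_supp (invol u) y" by blast
      have "y \<in> point_supp u v" by (rule point_supp_cancel[OF v(2)])
      moreover have "(v, u) \<in> ?W"
        by (rule subsetD[OF V(3)]) (simp add: v \<open>u \<in> C\<close>)
      ultimately show False using \<open>y \<notin> U\<close> by (simp add: subset_iff)
    qed
  qed
qed

end

section \<open>Haar measure and the involution\<close>

text \<open>A continuous function is Borel for the product topology, but the product
  \<sigma>-algebra may be smaller than the Borel \<sigma>-algebra of the product. On a compact
  rectangle the tube lemma gives uniform approximation by functions that depend on x only through
  finitely many open pieces, and these are product measurable.\<close>

lemma measurable_continuous_compact_rectangle:
  fixes h :: "'a::t2_space \<times> 'b::t2_space \<Rightarrow> real"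
  assumes h: "continuous_on UNIV h" and C: "compact C1" "compact C2"
  shows "(\<lambda>z. indicator (C1 \<times> C2) z * h z) \<in> borel_measurable (borel \<Otimes>\<^sub>M borel)"
proof -
  have C12 [measurable]: "C1 \<in> sets borel" "C2 \<in> sets borel" using C by (auto intro: borel_compact)
  have sec [measurable]: "(\<lambda>y. h (x, y)) \<in> borel_measurable borel" for x
    by (intro borel_measurable_continuous_onI continuous_on_compose2[OF h] continuous_intros) auto
  have approx: "\<exists>g \<in> borel_measurable (borel \<Otimes>\<^sub>M borel). \<forall>x\<in>C1. \<forall>y\<in>C2. \<bar>h (x, y) - g (x, y)\<bar> < \<epsilon>"
    if \<epsilon>: "0 < \<epsilon>" for \<epsilon> :: real
  proof -
    have nb: "\<exists>A. x \<in> A \<and> open A \<and> (\<forall>x'\<in>A. \<forall>y\<in>C2. \<bar>h (x', y) - h (x, y)\<bar> < \<epsilon>)" for x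
    proof -
      let ?W = "{z. \<bar>h (fst z, snd z) - h (x, snd z)\<bar> < \<epsilon>}"
      have "open ?W"
        by (intro open_Collect_less continuous_intros continuous_on_compose2[OF h]) auto
      moreover have "{x} \<times> C2 \<subseteq> ?W" using \<epsilon> by auto
      ultimately have "\<exists>A. x \<in> A \<and> open A \<and> A \<times> C2 \<subseteq> ?W"
        by (rule Elementary_Topology.tube_lemma[OF C(2)])
      then obtain A where A: "x \<in> A \<and> open A \<and> A \<times> C2 \<subseteq> ?W" ..
      have "\<bar>h (x', y) - h (x, y)\<bar> < \<epsilon>" if "x' \<in> A" "y \<in> C2" for x' y
      proof -
        have "(x', y) \<in> ?W" by (rule subsetD[of "A \<times> C2"]) (use A that in simp_all)
        then show ?thesis by simp
      qed
      then show ?thesis using A by blast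
    qed
    then obtain A where A: "\<And>x. x \<in> A x" "\<And>x. open (A x)"
      "\<And>x x' y. x' \<in> A x \<Longrightarrow> y \<in> C2 \<Longrightarrow> \<bar>h (x', y) - h (x, y)\<bar> < \<epsilon>" by metis
    \<comment> \<open>The pieces may overlap: each newly added piece takes precedence, and the error
      is below \<epsilon> whichever piece is used.\<close>
    have fin: "\<exists>g \<in> borel_measurable (borel \<Otimes>\<^sub>M borel). \<forall>x\<in>(\<Union>w\<in>D. A w). \<forall>y\<in>C2. \<bar>h (x, y) - g (x, y)\<bar> < \<epsilon>"
      if "finite D" for D
      using that
    proof (induction D rule: finite_induct)
      case (insert w D)
      then obtain g where [measurable]: "g \<in> borel_measurable (borel \<Otimes>\<^sub>M borel)"
        and g: "\<forall>x\<in>(\<Union>w\<in>D. A w). \<forall>y\<in>C2. \<bar>h (x, y) - g (x, y)\<bar> < \<epsilon>" by blast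
      have [measurable]: "A w \<in> sets borel" using A(2) by simp
      have m: "(\<lambda>z. if fst z \<in> A w then h (w, snd z) else g z) \<in> borel_measurable (borel \<Otimes>\<^sub>M borel)"
        by measurable
      show ?case
        by (rule bexI[OF _ m]) (use g A(3) in auto)
    next
      case empty
      show ?case by (rule bexI[of _ "\<lambda>_. 0"]) auto
    qed
    have "C1 \<subseteq> (\<Union>w\<in>C1. A w)" using A(1) by blast
    then obtain D where "D \<subseteq> C1" "finite D" "C1 \<subseteq> (\<Union>w\<in>D. A w)"
      by (rule compactE_image[OF C(1) A(2)])
    then show ?thesis using fin[of D] by (meson subsetD)
  qed
  have "\<forall>n. \<exists>g. g \<in> borel_measurable (borel \<Otimes>\<^sub>M borel) \<and> (\<forall>x\<in>C1. \<forall>y\<in>C2. \<bar>h (x, y) - g (x, y)\<bar> < 1 / Suc n)"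
    using approx by (metis of_nat_0_less_iff zero_less_Suc zero_less_divide_1_iff)
  then obtain g where g: "\<And>n. g n \<in> borel_measurable (borel \<Otimes>\<^sub>M borel)"
    "\<And>n x y. x \<in> C1 \<Longrightarrow> y \<in> C2 \<Longrightarrow> \<bar>h (x, y) - g n (x, y)\<bar> < 1 / Suc n" by metis
  have gm: "(\<lambda>z. indicator (C1 \<times> C2) z * g n z) \<in> borel_measurable (borel \<Otimes>\<^sub>M borel)" for n
    using g(1)[of n] by (intro borel_measurable_times borel_measurable_indicator pair_measureI C12)
  show ?thesis
  proof (rule borel_measurable_LIMSEQ_real[OF _ gm])
    fix z :: "'a \<times> 'b"
    show "(\<lambda>n. indicator (C1 \<times> C2) z * g n z) \<longlonglongrightarrow> indicator (C1 \<times> C2) z * h z"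
    proof (cases "z \<in> C1 \<times> C2")
      case True
      then have "\<bar>g n z - h z\<bar> \<le> 1 / Suc n" for n
        using g(2)[of "fst z" "snd z" n] by (auto simp: abs_minus_commute intro: less_imp_le)
      then have "(\<lambda>n. g n z - h z) \<longlonglongrightarrow> 0"
        by (intro tendsto_rabs_zero_cancel[of "\<lambda>n. g n z - h z"] tendsto_sandwich[OF _ _ tendsto_const LIMSEQ_Suc[OF lim_1_over_n]])
           (auto intro!: always_eventually)
      then show ?thesis using True by (simp add: LIM_zero_iff)
    qed simp
  qed
qed

lemma measurable_continuous_sigma_compact:
  fixes h :: "'a::t2_space \<times> 'a \<Rightarrow> real"
  assumes h: "continuous_on UNIV h" and C: "\<And>n::nat. compact (C n)"
  defines "Q \<equiv> \<Union>n. C n"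
  shows "h \<in> borel_measurable (restrict_space (borel \<Otimes>\<^sub>M borel) (Q \<times> Q))"
proof -
  \<comment> \<open>Increasing unions, so that both coordinates of a point eventually lie in the
    same compact set.\<close>
  define D where "D n = (\<Union>k\<le>n. C k)" for n
  have D: "compact (D n)" for n unfolding D_def using C by (intro compact_UN) auto
  have Q: "Q \<in> sets borel" unfolding Q_def using C by (intro sets.countable_UN) (auto intro: borel_compact)
  have "(\<lambda>z. indicator (Q \<times> Q) z * h z) \<in> borel_measurable (borel \<Otimes>\<^sub>M borel)"
  proof (rule borel_measurable_LIMSEQ_real[OF _ measurable_continuous_compact_rectangle[OF h D D]])
    fix z :: "'a \<times> 'a"
    show "(\<lambda>n. indicator (D n \<times> D n) z * h z) \<longlonglongrightarrow> indicator (Q \<times> Q) z * h z"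
    proof (cases "z \<in> Q \<times> Q")
      case True
      then obtain i j where "fst z \<in> C i" "snd z \<in> C j" by (auto simp: Q_def)
      then have "z \<in> D n \<times> D n" if "max i j \<le> n" for n
      proof -
        have "fst z \<in> D n" unfolding D_def using \<open>fst z \<in> C i\<close> that by (intro UN_I[of i]) auto
        moreover have "snd z \<in> D n" unfolding D_def using \<open>snd z \<in> C j\<close> that by (intro UN_I[of j]) auto
        ultimately show ?thesis by (simp add: mem_Times_iff)
      qed
      then have "\<forall>\<^sub>F n in sequentially. indicator (D n \<times> D n) z * h z = indicator (Q \<times> Q) z * h z"
        using True by (intro eventually_sequentiallyI[of "max i j"]) auto
      then show ?thesis by (rule tendsto_eventually)
    next
      case False
      then have "z \<notin> D n \<times> D n" for n by (auto simp: Q_def D_def)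
      then show ?thesis using False by simp
    qed
  qed
  then show ?thesis using Q
    by (subst borel_measurable_restrict_space_iff) (auto intro!: sets.Int pair_measureI)
qed

text \<open>Zero sets of continuous functions are stable under finite intersections, and their
  indicators are limits of bounded continuous functions. Both facts are needed to make the measure
  of a set under the product of x and y jointly measurable in (x, y).\<close>

definition baire :: "'a::topological_space measure" where
  "baire = sigma UNIV {{x. g x = 0} | g :: 'a \<Rightarrow> real. continuous_on UNIV g}"

lemma space_baire [simp]: "space baire = UNIV"
  by (simp add: baire_def)

lemma sets_baire: "sets (baire :: 'a::topological_space measure) =
    sigma_sets UNIV {{x. g x = 0} | g :: 'a \<Rightarrow> real. continuous_on UNIV g}"
  unfolding baire_def by (subst sets_measure_of) auto

lemma zero_set_baire: "continuous_on UNIV (g :: 'a::topological_space \<Rightarrow> real) \<Longrightarrow> {x. g x = 0} \<in> sets baire"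
  unfolding sets_baire by (intro sigma_sets.Basic) blast

lemma sets_baire_borel:
  assumes "A \<in> sets (baire :: 'a::topological_space measure)"
  shows "A \<in> sets borel"
proof -
  have "A \<in> sigma_sets UNIV {{x. g x = 0} | g :: 'a \<Rightarrow> real. continuous_on UNIV g}"
    using assms by (simp only: sets_baire)
  then have "A \<in> sigma_sets UNIV (sets borel)"
  proof (rule sigma_sets_mono'[THEN subsetD, rotated], intro subsetI)
    fix B assume "B \<in> {{x. g x = 0} | g :: 'a \<Rightarrow> real. continuous_on UNIV g}"
    then obtain g :: "'a \<Rightarrow> real" where "B = {x. g x = 0} \<and> continuous_on UNIV g"
      unfolding mem_Collect_eq ..
    then show "B \<in> sets borel" by (simp add: borel_closed closed_Collect_eq)
  qed
  then show ?thesis using sets.sigma_sets_eq[of "borel :: 'a measure"] by simp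
qed

lemma measurable_baire_borel: "f \<in> measurable baire N \<Longrightarrow> f \<in> measurable (borel :: 'a::topological_space measure) N"
  by (auto simp: measurable_def sets_baire_borel)

section \<open>Translation invariance for nonnegative functions\<close>

locale haar_hypergroup = commutative_hypergroup conv e invol
  for conv :: "('a::t2_space set \<Rightarrow> complex) \<Rightarrow> ('a set \<Rightarrow> complex) \<Rightarrow> 'a set \<Rightarrow> complex" and e invol +
  fixes M :: "'a measure"
  assumes haar: "haar_measure conv M"
begin

lemma radon: "radon_measure M"
  using haar by (simp add: haar_measure_def)

lemma sets_haar [measurable_cong, simp]: "sets M = sets borel"
  using radon by (simp add: radon_measure_def)

lemma space_haar [simp]: "space M = UNIV"
  using sets_eq_imp_space_eq[OF sets_haar] by simp

lemma haar_compact_finite: "compact C \<Longrightarrow> emeasure M C < \<infinity>"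
  using radon by (simp add: radon_measure_def)

lemma haar_outer_regular: "A \<in> sets borel \<Longrightarrow> emeasure M A = (INF U\<in>{U. open U \<and> A \<subseteq> U}. emeasure M U)"
  using radon by (simp add: radon_measure_def)

lemma haar_inner_regular: "open U \<Longrightarrow> emeasure M U = (SUP C\<in>{C. compact C \<and> C \<subseteq> U}. emeasure M C)"
  using radon unfolding radon_measure_def by blast

text \<open>Carries the invariance from Bochner integrals of complex functions to nonnegative
  integrals; boundedness of g makes every value of the translate finite, so that both integrals
  agree.\<close>

lemma nn_integral_translation_real:
  fixes g :: "'a \<Rightarrow> real"
  assumes int: "integrable M g" and g: "\<And>z. 0 \<le> g z" "\<And>z. g z \<le> B"
  shows "(\<lambda>y. \<integral>\<^sup>+z. ennreal (g z) \<partial>point_conv x y) \<in> borel_measurable borel"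
    and "(\<integral>\<^sup>+y. \<integral>\<^sup>+z. ennreal (g z) \<partial>point_conv x y \<partial>M) = (\<integral>\<^sup>+z. ennreal (g z) \<partial>M)"
proof -
  have [measurable]: "g \<in> borel_measurable borel" using borel_measurable_integrable[OF int] by simp
  have T: "translation conv x (\<lambda>z. complex_of_real (g z)) y = of_real (LINT z|point_conv x y. g z)" for y
    unfolding translation_def by (subst integral_completion) auto
  have int': "integrable M (\<lambda>z. complex_of_real (g z))" using int by simp
  have Ti: "integrable M (\<lambda>y. LINT z|point_conv x y. g z)"
    and Teq: "(LINT y|M. LINT z|point_conv x y. g z) = (LINT z|M. g z)"
  proof -
    have "integrable M (translation conv x (\<lambda>z. complex_of_real (g z))) \<and>
        (LINT y|M. translation conv x (\<lambda>z. complex_of_real (g z)) y) = (LINT y|M. complex_of_real (g y))"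
      using haar int' unfolding haar_measure_def by blast
    then show "integrable M (\<lambda>y. LINT z|point_conv x y. g z)"
      "(LINT y|M. LINT z|point_conv x y. g z) = (LINT z|M. g z)"
      by (auto simp: T[abs_def] complex_of_real_integrable_eq of_real_eq_iff)
  qed
  have nn: "(\<integral>\<^sup>+z. ennreal (g z) \<partial>point_conv x y) = ennreal (LINT z|point_conv x y. g z)" for y
  proof -
    interpret prob_space "point_conv x y" by (rule prob_space_point_conv)
    show ?thesis using g by (intro nn_integral_eq_integral integrable_const_bound[of _ B]) auto
  qed
  show "(\<lambda>y. \<integral>\<^sup>+z. ennreal (g z) \<partial>point_conv x y) \<in> borel_measurable borel"
    unfolding nn using borel_measurable_integrable[OF Ti] by simp
  have "(\<integral>\<^sup>+y. \<integral>\<^sup>+z. ennreal (g z) \<partial>point_conv x y \<partial>M) = ennreal (LINT y|M. LINT z|point_conv x y. g z)"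
    unfolding nn using g by (intro nn_integral_eq_integral Ti) (auto intro!: integral_nonneg_AE)
  also have "\<dots> = (\<integral>\<^sup>+z. ennreal (g z) \<partial>M)"
    unfolding Teq using g by (intro nn_integral_eq_integral[symmetric] int) auto
  finally show "(\<integral>\<^sup>+y. \<integral>\<^sup>+z. ennreal (g z) \<partial>point_conv x y \<partial>M) = (\<integral>\<^sup>+z. ennreal (g z) \<partial>M)" .
qed

text \<open>g is the increasing limit of the functions \<open>G n\<close>, cut off at height n and
  restricted to g > 1 / (n + 1). They are bounded and live on sets of finite measure, hence are
  integrable; invariance and measurability pass to the limit by monotone convergence.\<close>

lemma nn_integral_translation:
  assumes [measurable]: "g \<in> borel_measurable borel" and fin: "levels_finite M g"
  shows "(\<lambda>y. \<integral>\<^sup>+z. g z \<partial>point_conv x y) \<in> borel_measurable borel"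
    and "(\<integral>\<^sup>+y. \<integral>\<^sup>+z. g z \<partial>point_conv x y \<partial>M) = (\<integral>\<^sup>+z. g z \<partial>M)"
proof -
  define A where "A n = {z. ennreal (1 / Suc n) < g z}" for n
  have [measurable]: "A n \<in> sets borel" for n
  proof -
    have "{z\<in>space borel. ennreal (1 / Suc n) < g z} \<in> sets borel" by measurable
    then show ?thesis by (simp add: A_def)
  qed
  define G where "G n z = enn2real (min (g z) (of_nat n)) * indicator (A n) z" for n z
  have [measurable]: "G n \<in> borel_measurable borel" for n unfolding G_def by measurable
  have eG: "ennreal (G n z) = min (g z) (of_nat n) * indicator (A n) z" for n z
    by (auto simp: G_def indicator_def ennreal_enn2real_if min_def top_unique ennreal_of_nat_eq_real_of_nat)
  have G0: "0 \<le> G n z" for n z by (simp add: G_def)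
  have Gn: "G n z \<le> real n * indicator (A n) z" for n z
  proof -
    have "enn2real (min (g z) (of_nat n)) \<le> enn2real (of_nat n)"
      by (intro enn2real_mono) (auto simp: ennreal_of_nat_eq_real_of_nat)
    then show ?thesis by (auto simp: G_def indicator_def)
  qed
  have intG: "integrable M (G n)" for n
  proof (rule Bochner_Integration.integrable_bound[of _ "\<lambda>z. real n * indicator (A n) z"])
    have "emeasure M (A n) < \<infinity>"
      using fin[unfolded levels_finite_def superlevel_def, rule_format, of "1 / Suc n"] by (simp add: A_def)
    then show "integrable M (\<lambda>z. real n * indicator (A n) z)" by simp
  qed (use G0 Gn in \<open>auto intro!: AE_I2 order.trans[OF _ abs_ge_self]\<close>)
  have inc: "incseq (\<lambda>n z. ennreal (G n z))"
  proof (rule incseq_SucI, rule le_funI)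
    fix n z
    have "indicator (A n) z \<le> (indicator (A (Suc n)) z :: ennreal)"
    proof -
      have "ennreal (1 / Suc (Suc n)) \<le> ennreal (1 / Suc n)" by (intro ennreal_leI) (auto simp: field_simps)
      from le_less_trans[OF this] show ?thesis by (auto simp: A_def indicator_def simp del: of_nat_Suc)
    qed
    then show "ennreal (G n z) \<le> ennreal (G (Suc n) z)"
      unfolding eG by (intro mult_mono min.mono) (auto simp: ennreal_of_nat_eq_real_of_nat intro!: ennreal_leI)
  qed
  have sup: "(SUP n. ennreal (G n z)) = g z" for z
  proof (rule antisym)
    show "(SUP n. ennreal (G n z)) \<le> g z" by (intro SUP_least) (auto simp: eG indicator_def)
    show "g z \<le> (SUP n. ennreal (G n z))"
    proof (rule dense_le)
      fix y assume y: "y < g z"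
      obtain z' where z': "y < z'" "z' < g z" using dense[OF y] by auto
      have "0 < z'" using z'(1) by (rule le_less_trans[OF zero_le])
      with z' obtain r where r: "z' = ennreal r" "0 < r" by (cases z') auto
      obtain n1 where n1: "1 / Suc n1 < r" using nat_approx_posE[OF r(2)] by blast
      obtain n2 where n2: "r \<le> real n2" using real_arch_simple by blast
      let ?n = "max n1 n2"
      have "1 / Suc ?n \<le> 1 / Suc n1" by (auto simp: field_simps)
      then have "1 / Suc ?n < r" using n1 by simp
      then have "z \<in> A ?n" unfolding A_def mem_Collect_eq
        using z'(2) ennreal_lessI[OF r(2), of "1 / Suc ?n"] unfolding r(1) by (auto intro: less_trans)
      moreover have "z' \<le> of_nat ?n" using n2 r by (auto simp: ennreal_of_nat_eq_real_of_nat intro!: ennreal_leI)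
      ultimately have "z' \<le> ennreal (G ?n z)" using z' by (simp add: eG less_imp_le)
      then show "y \<le> (SUP n. ennreal (G n z))" using z' by (intro SUP_upper2[of ?n]) auto
    qed
  qed
  have real: "(\<lambda>y. \<integral>\<^sup>+z. ennreal (G n z) \<partial>point_conv x y) \<in> borel_measurable borel"
    "(\<integral>\<^sup>+y. \<integral>\<^sup>+z. ennreal (G n z) \<partial>point_conv x y \<partial>M) = (\<integral>\<^sup>+z. ennreal (G n z) \<partial>M)" for n
  proof -
    have "G n z \<le> real n" for z using Gn[of n z] by (rule order.trans) (auto simp: indicator_def)
    from nn_integral_translation_real[OF intG G0 this]
    show "(\<lambda>y. \<integral>\<^sup>+z. ennreal (G n z) \<partial>point_conv x y) \<in> borel_measurable borel"
      "(\<integral>\<^sup>+y. \<integral>\<^sup>+z. ennreal (G n z) \<partial>point_conv x y \<partial>M) = (\<integral>\<^sup>+z. ennreal (G n z) \<partial>M)" by auto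
  qed
  have mc: "(\<integral>\<^sup>+z. g z \<partial>N) = (SUP n. \<integral>\<^sup>+z. ennreal (G n z) \<partial>N)" if [measurable_cong]: "sets N = sets borel" for N
    unfolding sup[symmetric] by (intro nn_integral_monotone_convergence_SUP inc) measurable
  note [measurable] = real(1)
  show "(\<lambda>y. \<integral>\<^sup>+z. g z \<partial>point_conv x y) \<in> borel_measurable borel"
    by (subst mc) auto
  have "(\<integral>\<^sup>+y. \<integral>\<^sup>+z. g z \<partial>point_conv x y \<partial>M) = (\<integral>\<^sup>+y. (SUP n. \<integral>\<^sup>+z. ennreal (G n z) \<partial>point_conv x y) \<partial>M)"
    by (subst mc) auto
  also have "\<dots> = (SUP n. \<integral>\<^sup>+y. \<integral>\<^sup>+z. ennreal (G n z) \<partial>point_conv x y \<partial>M)"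
    using inc by (intro nn_integral_monotone_convergence_SUP) (auto simp: incseq_def le_fun_def intro!: nn_integral_mono)
  also have "\<dots> = (\<integral>\<^sup>+z. g z \<partial>M)" unfolding real(2) by (rule mc[symmetric]) simp
  finally show "(\<integral>\<^sup>+y. \<integral>\<^sup>+z. g z \<partial>point_conv x y \<partial>M) = (\<integral>\<^sup>+z. g z \<partial>M)" .
qed

text \<open>Invariance applied to the indicator of N. For each fixed x, changing a function on a
  null set therefore changes its translate only at almost no y.\<close>

lemma null_set_translation:
  assumes N: "N \<in> null_sets M"
  shows "AE y in M. emeasure (point_conv x y) N = 0"
proof -
  have [measurable]: "N \<in> sets borel" using null_setsD2[OF N] by simp
  have ind: "indicator N \<in> borel_measurable (borel :: 'a measure)" by measurable
  have "levels_finite M (indicator N)"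
    by (rule levels_finite_integrable) (use null_setsD1[OF N] in auto)
  from nn_integral_translation[OF ind this, of x] null_setsD1[OF N]
  show ?thesis by (simp add: nn_integral_0_iff_AE)
qed

lemma point_conv_commute: "point_conv x y = point_conv y x"
  by (simp add: conv_commute)


section \<open>Bump functions at the identity and the involution\<close>

lemma translation_bump:
  fixes k :: "'a \<Rightarrow> real"
  assumes k: "continuous_on UNIV k" "\<And>x. 0 \<le> k x" "\<And>x. k x \<le> 1"
    and L: "compact L" "\<And>x. x \<notin> L \<Longrightarrow> k x = 0"
  shows "continuous_on UNIV (\<lambda>z. LINT w|point_conv (fst z) (snd z). k w)"
    and "(\<integral>\<^sup>+w. ennreal (k w) \<partial>point_conv x y) = ennreal (LINT w|point_conv x y. k w)"
    and "0 \<le> (LINT w|point_conv x y. k w)"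
    and "(\<integral>\<^sup>+y. ennreal (LINT w|point_conv x y. k w) \<partial>M) = (\<integral>\<^sup>+w. ennreal (k w) \<partial>M)"
    and "(\<integral>\<^sup>+w. ennreal (k w) \<partial>M) < \<infinity>"
proof -
  have [measurable]: "k \<in> borel_measurable borel" using k(1) by (rule borel_measurable_continuous_onI)
  have "bounded (range k)" using k(2,3) by (auto simp: bounded_iff abs_le_iff intro!: exI[of _ 1] order.trans[OF _ k(2)])
  then show "continuous_on UNIV (\<lambda>z. LINT w|point_conv (fst z) (snd z). k w)"
    by (rule continuous_integral_point_conv[OF k(1)])
  show nn: "(\<integral>\<^sup>+w. ennreal (k w) \<partial>point_conv x y) = ennreal (LINT w|point_conv x y. k w)" for x y
  proof -
    interpret prob_space "point_conv x y" by (rule prob_space_point_conv)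
    show ?thesis using k by (intro nn_integral_eq_integral integrable_const_bound[of _ 1]) auto
  qed
  show "0 \<le> (LINT w|point_conv x y. k w)" by (intro integral_nonneg_AE) (simp add: k)
  have [measurable]: "L \<in> sets borel" using L(1) by (rule borel_compact)
  have "(\<integral>\<^sup>+w. ennreal (k w) \<partial>M) \<le> (\<integral>\<^sup>+w. indicator L w \<partial>M)"
  proof (intro nn_integral_mono)
    fix w show "ennreal (k w) \<le> indicator L w"
      using k(3)[of w] L(2)[of w] ennreal_leI[OF k(3)[of w]] by (auto simp: indicator_def)
  qed
  also have "\<dots> = emeasure M L" by (rule nn_integral_indicator) simp
  also have "\<dots> < \<infinity>" using L(1) by (rule haar_compact_finite)
  finally show fin: "(\<integral>\<^sup>+w. ennreal (k w) \<partial>M) < \<infinity>" .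
  show "(\<integral>\<^sup>+y. ennreal (LINT w|point_conv x y. k w) \<partial>M) = (\<integral>\<^sup>+w. ennreal (k w) \<partial>M)"
    using nn_integral_translation(2)[of "\<lambda>w. ennreal (k w)" x] fin
    by (simp add: nn levels_finite_integrable)
qed

lemma identity_bump:
  assumes "open V" "e \<in> V"
  obtains k :: "'a \<Rightarrow> real" and L where "continuous_on UNIV k" "\<And>x. 0 \<le> k x" "\<And>x. k x \<le> 1" "k e = 1"
    "\<And>x. x \<notin> V \<Longrightarrow> k x = 0" "compact L" "\<And>x. x \<notin> L \<Longrightarrow> k x = 0"
proof -
  obtain W L where W: "open W" "compact L" "{e} \<subseteq> W" "W \<subseteq> L"
    using compact_neighbourhood[of "{e}"] by auto
  obtain k :: "'a \<Rightarrow> real" where k: "continuous_on UNIV k" "\<And>x. 0 \<le> k x" "\<And>x. k x \<le> 1"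
    "\<And>x. x \<in> {e} \<Longrightarrow> k x = 1" "\<And>x. x \<notin> V \<inter> W \<Longrightarrow> k x = 0"
    using Urysohn_compact_open[of "{e}" "V \<inter> W"] W assms by auto
  show thesis by (rule that[of k L]) (use k W in auto)
qed

text \<open>If k had integral 0, so would all its translates. The translate by u~ is continuous and
  positive at u, so every point would have a null open neighbourhood; compact sets would be null,
  and by inner regularity the whole space.\<close>

lemma haar_bump_pos:
  fixes k :: "'a \<Rightarrow> real"
  assumes k: "continuous_on UNIV k" "\<And>x. 0 \<le> k x" "\<And>x. k x \<le> 1" "k e = 1"
    and L: "compact L" "\<And>x. x \<notin> L \<Longrightarrow> k x = 0"
  shows "0 < (\<integral>\<^sup>+w. ennreal (k w) \<partial>M)"
proof (rule ccontr)
  note T = translation_bump[OF k(1-3) L]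
  assume "\<not> ?thesis"
  then have 0: "(\<integral>\<^sup>+y. ennreal (LINT w|point_conv x y. k w) \<partial>M) = 0" for x
    using T(4)[of x] by simp
  have null: "\<exists>U. open U \<and> u \<in> U \<and> emeasure M U = 0" for u
  proof -
    let ?F = "\<lambda>y. LINT w|point_conv (invol u) y. k w"
    have cF: "continuous_on UNIV ?F"
    proof -
      have "continuous_on UNIV (\<lambda>y. (invol u, y))" by (intro continuous_on_Pair continuous_on_const continuous_on_id)
      from continuous_on_compose2[OF T(1) this] show ?thesis by simp
    qed
    then have [measurable]: "?F \<in> borel_measurable borel" by (rule borel_measurable_continuous_onI)
    have "open {y. 0 < ?F y}" using cF by (intro open_Collect_less continuous_intros) auto
    moreover have "0 < ?F u"
    proof -
      have "e \<in> point_supp (invol u) u" using identity_in_supp by simp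
      moreover have "open {z. 1 / 2 < k z}" using k(1) by (intro open_Collect_less continuous_intros) auto
      ultimately have "0 < emeasure (point_conv (invol u) u) {z. 1 / 2 < k z}"
        using k(4) by (intro emeasure_pos_supp_measure[OF conv_point_prob(1)]) auto
      then have "\<not> (AE z in point_conv (invol u) u. k z = 0)"
        using \<open>open {z. 1 / 2 < k z}\<close> by (rule_tac emeasure_pos_not_AE) auto
      moreover have [measurable]: "k \<in> borel_measurable borel" using k(1) by (rule borel_measurable_continuous_onI)
      ultimately have "(\<integral>\<^sup>+w. ennreal (k w) \<partial>point_conv (invol u) u) \<noteq> 0"
      proof (rule_tac notI)
        assume "(\<integral>\<^sup>+w. ennreal (k w) \<partial>point_conv (invol u) u) = 0"
        then have "AE w in point_conv (invol u) u. ennreal (k w) = 0" by (simp add: nn_integral_0_iff_AE)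
        then have "AE w in point_conv (invol u) u. k w = 0"
          by eventually_elim (use k(2) in \<open>auto simp: ennreal_eq_0_iff intro: antisym\<close>)
        then show False using \<open>\<not> (AE z in point_conv (invol u) u. k z = 0)\<close> by simp
      qed
      then show ?thesis using T(3)[of "invol u" u] by (simp add: T(2) ennreal_eq_0_iff)
    qed
    moreover have "emeasure M {y. 0 < ?F y} = 0"
    proof -
      have "AE y in M. ?F y = 0"
        using 0[of "invol u"] T(3)[of "invol u"] by (subst (asm) nn_integral_0_iff_AE) (auto simp: ennreal_eq_0_iff intro: antisym elim!: eventually_mono)
      then have "AE y in M. y \<notin> {y. 0 < ?F y}" by eventually_elim auto
      then have "{y. 0 < ?F y} \<in> null_sets M"
        using \<open>open {y. 0 < ?F y}\<close> by (subst AE_iff_null_sets) auto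
      then show ?thesis by auto
    qed
    ultimately show ?thesis by blast
  qed
  then obtain U where U: "\<And>u. open (U u)" "\<And>u. u \<in> U u" "\<And>u. emeasure M (U u) = 0" by metis
  have "emeasure M C = 0" if C: "compact C" for C
  proof -
    have "C \<subseteq> (\<Union>u\<in>C. U u)" using U(2) by blast
    then obtain D where D: "D \<subseteq> C" "finite D" "C \<subseteq> (\<Union>u\<in>D. U u)" by (rule compactE_image[OF C U(1)])
    have "emeasure M C \<le> emeasure M (\<Union>u\<in>D. U u)" using D U(1) by (intro emeasure_mono) auto
    also have "\<dots> \<le> (\<Sum>u\<in>D. emeasure M (U u))" using D U(1) by (intro emeasure_subadditive_finite) auto
    finally show ?thesis using U(3) by simp
  qed
  then have "emeasure M UNIV = 0" by (subst haar_inner_regular) (auto simp: SUP_eq_iff intro!: antisym SUP_least)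
  then show False using haar by (simp add: haar_measure_def)
qed

lemma open_invol_vimage: "open U \<Longrightarrow> open (invol -` U)"
  using invol_continuous by (simp add: continuous_on_open_vimage)

lemma compact_invol_vimage: "compact C \<Longrightarrow> compact (invol -` C)"
  unfolding invol_image[symmetric]
  by (rule compact_continuous_image[OF continuous_on_subset[OF invol_continuous]]) auto

text \<open>With \<open>k\<close> a bump function at the identity, the integral of \<open>k (x * y)\<close> over
  \<open>x \<in> C\<^sup>~\<close>, \<open>y \<in> U\<close> equals \<open>\<integral>k \<cdot> \<lambda>(C\<^sup>~)\<close> when \<open>y\<close> is integrated first
  and is at most \<open>\<integral>k \<cdot> \<lambda>(U)\<close> when \<open>x\<close> is.\<close>

lemma haar_invol_compact_le:
  assumes C: "compact C" and U: "open U" "C \<subseteq> U" and UL: "U \<subseteq> L" "compact L"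
  shows "emeasure M (invol -` C) \<le> emeasure M U"
proof -
  obtain V where V: "open V" "e \<in> V" "\<And>u y. u \<in> C \<Longrightarrow> y \<notin> U \<Longrightarrow> point_supp (invol u) y \<inter> V = {}"
    using identity_neighbourhood[OF C U] by blast
  obtain k :: "'a \<Rightarrow> real" and K where k: "continuous_on UNIV k" "\<And>x. 0 \<le> k x" "\<And>x. k x \<le> 1" "k e = 1"
    "\<And>x. x \<notin> V \<Longrightarrow> k x = 0" "compact K" "\<And>x. x \<notin> K \<Longrightarrow> k x = 0"
    using identity_bump[OF V(1,2)] by metis
  note T = translation_bump[OF k(1-3,6,7)]
  define \<kappa> where "\<kappa> = (\<integral>\<^sup>+w. ennreal (k w) \<partial>M)"
  have \<kappa>: "0 < \<kappa>" "\<kappa> < \<infinity>" unfolding \<kappa>_def using T(5) haar_bump_pos[OF k(1-4,6,7)] by auto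
  define h where "h z = (LINT w|point_conv (fst z) (snd z). k w)" for z
  let ?C = "invol -` C"
  have cC: "compact ?C" by (rule compact_invol_vimage[OF C])
  have [measurable]: "?C \<in> sets borel" "U \<in> sets borel" "L \<in> sets borel"
    using cC U UL by (auto intro: borel_compact)
  \<comment> \<open>Product measurability is available on compact rectangles only, hence
    \<open>L\<close>; since U \<subseteq> L, the extra factor changes nothing on C~ \<times>
    U.\<close>
  define E where "E x y = ennreal (indicator (?C \<times> L) (x, y) * h (x, y))" for x y
  have [measurable]: "case_prod E \<in> borel_measurable (borel \<Otimes>\<^sub>M borel)"
    unfolding E_def case_prod_unfold prod.collapse
    using measurable_continuous_compact_rectangle[OF T(1)[folded h_def] cC UL(2)] by measurable
  have hm [measurable]: "(\<lambda>y. h (x, y)) \<in> borel_measurable borel" for x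
  proof -
    have "continuous_on UNIV (\<lambda>y. (x, y))" by (intro continuous_on_Pair continuous_on_const continuous_on_id)
    from continuous_on_compose2[OF T(1)[folded h_def] this] show ?thesis
      by (intro borel_measurable_continuous_onI) simp
  qed
  have hcomm: "h (x, y) = h (y, x)" for x y by (simp add: h_def point_conv_commute)
  have h\<kappa>: "(\<integral>\<^sup>+y. ennreal (h (x, y)) \<partial>M) = \<kappa>" for x using T(4)[of x] by (simp add: h_def \<kappa>_def)
  \<comment> \<open>For x in C~ and y outside U the support of x * y misses \<open>V\<close> by the
    choice of \<open>V\<close>, and k vanishes off \<open>V\<close>.\<close>
  have h0: "h (x, y) = 0" if x: "x \<in> ?C" and y: "y \<notin> U" for x y
  proof -
    have "AE w in point_conv x y. k w = 0"
      using AE_supp_measure[OF conv_point_prob(1), of x y]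
    proof eventually_elim
      case (elim w)
      then have "w \<notin> V" using V(3)[of "invol x" y] x y by (auto simp: invol_invol)
      then show ?case by (rule k(5))
    qed
    then show ?thesis by (simp add: h_def integral_eq_zero_AE)
  qed
  \<comment> \<open>Cutting down to C~ and U leaves finite measures, as Fubini's theorem
    requires.\<close>
  let ?N1 = "density M (indicator ?C)" and ?N2 = "density M (indicator U)"
  have emC: "emeasure M ?C < \<infinity>" and emL: "emeasure M L < \<infinity>" using haar_compact_finite[OF cC] haar_compact_finite[OF UL(2)] by simp_all
  have emU: "emeasure M U < \<infinity>" using emeasure_mono[OF UL(1), of M] emL by (auto intro: le_less_trans)
  interpret N1: finite_measure ?N1
    using emC by (intro finite_measureI) (simp add: emeasure_density)
  interpret N2: finite_measure ?N2
    using emU by (intro finite_measureI) (simp add: emeasure_density)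
  interpret pair_sigma_finite ?N1 ?N2 ..
  have "\<kappa> * emeasure M ?C = (\<integral>\<^sup>+x\<in>?C. \<kappa> \<partial>M)" by (simp add: nn_integral_cmult_indicator)
  also have "\<dots> = (\<integral>\<^sup>+x. (\<integral>\<^sup>+y. E x y \<partial>?N2) \<partial>?N1)"
  proof -
    have "(\<integral>\<^sup>+y. E x y \<partial>?N2) = \<kappa>" if x: "x \<in> ?C" for x
    proof -
      have "(\<integral>\<^sup>+y. E x y \<partial>?N2) = (\<integral>\<^sup>+y. indicator U y * E x y \<partial>M)"
        by (rule nn_integral_density) measurable
      also have "\<dots> = (\<integral>\<^sup>+y. ennreal (h (x, y)) \<partial>M)"
        using x h0[OF x] UL(1) by (intro nn_integral_cong) (auto simp: E_def indicator_def)
      finally show ?thesis by (simp add: h\<kappa>)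
    qed
    then show ?thesis
      by (subst nn_integral_density) (auto intro!: nn_integral_cong simp: indicator_def)
  qed
  also have "\<dots> = (\<integral>\<^sup>+y. (\<integral>\<^sup>+x. E x y \<partial>?N1) \<partial>?N2)"
    by (rule Fubini'[symmetric]) simp
  also have "\<dots> = (\<integral>\<^sup>+y. indicator U y * (\<integral>\<^sup>+x. E x y \<partial>?N1) \<partial>M)"
    by (rule nn_integral_density) measurable
  \<comment> \<open>With x integrated first, commutativity turns the inner integral into part of a
    translate by y, which has integral \<open>\<kappa>\<close>.\<close>
  also have "\<dots> \<le> (\<integral>\<^sup>+y. indicator U y * \<kappa> \<partial>M)"
  proof (intro nn_integral_mono mult_left_mono)
    fix y
    have "(\<integral>\<^sup>+x. E x y \<partial>?N1) = (\<integral>\<^sup>+x. indicator ?C x * E x y \<partial>M)"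
      by (rule nn_integral_density) measurable
    also have "\<dots> \<le> (\<integral>\<^sup>+x. ennreal (h (y, x)) \<partial>M)"
      by (intro nn_integral_mono) (auto simp: E_def indicator_def hcomm[of _ y])
    finally show "(\<integral>\<^sup>+x. E x y \<partial>?N1) \<le> \<kappa>" by (simp add: h\<kappa>)
  qed simp
  also have "\<dots> = \<kappa> * emeasure M U" by (simp add: mult.commute[of "indicator U _"] nn_integral_cmult_indicator)
  finally show ?thesis using \<kappa> by (simp add: ennreal_mult_le_mult_iff)
qed

text \<open>Outer regularity shrinks U to C, and intersecting with a relatively compact
  \<open>W\<close> provides the compact superset. The estimate for C~ in place of C is the reverse
  inequality.\<close>

lemma haar_invol_compact:
  assumes C: "compact C"
  shows "emeasure M (invol -` C) = emeasure M C"
proof -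
  have le: "emeasure M (invol -` C) \<le> emeasure M C" if C: "compact C" for C
  proof -
    obtain W L where W: "open W" "compact L" "C \<subseteq> W" "W \<subseteq> L" using compact_neighbourhood[OF C] by metis
    have "emeasure M (invol -` C) \<le> emeasure M U" if "open U" "C \<subseteq> U" for U
    proof -
      have "emeasure M (invol -` C) \<le> emeasure M (U \<inter> W)"
        using that W by (intro haar_invol_compact_le[OF C, of _ L]) auto
      also have "\<dots> \<le> emeasure M U" using that by (intro emeasure_mono) auto
      finally show ?thesis .
    qed
    then show ?thesis using C by (subst haar_outer_regular) (auto intro!: INF_greatest borel_compact)
  qed
  from le[OF compact_invol_vimage[OF C]] le[OF C] show ?thesis by simp
qed

lemma haar_invol_open:
  assumes U: "open U"
  shows "emeasure M (invol -` U) = emeasure M U"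
proof -
  have le: "emeasure M U \<le> emeasure M (invol -` U)" if U: "open U" for U
  proof (subst haar_inner_regular[OF U], rule SUP_least, clarsimp)
    fix C assume C: "compact C" "C \<subseteq> U"
    have "emeasure M C = emeasure M (invol -` C)" using haar_invol_compact[OF C(1)] by simp
    also have "\<dots> \<le> emeasure M (invol -` U)" using C open_invol_vimage[OF U] by (intro emeasure_mono) auto
    finally show "emeasure M C \<le> emeasure M (invol -` U)" .
  qed
  from le[OF open_invol_vimage[OF U]] le[OF U] show ?thesis by simp
qed

text \<open>Compact sets yield open sets by inner regularity, and open sets yield Borel sets by
  outer regularity. One inequality is enough each time, because the involution is its own
  inverse.\<close>

lemma haar_invol: "distr M borel invol = M"
proof (rule measure_eqI)
  fix A assume "A \<in> sets (distr M borel invol)"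
  then have A: "A \<in> sets borel" by simp
  have [measurable]: "invol \<in> measurable M borel"
    using borel_measurable_continuous_onI[OF invol_continuous] by simp
  have le: "emeasure M (invol -` A) \<le> emeasure M A" if A: "A \<in> sets borel" for A
  proof (subst haar_outer_regular[OF A], rule INF_greatest, clarsimp)
    fix U assume U: "open U" "A \<subseteq> U"
    have "emeasure M (invol -` A) \<le> emeasure M (invol -` U)"
      using U open_invol_vimage[OF U(1)] by (intro emeasure_mono) auto
    then show "emeasure M (invol -` A) \<le> emeasure M U" by (simp add: haar_invol_open[OF U(1)])
  qed
  have "emeasure (distr M borel invol) A = emeasure M (invol -` A)"
    using A by (subst emeasure_distr) auto
  also have "\<dots> = emeasure M A"
    using le[OF A] le[of "invol -` A"] A by (intro antisym) auto
  finally show "emeasure (distr M borel invol) A = emeasure M A" .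
qed simp

end

section \<open>Baire approximation\<close>

lemma levels_finite_mono:
  assumes "levels_finite N g" "g \<in> borel_measurable N" "\<And>x. g' x \<le> g x"
  shows "levels_finite N g'"
proof -
  have "superlevel N g' s \<le> superlevel N g s" for s
    unfolding superlevel_def using assms by (intro emeasure_mono) (auto intro: less_le_trans)
  then show ?thesis using assms(1) by (auto simp: levels_finite_def intro: le_less_trans)
qed

context haar_hypergroup
begin

lemma measurable_ident_baire: "(\<lambda>x. x) \<in> measurable (point_conv x y) baire"
  by (auto simp: measurable_def sets_baire_borel)

text \<open>For a zero set A of g the indicator is the limit of the functions max(0, 1 - n|g|).
  Their integrals are continuous in (x, y), hence product measurable on Q \<times> Q, and zero sets
  form an intersection-stable generator. The products of point masses are pushed forward to the
  Baire \<sigma>-algebra because the argument reaches only its sets.\<close>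

lemma measurable_point_conv_kernel:
  assumes C: "\<And>n::nat. compact (C n)"
  defines "Q \<equiv> \<Union>n. C n"
  shows "(\<lambda>z. distr (point_conv (fst z) (snd z)) baire (\<lambda>x. x)) \<in>
    measurable (restrict_space (borel \<Otimes>\<^sub>M borel) (Q \<times> Q)) (subprob_algebra baire)"
proof (rule measurable_subprob_algebra_generated[OF sets_baire])
  let ?Z = "{{x. g x = 0} | g :: 'a \<Rightarrow> real. continuous_on UNIV g}"
  have Z: "\<exists>g :: 'a \<Rightarrow> real. A = {x. g x = 0} \<and> continuous_on UNIV g" if "A \<in> ?Z" for A
    using that by (simp only: mem_Collect_eq)
  show "Int_stable ?Z"
  proof (rule Int_stableI)
    fix A B assume "A \<in> ?Z" "B \<in> ?Z"
    obtain f :: "'a \<Rightarrow> real" where f: "A = {x. f x = 0}" "continuous_on UNIV f"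
      using Z[OF \<open>A \<in> ?Z\<close>] by (elim exE conjE) (rule_tac that; assumption)
    obtain g :: "'a \<Rightarrow> real" where g: "B = {x. g x = 0}" "continuous_on UNIV g"
      using Z[OF \<open>B \<in> ?Z\<close>] by (elim exE conjE) (rule_tac that; assumption)
    note fg = f g
    have "A \<inter> B = {x. \<bar>f x\<bar> + \<bar>g x\<bar> = 0}" using fg by (auto simp: add_nonneg_eq_0_iff)
    moreover have "continuous_on UNIV (\<lambda>x. \<bar>f x\<bar> + \<bar>g x\<bar>)" using fg by (intro continuous_intros)
    ultimately show "A \<inter> B \<in> ?Z" unfolding mem_Collect_eq by (intro exI conjI)
  qed
  show "subprob_space (distr (point_conv (fst z) (snd z)) baire (\<lambda>x. x))" for z
    by (intro prob_space_imp_subprob_space prob_space.prob_space_distr prob_space_point_conv measurable_ident_baire)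
  show "(\<lambda>z. emeasure (distr (point_conv (fst z) (snd z)) baire (\<lambda>x. x)) A) \<in>
      borel_measurable (restrict_space (borel \<Otimes>\<^sub>M borel) (Q \<times> Q))" if A: "A \<in> ?Z" for A
  proof -
    obtain g :: "'a \<Rightarrow> real" where g: "A = {x. g x = 0}" "continuous_on UNIV g"
      using Z[OF A] by (elim exE conjE) (rule_tac that; assumption)
    have AB: "A \<in> sets baire" unfolding g(1) by (rule zero_set_baire[OF g(2)])
    have [measurable]: "A \<in> sets borel" by (rule sets_baire_borel[OF AB])
    define k where "k n x = max 0 (1 - real n * \<bar>g x\<bar>)" for n x
    have k: "continuous_on UNIV (k n)" "0 \<le> k n x" "k n x \<le> 1" for n x
      unfolding k_def using g(2) by (auto intro!: continuous_intros)
    have [measurable]: "k n \<in> borel_measurable borel" for n by (rule borel_measurable_continuous_onI[OF k(1)])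
    have bk: "bounded (range (k n))" for n
      using k(2,3) by (auto simp: bounded_iff abs_le_iff intro!: exI[of _ 1] order.trans[OF _ k(2)])
    have lim: "(\<lambda>n. k n x) \<longlonglongrightarrow> indicator A x" for x
    proof (cases "g x = 0")
      case True then show ?thesis by (simp add: k_def g(1))
    next
      case False
      obtain N where N: "1 / \<bar>g x\<bar> \<le> real N" using real_arch_simple by blast
      have "k n x = 0" if "N \<le> n" for n
      proof -
        have "1 / \<bar>g x\<bar> \<le> real n" using N that by simp
        then show ?thesis using False by (simp add: k_def field_simps)
      qed
      then show ?thesis using False
        by (intro tendsto_eventually eventually_sequentiallyI[of N]) (simp add: g(1))
    qed
    have conv: "(\<lambda>n. LINT w|point_conv x y. k n w) \<longlonglongrightarrow> measure (point_conv x y) A" for x y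
    proof -
      interpret prob_space "point_conv x y" by (rule prob_space_point_conv)
      have "(\<lambda>n. LINT w|point_conv x y. k n w) \<longlonglongrightarrow> (LINT w|point_conv x y. indicator A w)"
        by (rule integral_dominated_convergence[where w = "\<lambda>_. 1"]) (use lim k in auto)
      then show ?thesis by simp
    qed
    have "(\<lambda>z. measure (point_conv (fst z) (snd z)) A) \<in> borel_measurable (restrict_space (borel \<Otimes>\<^sub>M borel) (Q \<times> Q))"
    proof (rule borel_measurable_LIMSEQ_real[OF conv])
      show "(\<lambda>z. LINT w|point_conv (fst z) (snd z). k n w) \<in> borel_measurable (restrict_space (borel \<Otimes>\<^sub>M borel) (Q \<times> Q))" for n
        unfolding Q_def by (rule measurable_continuous_sigma_compact[OF continuous_integral_point_conv[OF k(1) bk] C])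
    qed
    moreover have "emeasure (distr (point_conv x y) baire (\<lambda>x. x)) A = ennreal (measure (point_conv x y) A)" for x y
    proof -
      interpret prob_space "point_conv x y" by (rule prob_space_point_conv)
      show ?thesis using AB by (subst emeasure_distr[OF measurable_ident_baire]) (auto simp: emeasure_eq_measure)
    qed
    ultimately show ?thesis by simp
  qed
  have "emeasure (distr (point_conv x y) baire (\<lambda>x. x)) UNIV = 1" for x y
    using prob_space.emeasure_space_1[OF prob_space_point_conv, of x y] sets.top[of "baire :: 'a measure"]
    by (subst emeasure_distr[OF measurable_ident_baire]) auto
  then show "(\<lambda>z. emeasure (distr (point_conv (fst z) (snd z)) baire (\<lambda>x. x)) UNIV) \<in>
      borel_measurable (restrict_space (borel \<Otimes>\<^sub>M borel) (Q \<times> Q))" by simp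
qed auto

lemma measurable_nn_integral_point_conv:
  fixes g :: "'a \<Rightarrow> ennreal"
  assumes C: "\<And>n::nat. compact (C n)" and g: "g \<in> borel_measurable baire"
  defines "Q \<equiv> \<Union>n. C n"
  shows "(\<lambda>z. (\<integral>\<^sup>+w. g w \<partial>point_conv (fst z) (snd z)) * indicator (Q \<times> Q) z) \<in> borel_measurable (borel \<Otimes>\<^sub>M borel)"
proof -
  have [measurable]: "Q \<in> sets borel" unfolding Q_def using C by (intro sets.countable_UN) (auto intro: borel_compact)
  have "(\<lambda>z. \<integral>\<^sup>+w. g w \<partial>distr (point_conv (fst z) (snd z)) baire (\<lambda>x. x)) \<in>
     borel_measurable (restrict_space (borel \<Otimes>\<^sub>M borel) (Q \<times> Q))"
    using measurable_compose[OF measurable_point_conv_kernel[OF C, folded Q_def] nn_integral_measurable_subprob_algebra[OF g]]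
    by (simp add: Q_def)
  also have "(\<lambda>z. \<integral>\<^sup>+w. g w \<partial>distr (point_conv (fst z) (snd z)) baire (\<lambda>x. x)) =
     (\<lambda>z. \<integral>\<^sup>+w. g w \<partial>point_conv (fst z) (snd z))"
    by (intro ext nn_integral_distr measurable_ident_baire) (use g in simp)
  finally show ?thesis
    by (subst (asm) borel_measurable_restrict_space_iff_ennreal) (auto intro!: sets.Int pair_measureI)
qed

lemma haar_open_superset:
  assumes B: "B \<in> sets borel" "emeasure M B < \<infinity>" and \<epsilon>: "0 < \<epsilon>"
  shows "\<exists>U. open U \<and> B \<subseteq> U \<and> emeasure M U < emeasure M B + ennreal \<epsilon>"
proof -
  have "emeasure M B < emeasure M B + ennreal \<epsilon>"
    using B(2) \<epsilon> by (cases "emeasure M B")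
      (auto simp: ennreal_plus[symmetric] ennreal_less_iff simp del: ennreal_plus)
  then have "(INF U\<in>{U. open U \<and> B \<subseteq> U}. emeasure M U) < emeasure M B + ennreal \<epsilon>"
    unfolding haar_outer_regular[OF B(1), symmetric] .
  then show ?thesis by (auto simp: INF_less_iff)
qed

text \<open>Inner regularity is assumed for open sets only. Take an open U around A, a compact
  \<open>C\<close> inside U and an open V around U - A: then C - V is compact and lies in A. What is
  lost is contained in (U - C) \<union> V, of measure at most \<epsilon> + 2\<epsilon>.\<close>

lemma haar_finite_inner_regular:
  assumes A: "A \<in> sets borel" "emeasure M A < \<infinity>" and \<epsilon>: "0 < \<epsilon>"
  obtains C where "compact C" "C \<subseteq> A" "emeasure M (A - C) \<le> ennreal (3 * \<epsilon>)"
proof -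
  obtain U where U: "open U" "A \<subseteq> U" "emeasure M U < emeasure M A + ennreal \<epsilon>"
    using haar_open_superset[OF A \<epsilon>] by blast
  have Ufin: "emeasure M U < \<infinity>" using less_trans[OF U(3), of top] A(2) by simp
  have UA: "emeasure M (U - A) \<le> ennreal \<epsilon>"
  proof -
    have "emeasure M (U - A) = emeasure M U - emeasure M A" using U A by (intro emeasure_Diff) auto
    also have "\<dots> \<le> ennreal \<epsilon>" using U(3) A(2) by (auto simp: ennreal_minus_le_iff less_imp_le add.commute)
    finally show ?thesis .
  qed
  have UAf: "emeasure M (U - A) < \<infinity>" using UA by (auto intro: le_less_trans)
  obtain V where V: "open V" "U - A \<subseteq> V" "emeasure M V < emeasure M (U - A) + ennreal \<epsilon>"
    using haar_open_superset[of "U - A", OF _ UAf \<epsilon>] U A by auto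
  have "emeasure M (U - A) + ennreal \<epsilon> \<le> ennreal \<epsilon> + ennreal \<epsilon>" using UA by (intro add_mono) auto
  then have V2: "emeasure M V \<le> ennreal (2 * \<epsilon>)" using V(3) \<epsilon> by (simp flip: ennreal_plus)
  obtain C where C: "compact C" "C \<subseteq> U" "emeasure M U \<le> emeasure M C + ennreal \<epsilon>"
  proof (cases "emeasure M U = 0")
    case True then show thesis by (intro that[of "{}"]) auto
  next
    case False
    obtain u where u: "emeasure M U = ennreal u" "0 < u" using False Ufin by (cases "emeasure M U") auto
    \<comment> \<open>If u < \<epsilon> the left side is truncated to 0, which is still below u
      because the case of measure 0 was separated.\<close>
    have "ennreal (u - \<epsilon>) < emeasure M U" using u \<epsilon> by (simp add: ennreal_lessI)
    then obtain C where C: "compact C" "C \<subseteq> U" "ennreal (u - \<epsilon>) < emeasure M C"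
      by (subst (asm) haar_inner_regular[OF U(1)]) (auto simp: less_SUP_iff)
    have "emeasure M U = ennreal u" by (rule u)
    also have "\<dots> \<le> ennreal (u - \<epsilon>) + ennreal \<epsilon>"
    proof (cases "\<epsilon> \<le> u")
      case True then show ?thesis using \<epsilon> by (simp flip: ennreal_plus)
    next
      case False then show ?thesis using \<epsilon> by (simp add: ennreal_neg ennreal_leI)
    qed
    also have "\<dots> \<le> emeasure M C + ennreal \<epsilon>" using C(3) by (intro add_mono) auto
    finally show thesis using C by (intro that) auto
  qed
  have [measurable]: "C \<in> sets borel" using C by (auto intro: borel_compact)
  have "emeasure M (U - C) = emeasure M U - emeasure M C"
    using U C haar_compact_finite[OF C(1)] by (intro emeasure_Diff) auto
  also have "\<dots> \<le> ennreal \<epsilon>" using C(3) haar_compact_finite[OF C(1)] by (auto simp: ennreal_minus_le_iff add.commute)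
  finally have UC: "emeasure M (U - C) \<le> ennreal \<epsilon>" .
  show thesis
  proof (rule that[of "C - V"])
    show "compact (C - V)" using C V by (intro compact_diff)
    show "C - V \<subseteq> A" using C V by auto
    have "emeasure M (A - (C - V)) \<le> emeasure M ((U - C) \<union> V)"
      using U V C by (intro emeasure_mono) auto
    also have "\<dots> \<le> emeasure M (U - C) + emeasure M V"
      using U V by (intro emeasure_subadditive) auto
    also have "\<dots> \<le> ennreal \<epsilon> + ennreal (2 * \<epsilon>)" using UC V2 by (rule add_mono)
    also have "\<dots> = ennreal (3 * \<epsilon>)" using \<epsilon> by (simp flip: ennreal_plus)
    finally show "emeasure M (A - (C - V)) \<le> ennreal (3 * \<epsilon>)" .
  qed
qed

lemma haar_compact_exhaustion:
  assumes A: "A \<in> sets borel" "emeasure M A < \<infinity>"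
  obtains C :: "nat \<Rightarrow> 'a set" where "\<And>n. compact (C n)" "\<And>n. C n \<subseteq> A" "emeasure M (A - (\<Union>n. C n)) = 0"
proof -
  have "\<exists>C. compact C \<and> C \<subseteq> A \<and> emeasure M (A - C) \<le> ennreal (3 * (1 / Suc n))" for n
    using haar_finite_inner_regular[OF A, of "1 / Suc n"] by (metis of_nat_0_less_iff zero_less_Suc zero_less_divide_1_iff)
  then obtain C where C: "\<And>n. compact (C n)" "\<And>n. C n \<subseteq> A"
    "\<And>n. emeasure M (A - C n) \<le> ennreal (3 * (1 / Suc n))" by metis
  have "(\<lambda>n. ennreal (3 * (1 / Suc n))) \<longlonglongrightarrow> ennreal (3 * 0)"
    by (intro tendsto_ennrealI tendsto_mult_left LIMSEQ_Suc[OF lim_1_over_n])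
  moreover have "emeasure M (A - (\<Union>n. C n)) \<le> ennreal (3 * (1 / Suc n))" for n
  proof -
    have "emeasure M (A - (\<Union>n. C n)) \<le> emeasure M (A - C n)"
      using A C(1) by (intro emeasure_mono) (auto intro: borel_compact)
    then show ?thesis using C(3)[of n] by simp
  qed
  ultimately have "emeasure M (A - (\<Union>n. C n)) \<le> ennreal (3 * 0)"
    by (intro LIMSEQ_le_const) auto
  then show thesis using C by (intro that[of C]) auto
qed

text \<open>Urysohn functions are 1 on C and 0 off open sets whose measures tend to that of C. The
  set where all of them equal 1 is a countable intersection of zero sets; it lies in every one of
  these open sets, so it exceeds C by a null set, and in a relatively compact set, so it is
  compact.\<close>

lemma compact_baire_hull:
  assumes C: "compact C"
  obtains C' where "compact C'" "C \<subseteq> C'" "C' \<in> sets baire" "emeasure M (C' - C) = 0"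
proof -
  obtain W L where W: "open W" "compact L" "C \<subseteq> W" "W \<subseteq> L" using compact_neighbourhood[OF C] by metis
  have CB: "C \<in> sets borel" using C by (rule borel_compact)
  have Cf: "emeasure M C < \<infinity>" using C by (rule haar_compact_finite)
  have "\<exists>U. open U \<and> C \<subseteq> U \<and> emeasure M U < emeasure M C + ennreal (1 / Suc n)" for n
    by (rule haar_open_superset[OF CB Cf]) simp
  then obtain U where U: "\<And>n. open (U n)" "\<And>n. C \<subseteq> U n" "\<And>n. emeasure M (U n) < emeasure M C + ennreal (1 / Suc n)" by metis
  have "\<exists>k :: 'a \<Rightarrow> real. continuous_on UNIV k \<and> (\<forall>x\<in>C. k x = 1) \<and> (\<forall>x. x \<notin> U n \<inter> W \<longrightarrow> k x = 0)" for n
    using Urysohn_compact_open[OF C, of "U n \<inter> W"] U W by (metis Int_subset_iff open_Int)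
  then obtain k :: "nat \<Rightarrow> 'a \<Rightarrow> real" where k: "\<And>n. continuous_on UNIV (k n)" "\<And>n x. x \<in> C \<Longrightarrow> k n x = 1"
    "\<And>n x. x \<notin> U n \<inter> W \<Longrightarrow> k n x = 0" by metis
  define C' where "C' = (\<Inter>n. {x. k n x - 1 = 0})"
  have CC: "C \<subseteq> C'" using k(2) by (auto simp: C'_def)
  have "{x. k n x - 1 = 0} \<in> sets baire" for n by (intro zero_set_baire continuous_intros k(1))
  then have B: "C' \<in> sets baire" unfolding C'_def by (intro sets.countable_INT) blast+
  then have B': "C' \<in> sets borel" by (rule sets_baire_borel)
  have sub: "C' \<subseteq> U n \<inter> W" for n
  proof
    fix x assume "x \<in> C'"
    then have "k n x = 1" by (auto simp: C'_def)
    then show "x \<in> U n \<inter> W" using k(3)[of x n] by auto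
  qed
  have cl: "closed C'" unfolding C'_def using k(1)
    by (intro closed_INT ballI closed_Collect_eq continuous_intros)
  have "C' = L \<inter> C'" using sub W by blast
  then have "compact C'" using compact_Int_closed[OF W(2) cl] by simp
  moreover have "emeasure M (C' - C) = 0"
  proof -
    have "(\<lambda>n. ennreal (1 / Suc n)) \<longlonglongrightarrow> ennreal 0"
      by (intro tendsto_ennrealI LIMSEQ_Suc[OF lim_1_over_n])
    moreover have "emeasure M (C' - C) \<le> ennreal (1 / Suc n)" for n
    proof -
      have "emeasure M (C' - C) \<le> emeasure M (U n - C)" using sub[of n] U(1) CB by (intro emeasure_mono) auto
      also have "\<dots> = emeasure M (U n) - emeasure M C" using U CB Cf by (intro emeasure_Diff) auto
      also have "\<dots> \<le> ennreal (1 / Suc n)"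
        using U(3)[of n] Cf by (auto simp: ennreal_minus_le_iff less_imp_le add.commute simp del: of_nat_Suc)
      finally show ?thesis .
    qed
    ultimately have "emeasure M (C' - C) \<le> ennreal 0" by (intro LIMSEQ_le_const) auto
    then show ?thesis by simp
  qed
  ultimately show thesis using CC B by (intro that)
qed

lemma baire_approximation_set:
  assumes A: "A \<in> sets borel" "emeasure M A < \<infinity>"
  obtains C :: "nat \<Rightarrow> 'a set" where "\<And>n. compact (C n)" "\<And>n. C n \<in> sets baire"
    "AE x in M. x \<in> A \<longleftrightarrow> x \<in> (\<Union>n. C n)"
proof -
  obtain D :: "nat \<Rightarrow> 'a set" where D: "\<And>n. compact (D n)" "\<And>n. D n \<subseteq> A" "emeasure M (A - (\<Union>n. D n)) = 0"
    using haar_compact_exhaustion[OF A] by metis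
  have "\<forall>n. \<exists>C. compact C \<and> D n \<subseteq> C \<and> C \<in> sets baire \<and> emeasure M (C - D n) = 0"
    using compact_baire_hull[OF D(1)] by metis
  then obtain C where C: "\<And>n. compact (C n)" "\<And>n. D n \<subseteq> C n" "\<And>n. C n \<in> sets baire" "\<And>n. emeasure M (C n - D n) = 0"
    by metis
  have CDB: "C n \<in> sets borel" "D n \<in> sets borel" for n using C(1) D(1) by (auto intro: borel_compact)
  have "A - (\<Union>n. D n) \<in> null_sets M"
    using A D by (intro null_setsI) (auto intro: borel_compact)
  then have 1: "AE x in M. x \<notin> A - (\<Union>n. D n)" by (rule AE_not_in)
  have "C n - D n \<in> null_sets M" for n
    using C(4) CDB by (intro null_setsI) auto
  then have "AE x in M. x \<notin> C n - D n" for n by (rule AE_not_in)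
  then have "AE x in M. \<forall>n. x \<notin> C n - D n" unfolding AE_all_countable by blast
  with 1 have "AE x in M. x \<in> A \<longleftrightarrow> x \<in> (\<Union>n. C n)"
    by eventually_elim (use C(2) D(2) in blast)
  then show thesis using C by (intro that)
qed

text \<open>g is the supremum over the positive rationals a of a times the indicator of g > a. Each
  of these countably many level sets has finite measure and agrees almost everywhere with a
  countable union of compact Baire sets.\<close>

lemma baire_approximation_ennreal:
  fixes g :: "'a \<Rightarrow> ennreal"
  assumes g: "g \<in> borel_measurable (completion M)" and fin: "levels_finite (completion M) g"
  obtains g' and C :: "nat \<Rightarrow> 'a set" where "g' \<in> borel_measurable baire" "AE x in M. g x = g' x"
    "\<And>n. compact (C n)" "\<And>x. x \<notin> (\<Union>n. C n) \<Longrightarrow> g' x = 0"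
proof -
  obtain r :: "nat \<Rightarrow> rat" where r: "range r = {q. 0 < q}"
  proof -
    have "countable {q::rat. 0 < q}" "{q::rat. 0 < q} \<noteq> {}" by (auto intro!: exI[of _ 1])
    then show thesis using that[of "from_nat_into {q. 0 < q}"] by (simp add: range_from_nat_into)
  qed
  define a where "a n = (of_rat (r n) :: real)" for n
  have a0: "0 < a n" for n using r by (auto simp: a_def)
  have adense: "\<exists>n. y < ennreal (a n) \<and> ennreal (a n) < z" if yz: "y < z" for y z
  proof -
    obtain w where w: "y < w" "w < z" using dense[OF yz] by auto
    then obtain u where u: "w = ennreal u" "0 \<le> u" by (cases w) auto
    obtain w' where w': "w < w'" "w' < z" using dense[OF w(2)] by auto
    then obtain u' where u': "w' = ennreal u'" "0 \<le> u'" by (cases w') auto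
    have "u < u'" using w' u u' by (simp add: ennreal_less_iff)
    then obtain q where q: "u < of_rat q" "of_rat q < u'" using of_rat_dense by blast
    have "0 < (of_rat q :: real)" using q(1) u(2) by linarith
    then have "q \<in> range r" unfolding r by simp
    then obtain n where n: "r n = q" by auto
    have "ennreal u < ennreal (a n)" "ennreal (a n) < ennreal u'"
      using q u u' n less_imp_le[OF a0[of n]] by (auto simp: a_def ennreal_less_iff)
    then show ?thesis using w w' u u' by (intro exI[of _ n]) (auto intro: less_trans)
  qed
  have "\<exists>C :: nat \<Rightarrow> 'a set. (\<forall>m. compact (C m) \<and> C m \<in> sets baire) \<and> (AE x in M. ennreal (a n) < g x \<longleftrightarrow> x \<in> (\<Union>m. C m))" for n
  proof -
    let ?A = "{x \<in> space (completion M). ennreal (a n) < g x}"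
    have A: "?A \<in> sets (completion M)" using g by measurable
    have "emeasure (completion M) ?A < \<infinity>"
      using fin a0[of n] by (auto simp: levels_finite_def superlevel_def)
    \<comment> \<open>The level set is measurable for the completion only, so its Borel main part is
      approximated and the null part is discarded.\<close>
    then have mfin: "emeasure M (main_part M ?A) < \<infinity>" using A by simp
    have mB: "main_part M ?A \<in> sets borel" using main_part_sets[OF A] by simp
    obtain C :: "nat \<Rightarrow> 'a set" where C: "\<And>n. compact (C n)" "\<And>n. C n \<in> sets baire"
      "AE x in M. x \<in> main_part M ?A \<longleftrightarrow> x \<in> (\<Union>n. C n)"
      by (rule baire_approximation_set[OF mB mfin]) (rule_tac that; assumption)
    have "AE x in M. x \<notin> null_part M ?A" by (rule AE_notin_null_part[OF A])
    with C(3) have "AE x in M. ennreal (a n) < g x \<longleftrightarrow> x \<in> (\<Union>m. C m)"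
    proof eventually_elim
      case (elim x)
      have "x \<in> ?A \<longleftrightarrow> x \<in> main_part M ?A \<union> null_part M ?A"
        using main_part_null_part_Un[OF A] by simp
      then show ?case using elim by simp
    qed
    then show ?thesis using C by blast
  qed
  then obtain C :: "nat \<Rightarrow> nat \<Rightarrow> 'a set" where C: "\<And>n m. compact (C n m)" "\<And>n m. C n m \<in> sets baire"
    "\<And>n. AE x in M. ennreal (a n) < g x \<longleftrightarrow> x \<in> (\<Union>m. C n m)" by metis
  define g' where "g' x = (SUP n. ennreal (a n) * indicator (\<Union>m. C n m) x)" for x
  \<comment> \<open>A single sequence that enumerates the doubly indexed compact sets.\<close>
  define D where "D i = (case prod_decode i of (n, m) \<Rightarrow> C n m)" for i
  show thesis
  proof (rule that[of g' D])
    have "(\<Union>m. C n m) \<in> sets baire" for n using C(2) by auto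
    then show "g' \<in> borel_measurable baire" unfolding g'_def by measurable
    have "AE x in M. \<forall>n. ennreal (a n) < g x \<longleftrightarrow> x \<in> (\<Union>m. C n m)"
      using C(3) by (subst AE_all_countable) blast
    then show "AE x in M. g x = g' x"
    proof eventually_elim
      case (elim x)
      show ?case
      proof (rule antisym)
        show "g' x \<le> g x" unfolding g'_def
        proof (rule SUP_least)
          fix n show "ennreal (a n) * indicator (\<Union>m. C n m) x \<le> g x"
            using elim[rule_format, of n] by (auto simp: indicator_def)
        qed
        show "g x \<le> g' x"
        proof (rule dense_le)
          fix y assume "y < g x"
          then obtain n where n: "y < ennreal (a n)" "ennreal (a n) < g x" using adense by blast
          then have "x \<in> (\<Union>m. C n m)" using elim by blast
          then have "y \<le> ennreal (a n) * indicator (\<Union>m. C n m) x" using n by simp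
          then show "y \<le> g' x" unfolding g'_def by (rule SUP_upper2[OF UNIV_I])
        qed
      qed
    qed
    show "compact (D i)" for i using C(1) by (auto simp: D_def split: prod.split)
    show "g' x = 0" if x: "x \<notin> (\<Union>i. D i)" for x
    proof -
      have "x \<notin> (\<Union>m. C n m)" for n
      proof
        assume "x \<in> (\<Union>m. C n m)"
        then obtain m where "x \<in> C n m" by auto
        then have "x \<in> D (prod_encode (n, m))" by (simp add: D_def)
        then show False using x by blast
      qed
      then show ?thesis by (simp add: g'_def)
    qed
  qed
qed

text \<open>Apply the nonnegative case to the positive and negative parts of the real and imaginary
  parts, each of which is bounded by |f|. Since \<open>ennreal\<close> sends negative numbers to 0,
  it takes these parts by itself.\<close>

lemma baire_approximation_complex:
  fixes f :: "'a \<Rightarrow> complex"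
  assumes [measurable]: "f \<in> borel_measurable (completion M)"
    and fin: "levels_finite (completion M) (\<lambda>x. ennreal (cmod (f x)))"
  obtains f' and C :: "nat \<Rightarrow> 'a set" where "f' \<in> borel_measurable baire" "AE x in M. f x = f' x"
    "\<And>n. compact (C n)" "\<And>x. x \<notin> (\<Union>n. C n) \<Longrightarrow> f' x = 0"
proof -
  have part: "\<exists>g' (C :: nat \<Rightarrow> 'a set). g' \<in> borel_measurable baire \<and> (AE x in M. ennreal (h x) = g' x) \<and>
      (\<forall>n. compact (C n)) \<and> (\<forall>x. x \<notin> (\<Union>n. C n) \<longrightarrow> g' x = 0)"
    if [measurable]: "h \<in> borel_measurable (completion M)" and h: "\<And>x. h x \<le> cmod (f x)" for h :: "'a \<Rightarrow> real"
  proof -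
    have "levels_finite (completion M) (\<lambda>x. ennreal (h x))"
      by (rule levels_finite_mono[OF fin]) (auto intro: ennreal_leI h)
    then show ?thesis using baire_approximation_ennreal[of "\<lambda>x. ennreal (h x)"] by (metis that(1) measurable_compose[OF _ measurable_ennreal])
  qed
  obtain g1 and C1 :: "nat \<Rightarrow> 'a set" where 1: "g1 \<in> borel_measurable baire" "AE x in M. ennreal (Re (f x)) = g1 x"
      "\<And>n. compact (C1 n)" "\<And>x. x \<notin> (\<Union>n. C1 n) \<Longrightarrow> g1 x = 0"
  proof -
    have "Re (f x) \<le> cmod (f x)" for x by (rule complex_Re_le_cmod)
    then show thesis using part[of "\<lambda>x. Re (f x)"] that by auto
  qed
  obtain g2 and C2 :: "nat \<Rightarrow> 'a set" where 2: "g2 \<in> borel_measurable baire" "AE x in M. ennreal (- Re (f x)) = g2 x"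
      "\<And>n. compact (C2 n)" "\<And>x. x \<notin> (\<Union>n. C2 n) \<Longrightarrow> g2 x = 0"
  proof -
    have "- Re (f x) \<le> cmod (f x)" for x using abs_Re_le_cmod[of "f x"] by linarith
    then show thesis using part[of "\<lambda>x. - Re (f x)"] that by auto
  qed
  obtain g3 and C3 :: "nat \<Rightarrow> 'a set" where 3: "g3 \<in> borel_measurable baire" "AE x in M. ennreal (Im (f x)) = g3 x"
      "\<And>n. compact (C3 n)" "\<And>x. x \<notin> (\<Union>n. C3 n) \<Longrightarrow> g3 x = 0"
  proof -
    have "Im (f x) \<le> cmod (f x)" for x using abs_Im_le_cmod[of "f x"] by linarith
    then show thesis using part[of "\<lambda>x. Im (f x)"] that by auto
  qed
  obtain g4 and C4 :: "nat \<Rightarrow> 'a set" where 4: "g4 \<in> borel_measurable baire" "AE x in M. ennreal (- Im (f x)) = g4 x"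
      "\<And>n. compact (C4 n)" "\<And>x. x \<notin> (\<Union>n. C4 n) \<Longrightarrow> g4 x = 0"
  proof -
    have "- Im (f x) \<le> cmod (f x)" for x using abs_Im_le_cmod[of "f x"] by linarith
    then show thesis using part[of "\<lambda>x. - Im (f x)"] that by auto
  qed
  note [measurable] = 1(1) 2(1) 3(1) 4(1)
  define f' where "f' x = Complex (enn2real (g1 x) - enn2real (g2 x)) (enn2real (g3 x) - enn2real (g4 x))" for x
  show thesis
  proof (rule that[of f' "\<lambda>n. C1 n \<union> C2 n \<union> C3 n \<union> C4 n"])
    show "f' \<in> borel_measurable baire"
      unfolding borel_measurable_complex_iff f'_def by simp
    show "AE x in M. f x = f' x"
      using 1(2) 2(2) 3(2) 4(2)
    proof eventually_elim
      case (elim x)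
      have pm: "enn2real (ennreal u) - enn2real (ennreal (- u)) = u" for u
        by (cases "0 \<le> u") (auto simp: ennreal_neg)
      show ?case unfolding f'_def elim[symmetric] pm by simp
    qed
    show "compact (C1 n \<union> C2 n \<union> C3 n \<union> C4 n)" for n using 1 2 3 4 by (intro compact_Un)
    show "f' x = 0" if "x \<notin> (\<Union>n. C1 n \<union> C2 n \<union> C3 n \<union> C4 n)" for x
      using that 1(4)[of x] 2(4)[of x] 3(4)[of x] 4(4)[of x] by (simp add: f'_def complex_eq_iff)
  qed
qed

end

section \<open>O'Neil's inequality\<close>

lemma ennreal_minus_add_min: "(a - ennreal s) + min a (ennreal s) = a"
proof (cases "a \<le> ennreal s")
  case True
  then have "a < top" by (rule le_less_trans) simp
  then show ?thesis using True by (simp add: diff_eq_0_iff_ennreal min_def)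
qed (simp add: min_def diff_add_cancel_ennreal)

lemma superlevel_min:
  assumes "0 \<le> s" "0 < \<sigma>"
  shows "superlevel N (\<lambda>w. min (F w) (ennreal s)) \<sigma> = (if \<sigma> < s then superlevel N F \<sigma> else 0)"
  using assms by (auto simp: superlevel_def ennreal_less_iff)

lemma level_integral_min:
  assumes "0 \<le> s"
  shows "level_integral N (\<lambda>w. min (F w) (ennreal s)) m = (\<integral>\<^sup>+\<sigma>\<in>{0<..<s}. min m (superlevel N F \<sigma>) \<partial>lborel)"
  unfolding level_integral_def
  using assms by (intro nn_integral_cong) (auto simp: indicator_def superlevel_min)

context haar_hypergroup
begin

abbreviation nn_translation :: "('a \<Rightarrow> ennreal) \<Rightarrow> 'a \<Rightarrow> 'a \<Rightarrow> ennreal" where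
  "nn_translation F x y \<equiv> (\<integral>\<^sup>+w. F w \<partial>point_conv x y)"

text \<open>G stands for y \<mapsto> \<phi>(y~), so the involution is absorbed. Its invariance
  enters later through two facts: G has the distribution function of \<phi>, and null sets are
  preserved.\<close>

definition nn_conv :: "('a \<Rightarrow> ennreal) \<Rightarrow> ('a \<Rightarrow> ennreal) \<Rightarrow> 'a \<Rightarrow> ennreal" where
  "nn_conv F G x = (\<integral>\<^sup>+y. nn_translation F x y * G y \<partial>M)"

lemma nn_translation_le_const:
  assumes "\<And>w. F w \<le> c"
  shows "nn_translation F x y \<le> c"
proof -
  interpret prob_space "point_conv x y" by (rule prob_space_point_conv)
  have "nn_translation F x y \<le> (\<integral>\<^sup>+w. c \<partial>point_conv x y)" by (intro nn_integral_mono assms)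
  also have "\<dots> = c" using emeasure_space_1 by simp
  finally show ?thesis .
qed

lemma nn_translation_minus_min:
  assumes [measurable]: "F \<in> borel_measurable borel"
  shows "nn_translation F x y = nn_translation (\<lambda>w. F w - ennreal s) x y + nn_translation (\<lambda>w. min (F w) (ennreal s)) x y"
proof -
  have "nn_translation F x y = (\<integral>\<^sup>+w. (F w - ennreal s) + min (F w) (ennreal s) \<partial>point_conv x y)"
    by (simp add: ennreal_minus_add_min)
  then show ?thesis by (subst (asm) nn_integral_add) auto
qed

lemma nn_conv_sup_bound_left:
  assumes [measurable]: "G \<in> borel_measurable borel" and "\<And>w. F w \<le> c"
  shows "nn_conv F G x \<le> c * (\<integral>\<^sup>+y. G y \<partial>M)"
proof -
  have "nn_conv F G x \<le> (\<integral>\<^sup>+y. c * G y \<partial>M)"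
    unfolding nn_conv_def by (intro nn_integral_mono mult_right_mono nn_translation_le_const assms) simp
  then show ?thesis by (simp add: nn_integral_cmult)
qed

lemma nn_conv_sup_bound_right:
  assumes F: "F \<in> borel_measurable borel" "levels_finite M F" and "\<And>w. G w \<le> c"
  shows "nn_conv F G x \<le> c * (\<integral>\<^sup>+y. F y \<partial>M)"
proof -
  note [measurable] = nn_integral_translation(1)[OF F]
  have "nn_conv F G x \<le> (\<integral>\<^sup>+y. nn_translation F x y * c \<partial>M)"
    unfolding nn_conv_def by (intro nn_integral_mono mult_left_mono assms) simp
  also have "\<dots> = (\<integral>\<^sup>+y. F y \<partial>M) * c"
    by (subst nn_integral_multc) (auto simp: nn_integral_translation(2)[OF F])
  finally show ?thesis by (simp add: mult.commute)
qed

lemma levels_finite_minus: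
  assumes "levels_finite M F" "F \<in> borel_measurable borel"
  shows "levels_finite M (\<lambda>w. F w - ennreal s)"
  by (rule levels_finite_mono[OF assms(1)]) (use assms(2) in \<open>auto simp: diff_le_self_ennreal\<close>)

lemma levels_finite_min:
  assumes "levels_finite M F" "F \<in> borel_measurable borel"
  shows "levels_finite M (\<lambda>w. min (F w) (ennreal s))"
  by (rule levels_finite_mono[OF assms(1)]) (use assms(2) in auto)

text \<open>Cut F at the height s that belongs to t, the measure of B. The upper part contributes at
  most its integral, which translation preserves, and the lower part at most s t; together they are
  exactly the level integral at t.\<close>

lemma nn_integral_translation_set_le:
  assumes F: "F \<in> borel_measurable borel" "levels_finite M F" and B: "B \<in> sets borel" "emeasure M B < \<infinity>"
  shows "(\<integral>\<^sup>+y. nn_translation F x y * indicator B y \<partial>M) \<le> level_integral M F (emeasure M B)"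
proof (cases "emeasure M B = 0 \<or> level_integral M F (emeasure M B) = top")
  case True
  then show ?thesis
  proof
    assume "emeasure M B = 0"
    then have "B \<in> null_sets M" using B(1) by auto
    then have "AE y in M. nn_translation F x y * indicator B y = 0"
      by (rule AE_mp[OF AE_not_in]) auto
    then show ?thesis by (subst nn_integral_cong_AE[of _ "\<lambda>_. 0"]) auto
  qed (simp add: infinity_ennreal_def)
next
  case False
  obtain t where t: "emeasure M B = ennreal t" "0 < t"
    using False B(2) by (cases "emeasure M B") (auto simp: less_le)
  note [measurable] = F(1) B(1)
  have "level_integral M F (ennreal t) < \<infinity>" using False t by (simp add: less_top)
  then obtain s where s: "0 \<le> s" "\<And>\<sigma>. s < \<sigma> \<Longrightarrow> superlevel M F \<sigma> \<le> ennreal t"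
    "\<And>\<sigma>. 0 < \<sigma> \<Longrightarrow> \<sigma> < s \<Longrightarrow> ennreal t < superlevel M F \<sigma>"
    using split_level[of F M t] t by auto
  let ?F1 = "\<lambda>w. F w - ennreal s"
  have F1: "?F1 \<in> borel_measurable borel" "levels_finite M ?F1"
    using levels_finite_minus[OF F(2,1)] by auto
  note [measurable] = nn_integral_translation(1)[OF F1]
  have "(\<integral>\<^sup>+y. nn_translation F x y * indicator B y \<partial>M) \<le>
    (\<integral>\<^sup>+y. nn_translation ?F1 x y + ennreal s * indicator B y \<partial>M)"
  proof (intro nn_integral_mono)
    fix y
    have "nn_translation F x y \<le> nn_translation ?F1 x y + ennreal s"
      unfolding nn_translation_minus_min[OF F(1), of x y s]
      by (intro add_left_mono nn_translation_le_const) auto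
    then show "nn_translation F x y * indicator B y \<le> nn_translation ?F1 x y + ennreal s * indicator B y"
      by (auto simp: indicator_def)
  qed
  also have "\<dots> = (\<integral>\<^sup>+y. nn_translation ?F1 x y \<partial>M) + ennreal s * ennreal t"
    by (subst nn_integral_add) (auto simp: nn_integral_cmult_indicator t)
  also have "\<dots> = level_integral M F (ennreal t)"
    using nn_integral_translation(2)[OF F1] level_integral_split[OF _ t(2) F(2) s]
    by (simp add: mult.commute)
  finally show ?thesis by (simp add: t)
qed

text \<open>Slice G by the layer cake formula and apply
  \<open>nn_integral_translation_set_le\<close> to each level set of G. Truncating F confines its
  heights to (0, s), and truncating G confines the slices to (0, r). The bound holds at every
  x.\<close>

lemma nn_conv_truncated_le:
  assumes F: "F \<in> borel_measurable borel" "levels_finite M F" and G: "G \<in> borel_measurable borel" "levels_finite M G"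
    and s: "0 \<le> s" and r: "0 \<le> r"
  shows "nn_conv (\<lambda>w. min (F w) (ennreal s)) (\<lambda>w. min (G w) (ennreal r)) x \<le>
    (\<integral>\<^sup>+\<tau>\<in>{0<..<r}. (\<integral>\<^sup>+\<sigma>\<in>{0<..<s}. min (superlevel M F \<sigma>) (superlevel M G \<tau>) \<partial>lborel) \<partial>lborel)"
proof -
  let ?F = "\<lambda>w. min (F w) (ennreal s)" and ?G = "\<lambda>w. min (G w) (ennreal r)"
  note [measurable] = F(1) G(1)
  have F2: "?F \<in> borel_measurable borel" "levels_finite M ?F" using levels_finite_min[OF F(2,1)] by auto
  have G2: "levels_finite M ?G" using levels_finite_min[OF G(2,1)] .
  have "nn_conv ?F ?G x = (\<integral>\<^sup>+\<tau>\<in>{0<..}. (\<integral>\<^sup>+y. nn_translation ?F x y * indicator {y\<in>space M. ennreal \<tau> < ?G y} y \<partial>M) \<partial>lborel)"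
    unfolding nn_conv_def
    by (rule nn_integral_layer_cake)
       (use nn_integral_translation(1)[OF F2] G2 in \<open>auto simp: levels_finite_def superlevel_def\<close>)
  also have "\<dots> \<le> (\<integral>\<^sup>+\<tau>\<in>{0<..<r}. (\<integral>\<^sup>+\<sigma>\<in>{0<..<s}. min (superlevel M F \<sigma>) (superlevel M G \<tau>) \<partial>lborel) \<partial>lborel)"
  proof (intro nn_integral_mono)
    fix \<tau> :: real
    let ?B = "{y\<in>space M. ennreal \<tau> < ?G y}"
    show "(\<integral>\<^sup>+y. nn_translation ?F x y * indicator ?B y \<partial>M) * indicator {0<..} \<tau> \<le>
      (\<integral>\<^sup>+\<sigma>\<in>{0<..<s}. min (superlevel M F \<sigma>) (superlevel M G \<tau>) \<partial>lborel) * indicator {0<..<r} \<tau>"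
    proof (cases "0 < \<tau>")
      case True
      have em: "emeasure M ?B = (if \<tau> < r then superlevel M G \<tau> else 0)"
        using superlevel_min[OF r True, where F = G and N = M] by (simp only: superlevel_def)
      have B: "?B \<in> sets borel" using sets_haar by measurable
      have Bf: "emeasure M ?B < \<infinity>" using G2 True by (auto simp: levels_finite_def superlevel_def)
      have le: "(\<integral>\<^sup>+y. nn_translation ?F x y * indicator ?B y \<partial>M) \<le> level_integral M ?F (emeasure M ?B)"
        by (rule nn_integral_translation_set_le[OF F2 B Bf])
      show ?thesis
      proof (cases "\<tau> < r")
        case True
        then show ?thesis using le \<open>0 < \<tau>\<close> unfolding em level_integral_min[OF s]
          by (simp add: min.commute)
      next
        case False
        then have m0: "emeasure M ?B = 0" unfolding em by simp
        have "level_integral M ?F (emeasure M ?B) = 0" unfolding m0 level_integral_def by simp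
        then show ?thesis using le False by simp
      qed
    qed simp
  qed
  finally show ?thesis .
qed

lemma nn_conv_add_left:
  assumes "F1 \<in> borel_measurable borel" "levels_finite M F1" "F2 \<in> borel_measurable borel" "levels_finite M F2"
    "G \<in> borel_measurable borel" and "\<And>y. nn_translation F x y = nn_translation F1 x y + nn_translation F2 x y"
  shows "nn_conv F G x = nn_conv F1 G x + nn_conv F2 G x"
proof -
  note [measurable] = assms(5) nn_integral_translation(1)[OF assms(1,2)] nn_integral_translation(1)[OF assms(3,4)]
  show ?thesis unfolding nn_conv_def assms(6) by (simp add: distrib_right nn_integral_add)
qed

lemma nn_conv_minus_min_right:
  assumes F: "F \<in> borel_measurable borel" "levels_finite M F" and G: "G \<in> borel_measurable borel"
  shows "nn_conv F G x = nn_conv F (\<lambda>w. G w - ennreal r) x + nn_conv F (\<lambda>w. min (G w) (ennreal r)) x"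
proof -
  note [measurable] = G nn_integral_translation(1)[OF F]
  have "nn_conv F G x = (\<integral>\<^sup>+y. nn_translation F x y * ((G y - ennreal r) + min (G y) (ennreal r)) \<partial>M)"
    by (simp add: nn_conv_def ennreal_minus_add_min)
  then show ?thesis unfolding nn_conv_def by (subst (asm) distrib_left, subst (asm) nn_integral_add) auto
qed

text \<open>\<open>Q\<close> absorbs all points that contribute when \<open>F\<close> and \<open>G\<close> live on
  \<open>SF\<close> and \<open>SG\<close>; being \<open>\<sigma>\<close>-compact, it makes Fubini available although \<open>M\<close> need not be \<open>\<sigma>\<close>-finite.\<close>

context
  fixes E :: "nat \<Rightarrow> 'a set" and Q SF SG :: "'a set"
  assumes E: "\<And>n. compact (E n)" and Q: "Q = (\<Union>n. E n)" and SG: "SG \<subseteq> Q"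
    and product: "\<And>x y w. y \<in> SG \<Longrightarrow> w \<in> SF \<Longrightarrow> w \<in> point_supp x y \<Longrightarrow> x \<in> Q"
begin

lemma Q_borel [measurable]: "Q \<in> sets borel"
  unfolding Q using E by (intro sets.countable_UN) (auto intro: borel_compact)

lemma sigma_finite_restricted: "sigma_finite_measure (density M (indicator Q))"
proof
  have "emeasure (density M (indicator Q)) a \<noteq> \<infinity>" if "a \<in> {UNIV - Q} \<union> range E" for a
  proof -
    have [measurable]: "a \<in> sets borel" using that E by (auto intro: borel_compact)
    have *: "emeasure (density M (indicator Q)) a = emeasure M (Q \<inter> a)"
      by (subst emeasure_density) (auto simp: indicator_inter_arith[symmetric])
    from that show ?thesis
    proof
      assume "a \<in> {UNIV - Q}"
      then have "Q \<inter> a = {}" by auto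
      then show ?thesis unfolding * by simp
    next
      assume "a \<in> range E"
      then obtain n where n: "a = E n" by auto
      have "emeasure M (Q \<inter> a) \<le> emeasure M (E n)" unfolding n using E by (intro emeasure_mono) (auto intro: borel_compact)
      then show ?thesis unfolding * using haar_compact_finite[OF E, of n] by (auto simp: top_unique)
    qed
  qed
  moreover have "{UNIV - Q} \<union> range E \<subseteq> sets borel" using E by (auto intro: borel_compact)
  moreover have "\<Union>({UNIV - Q} \<union> range E) = UNIV" by (auto simp: Q)
  ultimately show "\<exists>A. countable A \<and> A \<subseteq> sets (density M (indicator Q)) \<and>
      \<Union>A = space (density M (indicator Q)) \<and> (\<forall>a\<in>A. emeasure (density M (indicator Q)) a \<noteq> \<infinity>)"
    by (intro exI[of _ "{UNIV - Q} \<union> range E"]) auto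
qed

lemma nn_translation_zero:
  assumes "\<And>w. w \<notin> SF \<Longrightarrow> F w = 0" "y \<in> SG" "x \<notin> Q"
  shows "nn_translation F x y = 0"
proof -
  have "AE w in point_conv x y. F w = 0"
    using AE_supp_measure[OF conv_point_prob(1), of x y]
    by eventually_elim (use product assms in blast)
  then show ?thesis by (subst nn_integral_cong_AE[of _ "\<lambda>_. 0"]) auto
qed

context
  fixes F G :: "'a \<Rightarrow> ennreal"
  assumes F: "F \<in> borel_measurable baire" and F0: "\<And>w. w \<notin> SF \<Longrightarrow> F w = 0"
    and G: "G \<in> borel_measurable borel" and G0: "\<And>y. y \<notin> SG \<Longrightarrow> G y = 0"
begin

lemma nn_conv_zero: "x \<notin> Q \<Longrightarrow> nn_conv F G x = 0"
proof -
  assume x: "x \<notin> Q"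
  have "nn_translation F x y * G y = 0" for y
  proof (cases "y \<in> SG")
    case True
    have "nn_translation F x y = 0" using F0 True x by (rule nn_translation_zero)
    then show ?thesis by simp
  qed (simp add: G0)
  then have "nn_conv F G x = (\<integral>\<^sup>+y. 0 \<partial>M)" unfolding nn_conv_def by (intro nn_integral_cong)
  then show ?thesis by simp
qed

lemma measurable_nn_conv_kernel:
  "(\<lambda>z. nn_translation F (fst z) (snd z) * indicator (Q \<times> Q) z * G (snd z)) \<in> borel_measurable (borel \<Otimes>\<^sub>M borel)"
  using measurable_nn_integral_point_conv[OF E F] G unfolding Q by measurable

text \<open>G vanishes off Q, and for x outside Q the convolution is 0. The inserted indicator of Q
  \<times> Q makes the kernel product measurable, and the restricted measure is
  \<sigma>-finite.\<close>

lemma nn_conv_restricted: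
  "nn_conv F G x = (\<integral>\<^sup>+y. nn_translation F x y * indicator (Q \<times> Q) (x, y) * G y \<partial>density M (indicator Q))"
proof (cases "x \<in> Q")
  case False then show ?thesis by (simp add: nn_conv_zero)
next
  case True
  have m: "(\<lambda>y. nn_translation F x y * indicator (Q \<times> Q) (x, y) * G y) \<in> borel_measurable borel"
    using measurable_compose[OF measurable_Pair1'[of x borel borel] measurable_nn_conv_kernel] by simp
  have "nn_conv F G x = (\<integral>\<^sup>+y. indicator Q y * (nn_translation F x y * indicator (Q \<times> Q) (x, y) * G y) \<partial>M)"
    unfolding nn_conv_def using True SG G0 by (intro nn_integral_cong) (auto simp: indicator_def)
  also have "\<dots> = (\<integral>\<^sup>+y. nn_translation F x y * indicator (Q \<times> Q) (x, y) * G y \<partial>density M (indicator Q))"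
    using m by (intro nn_integral_density[symmetric]) auto
  finally show ?thesis .
qed

lemma measurable_nn_conv: "nn_conv F G \<in> borel_measurable borel"
proof -
  interpret sigma_finite_measure "density M (indicator Q)" by (rule sigma_finite_restricted)
  have "(\<lambda>(x, y). nn_translation F x y * indicator (Q \<times> Q) (x, y) * G y) \<in> borel_measurable (borel \<Otimes>\<^sub>M density M (indicator Q))"
    using measurable_nn_conv_kernel by (simp add: case_prod_unfold cong: measurable_cong_sets)
  from borel_measurable_nn_integral[OF this] show ?thesis by (simp add: nn_conv_restricted[abs_def])
qed

text \<open>After the exchange on Q \<times> Q, commutativity turns the integral over x into the
  integral of a translate by y, which invariance evaluates.\<close>

lemma nn_conv_L1_bound:
  assumes fin: "levels_finite M F"
  shows "(\<integral>\<^sup>+x. nn_conv F G x \<partial>M) \<le> (\<integral>\<^sup>+x. F x \<partial>M) * (\<integral>\<^sup>+x. G x \<partial>M)"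
proof -
  have FB: "F \<in> borel_measurable borel" using F by (rule measurable_baire_borel)
  note [measurable] = FB G nn_integral_translation(1)[OF FB fin] measurable_nn_conv
  let ?N = "density M (indicator Q)"
  interpret sigma_finite_measure ?N by (rule sigma_finite_restricted)
  interpret pair_sigma_finite ?N ?N ..
  let ?K = "\<lambda>x y. nn_translation F x y * indicator (Q \<times> Q) (x, y) * G y"
  have K: "case_prod ?K \<in> borel_measurable (?N \<Otimes>\<^sub>M ?N)"
    using measurable_nn_conv_kernel by (simp add: case_prod_unfold cong: measurable_cong_sets)
  have Km: "(\<lambda>x. ?K x y) \<in> borel_measurable borel" for y
    using measurable_compose[OF measurable_Pair2'[of y borel borel] measurable_nn_conv_kernel] by simp
  have "(\<integral>\<^sup>+x. nn_conv F G x \<partial>M) = (\<integral>\<^sup>+x. indicator Q x * nn_conv F G x \<partial>M)"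
    using nn_conv_zero by (intro nn_integral_cong) (auto simp: indicator_def)
  also have "\<dots> = (\<integral>\<^sup>+x. nn_conv F G x \<partial>?N)"
    by (rule nn_integral_density[symmetric]) auto
  also have "\<dots> = (\<integral>\<^sup>+x. \<integral>\<^sup>+y. ?K x y \<partial>?N \<partial>?N)"
    by (simp add: nn_conv_restricted)
  also have "\<dots> = (\<integral>\<^sup>+y. \<integral>\<^sup>+x. ?K x y \<partial>?N \<partial>?N)"
    by (rule Fubini'[symmetric]) (rule K)
  also have "\<dots> \<le> (\<integral>\<^sup>+y. (\<integral>\<^sup>+x. F x \<partial>M) * G y \<partial>?N)"
  proof (intro nn_integral_mono)
    fix y
    have "(\<integral>\<^sup>+x. ?K x y \<partial>?N) = (\<integral>\<^sup>+x. indicator Q x * ?K x y \<partial>M)"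
      using Km by (intro nn_integral_density) auto
    also have "\<dots> \<le> (\<integral>\<^sup>+x. nn_translation F y x * G y \<partial>M)"
      by (intro nn_integral_mono) (auto simp: indicator_def point_conv_commute[of _ y])
    also have "\<dots> = (\<integral>\<^sup>+x. F x \<partial>M) * G y"
      by (subst nn_integral_multc) (auto simp: nn_integral_translation(2)[OF FB fin])
    finally show "(\<integral>\<^sup>+x. ?K x y \<partial>?N) \<le> (\<integral>\<^sup>+x. F x \<partial>M) * G y" .
  qed
  also have "\<dots> = (\<integral>\<^sup>+y. indicator Q y * ((\<integral>\<^sup>+x. F x \<partial>M) * G y) \<partial>M)"
    by (rule nn_integral_density) auto
  also have "\<dots> \<le> (\<integral>\<^sup>+y. (\<integral>\<^sup>+x. F x \<partial>M) * G y \<partial>M)"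
    by (intro nn_integral_mono) (auto simp: indicator_def)
  also have "\<dots> = (\<integral>\<^sup>+x. F x \<partial>M) * (\<integral>\<^sup>+x. G x \<partial>M)" by (rule nn_integral_cmult) simp
  finally show ?thesis .
qed

end

text \<open>\<open>H\<close> and \<open>B\<close> decompose the convolution as the K-functional at t
  requires. \<open>H\<close> is the convolution of the two upper parts, estimated in L^1;
  \<open>B\<close> collects the sup bounds for the other three products.\<close>

lemma nn_conv_ONeil:
  assumes F: "F \<in> borel_measurable baire" "\<And>w. w \<notin> SF \<Longrightarrow> F w = 0" "levels_finite M F"
    and G: "G \<in> borel_measurable borel" "\<And>y. y \<notin> SG \<Longrightarrow> G y = 0" "levels_finite M G"
    and t: "0 < t" and fin: "level_integral M F (ennreal t) < \<infinity>" "level_integral M G (ennreal t) < \<infinity>"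
  shows "\<exists>H B. H \<in> borel_measurable borel \<and> (\<forall>x. nn_conv F G x \<le> H x + B) \<and>
    (\<integral>\<^sup>+x. H x \<partial>M) + ennreal t * B \<le>
      ennreal t * (\<integral>\<^sup>+u\<in>{t..}. ennreal (1 / u\<^sup>2) * (level_integral M F (ennreal u) * level_integral M G (ennreal u)) \<partial>lborel)"
proof -
  have FB: "F \<in> borel_measurable borel" using F(1) by (rule measurable_baire_borel)
  note [measurable] = FB G(1)
  obtain s where s: "0 \<le> s" "\<And>\<sigma>. s < \<sigma> \<Longrightarrow> superlevel M F \<sigma> \<le> ennreal t"
    "\<And>\<sigma>. 0 < \<sigma> \<Longrightarrow> \<sigma> < s \<Longrightarrow> ennreal t < superlevel M F \<sigma>"
    using split_level[of F M t] t fin by auto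
  obtain r where r: "0 \<le> r" "\<And>\<sigma>. r < \<sigma> \<Longrightarrow> superlevel M G \<sigma> \<le> ennreal t"
    "\<And>\<sigma>. 0 < \<sigma> \<Longrightarrow> \<sigma> < r \<Longrightarrow> ennreal t < superlevel M G \<sigma>"
    using split_level[of G M t] t fin by auto
  define F1 where "F1 w = F w - ennreal s" for w
  define F2 where "F2 w = min (F w) (ennreal s)" for w
  define G1 where "G1 w = G w - ennreal r" for w
  define G2 where "G2 w = min (G w) (ennreal r)" for w
  have F1: "F1 \<in> borel_measurable baire" "F1 \<in> borel_measurable borel" "levels_finite M F1" "\<And>w. w \<notin> SF \<Longrightarrow> F1 w = 0"
    using F(1) levels_finite_minus[OF F(3) FB] F(2) unfolding F1_def[abs_def] by auto
  have F2: "F2 \<in> borel_measurable borel" "levels_finite M F2" "\<And>w. F2 w \<le> ennreal s"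
    using levels_finite_min[OF F(3) FB] unfolding F2_def[abs_def] by auto
  have G1: "G1 \<in> borel_measurable borel" "\<And>w. w \<notin> SG \<Longrightarrow> G1 w = 0"
    using G(2) unfolding G1_def[abs_def] by auto
  have G2: "G2 \<in> borel_measurable borel" "\<And>w. G2 w \<le> ennreal r"
    unfolding G2_def[abs_def] by auto
  define I where "I = (\<integral>\<^sup>+x. F1 x \<partial>M)"
  define J where "J = (\<integral>\<^sup>+x. G1 x \<partial>M)"
  define K where "K = (\<integral>\<^sup>+\<tau>\<in>{0<..<r}. (\<integral>\<^sup>+\<sigma>\<in>{0<..<s}. min (superlevel M F \<sigma>) (superlevel M G \<tau>) \<partial>lborel) \<partial>lborel)"
  have I: "I = (\<integral>\<^sup>+\<sigma>\<in>{s<..}. superlevel M F \<sigma> \<partial>lborel)"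
    unfolding I_def F1_def by (rule nn_integral_minus_level) (use F(3) s(1) in auto)
  have J: "J = (\<integral>\<^sup>+\<sigma>\<in>{r<..}. superlevel M G \<sigma> \<partial>lborel)"
    unfolding J_def G1_def by (rule nn_integral_minus_level) (use G(3) r(1) in auto)
  let ?B = "ennreal s * J + ennreal r * I + K"
  have "nn_conv F G x \<le> nn_conv F1 G1 x + ?B" for x
  proof -
    have "nn_conv F G x = nn_conv F1 G x + nn_conv F2 G x"
      by (rule nn_conv_add_left[OF F1(2,3) F2(1,2) G(1)])
         (unfold F1_def F2_def, rule nn_translation_minus_min[OF FB])
    also have "nn_conv F1 G x = nn_conv F1 G1 x + nn_conv F1 G2 x"
      unfolding G1_def G2_def by (rule nn_conv_minus_min_right[OF F1(2,3) G(1)])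
    also have "nn_conv F2 G x = nn_conv F2 G1 x + nn_conv F2 G2 x"
      unfolding G1_def G2_def by (rule nn_conv_minus_min_right[OF F2(1,2) G(1)])
    also have "nn_conv F1 G1 x + nn_conv F1 G2 x + (nn_conv F2 G1 x + nn_conv F2 G2 x) \<le>
       nn_conv F1 G1 x + ennreal r * I + (ennreal s * J + K)"
    proof (intro add_mono order_refl)
      show "nn_conv F1 G2 x \<le> ennreal r * I" unfolding I_def by (rule nn_conv_sup_bound_right[OF F1(2,3) G2(2)])
      show "nn_conv F2 G1 x \<le> ennreal s * J" unfolding J_def by (rule nn_conv_sup_bound_left[OF G1(1) F2(3)])
      show "nn_conv F2 G2 x \<le> K" unfolding F2_def[abs_def] G2_def[abs_def] K_def
        by (rule nn_conv_truncated_le[OF FB F(3) G(1,3) s(1) r(1)])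
    qed
    finally show ?thesis by (simp add: add_ac)
  qed
  moreover have "nn_conv F1 G1 \<in> borel_measurable borel"
    by (rule measurable_nn_conv[OF F1(1,4) G1])
  moreover have "(\<integral>\<^sup>+x. nn_conv F1 G1 x \<partial>M) + ennreal t * ?B \<le>
      ennreal t * (\<integral>\<^sup>+u\<in>{t..}. ennreal (1 / u\<^sup>2) * (level_integral M F (ennreal u) * level_integral M G (ennreal u)) \<partial>lborel)"
  proof -
    have finA: "superlevel M F \<sigma> < \<infinity>" "superlevel M G \<sigma> < \<infinity>" if "0 < \<sigma>" for \<sigma>
      using that F(3) G(3) by (auto simp: levels_finite_def)
    have mA: "superlevel M F \<in> borel_measurable borel" "superlevel M G \<in> borel_measurable borel" by auto
    have "(\<integral>\<^sup>+x. nn_conv F1 G1 x \<partial>M) + ennreal t * ?B \<le> I * J + ennreal t * ?B"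
      unfolding I_def J_def by (intro add_right_mono nn_conv_L1_bound F1 G1)
    also have "\<dots> \<le> ennreal t * (\<integral>\<^sup>+\<sigma>\<in>{0<..}. (\<integral>\<^sup>+\<tau>\<in>{0<..}.
        truncation_kernel (ennreal t) (superlevel M F \<sigma>) (superlevel M G \<tau>) \<partial>lborel) \<partial>lborel)"
      unfolding I J K_def
      by (rule split_terms_le_truncation_kernel_integral[OF mA finA t s r])
    also have "\<dots> \<le> ennreal t * (\<integral>\<^sup>+u\<in>{t..}. ennreal (1 / u\<^sup>2) * (level_integral M F (ennreal u) * level_integral M G (ennreal u)) \<partial>lborel)"
      unfolding level_integral_def
      by (intro mult_left_mono truncation_kernel_integral_le[OF mA finA t]) auto
    finally show ?thesis .
  qed
  ultimately show ?thesis by blast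
qed

end

end

section \<open>Passage from Baire functions to the completed measure\<close>

lemma measurable_completion_AE_eq:
  fixes f g :: "'a \<Rightarrow> 'b::topological_space"
  assumes g: "g \<in> borel_measurable M" and eq: "AE x in M. f x = g x"
  shows "f \<in> borel_measurable (completion M)"
proof (rule measurableI)
  fix A :: "'b set" assume A: "A \<in> sets borel"
  have "g -` A \<inter> space M \<in> sets (completion M)" using measurable_sets[OF g A] by simp
  moreover have "AE x in completion M. x \<in> g -` A \<inter> space M \<longleftrightarrow> x \<in> f -` A \<inter> space (completion M)"
    using AE_completion[OF eq] by eventually_elim auto
  ultimately show "f -` A \<inter> space (completion M) \<in> sets (completion M)"
    using completion.in_sets_AE by blast
qed simp

lemma superlevel_completion_AE_eq:
  assumes f: "f \<in> borel_measurable (completion M)" and g: "g \<in> borel_measurable M" and eq: "AE x in M. f x = g x"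
  shows "superlevel (completion M) f s = superlevel M g s"
proof -
  have "superlevel (completion M) f s = emeasure (completion M) {x\<in>space M. ennreal s < g x}"
    unfolding superlevel_def
  proof (rule emeasure_eq_AE)
    show "AE x in completion M. x \<in> {x\<in>space (completion M). ennreal s < f x} \<longleftrightarrow> x \<in> {x\<in>space M. ennreal s < g x}"
      using AE_completion[OF eq] by eventually_elim auto
    show "{x\<in>space (completion M). ennreal s < f x} \<in> sets (completion M)" using f by measurable
    show "{x\<in>space M. ennreal s < g x} \<in> sets (completion M)" using g by (intro sets_completionI_sets) measurable
  qed
  also have "\<dots> = superlevel M g s" using g by (simp add: superlevel_def)
  finally show ?thesis .
qed

text \<open>Expresses the integral through four nonnegative integrals, for which measurability in
  (x, y) is known.\<close>

lemma complex_integral_parts: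
  fixes f :: "'a \<Rightarrow> complex"
  assumes f: "integrable M f"
  shows "(LINT x|M. f x) = Complex
    (enn2real (\<integral>\<^sup>+x. ennreal (Re (f x)) \<partial>M) - enn2real (\<integral>\<^sup>+x. ennreal (- Re (f x)) \<partial>M))
    (enn2real (\<integral>\<^sup>+x. ennreal (Im (f x)) \<partial>M) - enn2real (\<integral>\<^sup>+x. ennreal (- Im (f x)) \<partial>M))"
  using integral_bounded_linear[OF bounded_linear_Re f] integral_bounded_linear[OF bounded_linear_Im f]
    real_lebesgue_integral_def[OF integrable_bounded_linear[OF bounded_linear_Re f]]
    real_lebesgue_integral_def[OF integrable_bounded_linear[OF bounded_linear_Im f]]
  by (simp add: complex_eq_iff)

context haar_hypergroup
begin

text \<open>F need not be integrable, but its part above the cut height for t = 1 is, so the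
  translate of that part is finite almost everywhere; the rest is bounded by s.\<close>

lemma nn_translation_finite_AE:
  assumes F: "F \<in> borel_measurable borel" "levels_finite M F" and fin: "level_integral M F (ennreal 1) < \<infinity>"
  shows "AE y in M. nn_translation F x y < \<infinity>"
proof -
  note [measurable] = F(1)
  obtain s where s: "0 \<le> s" "\<And>\<sigma>. s < \<sigma> \<Longrightarrow> superlevel M F \<sigma> \<le> ennreal 1"
    "\<And>\<sigma>. 0 < \<sigma> \<Longrightarrow> \<sigma> < s \<Longrightarrow> ennreal 1 < superlevel M F \<sigma>"
    using split_level[of F M 1] fin by auto
  let ?F1 = "\<lambda>w. F w - ennreal s"
  have F1: "?F1 \<in> borel_measurable borel" "levels_finite M ?F1"
    using levels_finite_minus[OF F(2,1)] by auto
  have "(\<integral>\<^sup>+x. ?F1 x \<partial>M) \<le> level_integral M F (ennreal 1)"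
    using level_integral_split[OF _ zero_less_one F(2) s] by simp
  then have "(\<integral>\<^sup>+x. ?F1 x \<partial>M) \<noteq> \<infinity>" using fin by (auto simp: top_unique)
  then have "(\<integral>\<^sup>+y. nn_translation ?F1 x y \<partial>M) \<noteq> \<infinity>"
    using nn_integral_translation(2)[OF F1, of x] by simp
  then have "AE y in M. nn_translation ?F1 x y \<noteq> \<infinity>"
    using nn_integral_translation(1)[OF F1] by (intro nn_integral_PInf_AE) auto
  then show ?thesis
  proof eventually_elim
    case (elim y)
    have "nn_translation (\<lambda>w. min (F w) (ennreal s)) x y \<le> ennreal s" by (rule nn_translation_le_const) simp
    then have "nn_translation (\<lambda>w. min (F w) (ennreal s)) x y < top" by (rule le_less_trans) simp
    then show ?case using elim by (simp add: nn_translation_minus_min[OF F(1), of x y s] less_top)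
  qed
qed

lemma AE_translation_AE_eq:
  assumes "AE w in M. f w = f' w"
  shows "AE y in M. AE w in point_conv x y. f w = f' w"
proof -
  obtain N where N: "{w \<in> space M. f w \<noteq> f' w} \<subseteq> N" "N \<in> sets M" "emeasure M N = 0"
    using assms by (rule AE_E) 
  then have "N \<in> null_sets M" by auto
  then have "AE y in M. emeasure (point_conv x y) N = 0" by (rule null_set_translation)
  then show ?thesis
  proof eventually_elim
    case (elim y)
    show ?case by (rule AE_I[OF _ elim]) (use N in auto)
  qed
qed

lemma AE_invol:
  assumes "AE w in M. P w"
  shows "AE w in M. P (invol w)"
proof -
  have [measurable]: "invol \<in> measurable M borel"
    using borel_measurable_continuous_onI[OF invol_continuous] by simp
  obtain N where N: "{w \<in> space M. \<not> P w} \<subseteq> N" "N \<in> sets M" "emeasure M N = 0"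
    using assms by (rule AE_E)
  have "emeasure M (invol -` N) = emeasure (distr M borel invol) N"
    using N by (subst emeasure_distr) auto
  then have "emeasure M (invol -` N) = 0" using N by (simp add: haar_invol)
  then show ?thesis using N by (intro AE_I[of _ _ "invol -` N"]) auto
qed

lemma superlevel_invol:
  assumes [measurable]: "g \<in> borel_measurable borel"
  shows "superlevel M (\<lambda>y. g (invol y)) s = superlevel M g s"
proof -
  have [measurable]: "invol \<in> measurable M borel"
    using borel_measurable_continuous_onI[OF invol_continuous] by simp
  have "{y. ennreal s < g y} \<in> sets borel"
  proof -
    have "{y\<in>space borel. ennreal s < g y} \<in> sets borel" by measurable
    then show ?thesis by simp
  qed
  then have "superlevel M g s = emeasure M (invol -` {y. ennreal s < g y})"
    unfolding superlevel_def by (subst haar_invol[symmetric], subst emeasure_distr) auto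
  then show ?thesis by (simp add: superlevel_def vimage_def)
qed

text \<open>If w \<in> supp(x * y), commutativity and cancellation give x \<in> supp(y~ * w). The
  relevant x therefore lie in the supports of products of points of B n and A m, and these are
  contained in one compact set for each pair (n, m).\<close>

lemma product_exhaustion:
  fixes A B :: "nat \<Rightarrow> 'a set"
  assumes "\<And>n. compact (A n)" "\<And>n. compact (B n)"
  obtains E :: "nat \<Rightarrow> 'a set" where "\<And>n. compact (E n)" "(\<Union>n. invol -` B n) \<subseteq> (\<Union>n. E n)"
    "\<And>x y w. y \<in> (\<Union>n. invol -` B n) \<Longrightarrow> w \<in> (\<Union>n. A n) \<Longrightarrow> w \<in> point_supp x y \<Longrightarrow> x \<in> (\<Union>n. E n)"
proof -
  have "\<forall>n m. \<exists>Y. compact Y \<and> (\<forall>y\<in>B n. \<forall>w\<in>A m. point_supp y w \<subseteq> Y)"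
  proof (intro allI)
    fix n m
    obtain Y where "compact Y" "\<And>y w. y \<in> B n \<Longrightarrow> w \<in> A m \<Longrightarrow> point_supp y w \<subseteq> Y"
      using compact_superset_point_supp[OF assms(2)[of n] assms(1)[of m]] by blast
    then show "\<exists>Y. compact Y \<and> (\<forall>y\<in>B n. \<forall>w\<in>A m. point_supp y w \<subseteq> Y)" by blast
  qed
  then obtain Y where Y: "\<And>n m. compact (Y n m)"
    "\<And>n m y w. y \<in> B n \<Longrightarrow> w \<in> A m \<Longrightarrow> point_supp y w \<subseteq> Y n m" by metis
  define E where "E i = invol -` B i \<union> (case prod_decode i of (n, m) \<Rightarrow> Y n m)" for i
  show thesis
  proof (rule that[of E])
    show "compact (E i)" for i unfolding E_def using Y(1) compact_invol_vimage[OF assms(2)]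
      by (intro compact_Un) (auto split: prod.split)
    show "(\<Union>n. invol -` B n) \<subseteq> (\<Union>n. E n)" by (auto simp: E_def)
    fix x y w assume "y \<in> (\<Union>n. invol -` B n)" "w \<in> (\<Union>n. A n)" and w: "w \<in> point_supp x y"
    then obtain n m where nm: "invol y \<in> B n" "w \<in> A m" by auto
    have "w \<in> point_supp (invol (invol y)) x" using w by (simp add: invol_invol conv_commute)
    then have "x \<in> point_supp (invol y) w" by (rule point_supp_cancel)
    then have "x \<in> Y n m" using Y(2)[OF nm] by blast
    then have "x \<in> E (prod_encode (n, m))" by (simp add: E_def)
    then show "x \<in> (\<Union>n. E n)" by blast
  qed
qed

lemma fun_conv_lorentz:
  fixes f \<phi> :: "'a \<Rightarrow> complex" and q0 q1 q2 :: ennreal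
  assumes p: "1 \<le> p1" "1 \<le> p2" "1 < 1 / p1 + 1 / p2" "1 / p0 = 1 / p1 + 1 / p2 - 1"
    and q: "1 \<le> q0" "1 \<le> q1" "1 \<le> q2" "1 / q0 \<le> 1 / q1 + 1 / q2"
    and f: "f \<in> lorentz_space M p1 q1" and \<phi>: "\<phi> \<in> lorentz_space M p2 q2"
  shows "(AE x in completion M. fun_conv_exists_at conv invol M f \<phi> x) \<and>
    fun_conv conv invol M f \<phi> \<in> lorentz_space M p0 q0 \<and>
    lorentz_norm M p0 q0 (fun_conv conv invol M f \<phi>)
      \<le> ennreal (3 * p0) * lorentz_norm M p1 q1 f * lorentz_norm M p2 q2 \<phi>"
proof -
  have fm: "f \<in> borel_measurable (completion M)" and \<phi>m: "\<phi> \<in> borel_measurable (completion M)"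
    using f \<phi> by (auto simp: lorentz_space_def)
  obtain f' and A :: "nat \<Rightarrow> 'a set" where f': "f' \<in> borel_measurable baire" "AE x in M. f x = f' x"
    and A: "\<And>n. compact (A n)" and f'0: "\<And>x. x \<notin> (\<Union>n. A n) \<Longrightarrow> f' x = 0"
    by (rule baire_approximation_complex[OF fm levels_finite_lorentz[OF f p(1) q(2)]]) (rule_tac that; assumption)
  obtain \<phi>' and B :: "nat \<Rightarrow> 'a set" where \<phi>': "\<phi>' \<in> borel_measurable baire" "AE x in M. \<phi> x = \<phi>' x"
    and B: "\<And>n. compact (B n)" and \<phi>'0: "\<And>x. x \<notin> (\<Union>n. B n) \<Longrightarrow> \<phi>' x = 0"
    by (rule baire_approximation_complex[OF \<phi>m levels_finite_lorentz[OF \<phi> p(2) q(3)]]) (rule_tac that; assumption)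
  obtain E :: "nat \<Rightarrow> 'a set" where E: "\<And>n. compact (E n)" and SG: "(\<Union>n. invol -` B n) \<subseteq> (\<Union>n. E n)"
    and product: "\<And>x y w. y \<in> (\<Union>n. invol -` B n) \<Longrightarrow> w \<in> (\<Union>n. A n) \<Longrightarrow> w \<in> point_supp x y \<Longrightarrow> x \<in> (\<Union>n. E n)"
    by (rule product_exhaustion[of A B, OF A B]) (rule_tac that; assumption)
  define Q where "Q = (\<Union>n. E n)"
  note exhaustion = E Q_def SG[folded Q_def] product[folded Q_def]
  have invm [measurable]: "invol \<in> borel_measurable borel"
    by (rule borel_measurable_continuous_onI[OF invol_continuous])
  have f'B [measurable]: "f' \<in> borel_measurable borel" and \<phi>'B [measurable]: "\<phi>' \<in> borel_measurable borel"
    using f'(1) \<phi>'(1) by (auto intro: measurable_baire_borel)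
  define F where "F w = ennreal (cmod (f' w))" for w
  define G where "G y = ennreal (cmod (\<phi>' (invol y)))" for y
  have F: "F \<in> borel_measurable baire" "\<And>w. w \<notin> (\<Union>n. A n) \<Longrightarrow> F w = 0"
    using f'(1) f'0 unfolding F_def by auto
  have FB [measurable]: "F \<in> borel_measurable borel" unfolding F_def by measurable
  have GB [measurable]: "G \<in> borel_measurable borel" unfolding G_def by measurable
  have G0: "\<And>y. y \<notin> (\<Union>n. invol -` B n) \<Longrightarrow> G y = 0" using \<phi>'0 unfolding G_def by auto
  have slF: "superlevel M F s = superlevel (completion M) (\<lambda>x. ennreal (cmod (f x))) s" for s
    by (rule superlevel_completion_AE_eq[symmetric]) (use fm f'(2) in \<open>auto simp: F_def\<close>)
  have slG: "superlevel M G s = superlevel (completion M) (\<lambda>x. ennreal (cmod (\<phi> x))) s" for s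
  proof -
    have "superlevel M G s = superlevel M (\<lambda>y. ennreal (cmod (\<phi>' y))) s"
      unfolding G_def by (rule superlevel_invol) measurable
    also have "\<dots> = superlevel (completion M) (\<lambda>x. ennreal (cmod (\<phi> x))) s"
      by (rule superlevel_completion_AE_eq[symmetric]) (use \<phi>m \<phi>'(2) in auto)
    finally show ?thesis .
  qed
  have liF: "level_integral M F (ennreal t) = ennreal t * max_rearrangement M f t"
    and liG: "level_integral M G (ennreal t) = ennreal t * max_rearrangement M \<phi> t" if "0 < t" for t
    using level_integral_max_rearrangement[OF fm that] level_integral_max_rearrangement[OF \<phi>m that]
    by (simp_all add: level_integral_def slF slG)
  have finF: "level_integral M F (ennreal t) < \<infinity>" and finG: "level_integral M G (ennreal t) < \<infinity>" if "0 < t" for t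
    using level_integral_lorentz_finite[OF f p(1) q(2) that] level_integral_lorentz_finite[OF \<phi> p(2) q(3) that]
    by (simp_all add: level_integral_def slF slG)
  have lfF: "levels_finite M F" and lfG: "levels_finite M G"
    using levels_finite_lorentz[OF f p(1) q(2)] levels_finite_lorentz[OF \<phi> p(2) q(3)]
    by (simp_all add: levels_finite_def slF slG)
  define K where "K t = (\<integral>\<^sup>+u\<in>{t..}. max_rearrangement M f u * max_rearrangement M \<phi> u \<partial>lborel)" for t
  have Kfin: "K t < \<infinity>" if "0 < t" for t
    unfolding K_def by (rule max_rearrangement_product_integral_finite[OF f \<phi> p(1) q(2) p(2) q(3) p(3) that])
  have ONeil: "\<exists>H b. H \<in> borel_measurable borel \<and> (\<forall>x. nn_conv F G x \<le> H x + b) \<and>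
      (\<integral>\<^sup>+x. H x \<partial>M) + ennreal t * b \<le> ennreal t * K t" if t: "0 < t" for t
  proof -
    have "(\<integral>\<^sup>+u\<in>{t..}. ennreal (1 / u\<^sup>2) * (level_integral M F (ennreal u) * level_integral M G (ennreal u)) \<partial>lborel) = K t"
      unfolding K_def
    \<comment> \<open>The two factors u of the level integrals cancel against u^(-2).\<close>
    proof (intro nn_integral_cong)
      fix u :: real
      have "ennreal (1 / u\<^sup>2) * (ennreal u * ennreal u) = 1" if "t \<le> u"
        using t that by (simp add: ennreal_mult[symmetric] power2_eq_square)
      then have "t \<le> u \<Longrightarrow> ennreal (1 / u\<^sup>2) * ((ennreal u * a) * (ennreal u * b)) = a * b" for a b
        by (metis (no_types, opaque_lifting) mult.assoc mult.left_commute mult.right_neutral mult.commute)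
      then show "ennreal (1 / u\<^sup>2) * (level_integral M F (ennreal u) * level_integral M G (ennreal u)) * indicator {t..} u =
         max_rearrangement M f u * max_rearrangement M \<phi> u * indicator {t..} u"
        using t by (auto simp: indicator_def liF liG)
    qed
    moreover have "\<exists>H b. H \<in> borel_measurable borel \<and> (\<forall>x. nn_conv F G x \<le> H x + b) \<and>
      (\<integral>\<^sup>+x. H x \<partial>M) + ennreal t * b \<le>
      ennreal t * (\<integral>\<^sup>+u\<in>{t..}. ennreal (1 / u\<^sup>2) * (level_integral M F (ennreal u) * level_integral M G (ennreal u)) \<partial>lborel)"
      by (rule nn_conv_ONeil[where E = E and Q = Q and SF = "\<Union>n. A n" and SG = "\<Union>n. invol -` B n"];
          fact exhaustion F lfF GB G0 lfG t finF[OF t] finG[OF t])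
    ultimately show ?thesis by (simp only:)
  qed
  \<comment> \<open>The four nonnegative parts of f', indexed so that measurability and finiteness
    are proved once for all of them.\<close>
  define R where "R i w = (if i = (0::nat) then ennreal (Re (f' w)) else if i = 1 then ennreal (- Re (f' w))
    else if i = 2 then ennreal (Im (f' w)) else ennreal (- Im (f' w)))" for i w
  have RB: "R i \<in> borel_measurable baire" for i using f'(1) unfolding R_def by simp
  have Rle: "R i w \<le> F w" for i w
    unfolding R_def F_def using abs_Re_le_cmod[of "f' w"] abs_Im_le_cmod[of "f' w"] by (auto intro!: ennreal_leI)
  have Rlf: "levels_finite M (R i)" for i by (rule levels_finite_mono[OF lfF]) (use Rle in auto)
  \<comment> \<open>A version of the translate of f that is built from nonnegative translates of
    Baire functions and hence Borel in y; for each x it agrees with the translate of f at almost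
    every y.\<close>
  define \<tau> where "\<tau> x y = Complex
    (enn2real (nn_translation (R 0) x y) - enn2real (nn_translation (R 1) x y))
    (enn2real (nn_translation (R 2) x y) - enn2real (nn_translation (R 3) x y))" for x y
  note [measurable] = nn_integral_translation(1)[OF measurable_baire_borel[OF RB] Rlf]
  have \<tau>m [measurable]: "\<tau> x \<in> borel_measurable borel" for x
    unfolding borel_measurable_complex_iff \<tau>_def by simp
  define g where "g x y = \<tau> x y * \<phi>' (invol y)" for x y
  have gm [measurable]: "g x \<in> borel_measurable borel" for x unfolding g_def by measurable
  have good: "AE y in M. integrable (completion (point_conv x y)) f \<and> translation conv x f y = \<tau> x y \<and>
      ennreal (cmod (\<tau> x y)) \<le> nn_translation F x y" for x
    using AE_translation_AE_eq[OF f'(2), of x] nn_translation_finite_AE[OF FB lfF finF[OF zero_less_one], of x]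
  proof eventually_elim
    case (elim y)
    have int': "integrable (point_conv x y) f'"
      using elim(2) unfolding F_def by (intro integrableI_bounded) auto
    have fc: "f \<in> borel_measurable (completion (point_conv x y))"
      using elim(1) by (rule measurable_completion_AE_eq[rotated]) simp
    have eq: "AE w in completion (point_conv x y). f w = f' w" by (rule AE_completion[OF elim(1)])
    have f'c: "f' \<in> borel_measurable (completion (point_conv x y))" by (rule measurable_completion) simp
    have "integrable (completion (point_conv x y)) f'" using int' by (simp add: integrable_completion)
    then have 1: "integrable (completion (point_conv x y)) f"
      using integrable_cong_AE[OF fc f'c eq] by simp
    have "translation conv x f y = (LINT w|completion (point_conv x y). f' w)"
      unfolding translation_def by (rule integral_cong_AE[OF fc f'c eq])
    also have "\<dots> = (LINT w|point_conv x y. f' w)" by (rule integral_completion) simp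
    finally have 2: "translation conv x f y = (LINT w|point_conv x y. f' w)" .
    have 3: "(LINT w|point_conv x y. f' w) = \<tau> x y"
      unfolding \<tau>_def R_def by (simp add: complex_integral_parts[OF int'])
    have "ennreal (cmod (LINT w|point_conv x y. f' w)) \<le> nn_translation F x y"
      unfolding F_def by (rule integral_norm_bound_ennreal[OF int'])
    then show ?case using 1 2 3 by simp
  qed
  have conv_eq: "AE y in M. translation conv x f y * \<phi> (invol y) = g x y" for x
    using good[of x] AE_invol[OF \<phi>'(2)] by eventually_elim (simp add: g_def)
  have conv_m: "(\<lambda>y. translation conv x f y * \<phi> (invol y)) \<in> borel_measurable (completion M)" for x
    by (rule measurable_completion_AE_eq[OF _ conv_eq]) simp
  have gc: "g x \<in> borel_measurable (completion M)" for x by (rule measurable_completion) simp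
  have fc_eq: "fun_conv conv invol M f \<phi> x = (LINT y|M. g x y)" for x
  proof -
    have "fun_conv conv invol M f \<phi> x = (LINT y|completion M. g x y)"
      unfolding fun_conv_def by (rule integral_cong_AE[OF conv_m gc AE_completion[OF conv_eq]])
    also have "\<dots> = (LINT y|M. g x y)" by (rule integral_completion) simp
    finally show ?thesis .
  qed
  have g_bound: "(\<integral>\<^sup>+y. ennreal (cmod (g x y)) \<partial>M) \<le> nn_conv F G x" for x
    unfolding nn_conv_def
  proof (rule nn_integral_mono_AE)
    show "AE y in M. ennreal (cmod (g x y)) \<le> nn_translation F x y * G y"
      using good[of x] by eventually_elim (auto simp: g_def G_def norm_mult ennreal_mult intro!: mult_right_mono)
  qed
  \<comment> \<open>This holds at every x: where \<open>g x\<close> is not integrable the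
    convolution is 0 by convention.\<close>
  have h_bound: "ennreal (cmod (fun_conv conv invol M f \<phi> x)) \<le> nn_conv F G x" for x
  proof (cases "integrable M (g x)")
    case True
    show ?thesis unfolding fc_eq using integral_norm_bound_ennreal[OF True] g_bound[of x] by (rule order.trans)
  qed (simp add: fc_eq not_integrable_integral_eq)
  have hB: "fun_conv conv invol M f \<phi> \<in> borel_measurable borel"
  proof -
    have QB [measurable]: "Q \<in> sets borel" by (rule Q_borel[OF exhaustion])
    interpret sigma_finite_measure "density M (indicator Q)" by (rule sigma_finite_restricted[OF exhaustion])
    \<comment> \<open>\<open>\<tau>\<close> cut down to Q \<times> Q. The indicator sits inside each
      of the four parts, where joint measurability is available.\<close>
    define \<tau>Q where "\<tau>Q z = Complex
      (enn2real (nn_translation (R 0) (fst z) (snd z) * indicator (Q \<times> Q) z) - enn2real (nn_translation (R 1) (fst z) (snd z) * indicator (Q \<times> Q) z))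
      (enn2real (nn_translation (R 2) (fst z) (snd z) * indicator (Q \<times> Q) z) - enn2real (nn_translation (R 3) (fst z) (snd z) * indicator (Q \<times> Q) z))" for z
    have RQm: "(\<lambda>z. enn2real (nn_translation (R i) (fst z) (snd z) * indicator (Q \<times> Q) z)) \<in> borel_measurable (borel \<Otimes>\<^sub>M borel)" for i
      unfolding Q_def by (intro borel_measurable_enn2real measurable_nn_integral_point_conv E RB)
    have \<tau>Qm: "\<tau>Q \<in> borel_measurable (borel \<Otimes>\<^sub>M borel)"
      unfolding borel_measurable_complex_iff \<tau>Q_def complex.sel by (intro conjI borel_measurable_diff RQm)
    have "(\<lambda>z. \<tau>Q z * \<phi>' (invol (snd z))) \<in> borel_measurable (borel \<Otimes>\<^sub>M borel)"
      using \<tau>Qm by measurable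
    then have "(\<lambda>(x, y). \<tau>Q (x, y) * \<phi>' (invol y)) \<in> borel_measurable (borel \<Otimes>\<^sub>M density M (indicator Q))"
      by (simp add: case_prod_unfold cong: measurable_cong_sets)
    from borel_measurable_lebesgue_integral[OF this]
    have "(\<lambda>x. LINT y|density M (indicator Q). \<tau>Q (x, y) * \<phi>' (invol y)) \<in> borel_measurable borel" .
    moreover have fe: "fun_conv conv invol M f \<phi> x = (LINT y|density M (indicator Q). \<tau>Q (x, y) * \<phi>' (invol y))" for x
    proof (cases "x \<in> Q")
      case False
      have "nn_conv F G x = 0"
        by (rule nn_conv_zero[where E = E and Q = Q and SF = "\<Union>n. A n" and SG = "\<Union>n. invol -` B n"];
          fact exhaustion F GB G0 False)
      then have "ennreal (cmod (fun_conv conv invol M f \<phi> x)) \<le> 0"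
        using h_bound[of x] by simp
      then show ?thesis using False by (simp add: \<tau>Q_def complex_eq_iff zero_complex.ctr[symmetric])
    next
      case True
      have "(\<lambda>y. \<tau>Q (x, y) * \<phi>' (invol y)) = (\<lambda>y. indicator Q y *\<^sub>R g x y)"
        using True by (auto simp: fun_eq_iff \<tau>Q_def g_def \<tau>_def indicator_def complex_eq_iff)
      \<comment> \<open>One indicator is to become the density of the restricted measure, the other
        stays in the integrand; both are harmless because \<phi>'(y~) vanishes off Q.\<close>
      moreover have "(LINT y|M. g x y) = (LINT y|M. indicator Q y *\<^sub>R (indicator Q y *\<^sub>R g x y))"
      proof (intro Bochner_Integration.integral_cong refl)
        fix y
        have "g x y = 0" if "y \<notin> Q"
          using that exhaustion(3) \<phi>'0[of "invol y"] by (auto simp: g_def)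
        then show "g x y = indicator Q y *\<^sub>R (indicator Q y *\<^sub>R g x y)" by (auto simp: indicator_def)
      qed
      moreover have "density M (indicator Q) = density M (\<lambda>y. ennreal (indicator Q y))"
        by (simp add: ennreal_indicator)
      ultimately show ?thesis
        unfolding fc_eq by (simp only:) (subst integral_density, auto)
    qed
    ultimately show ?thesis by (simp only: fe[abs_def])
  qed
  then have hm: "fun_conv conv invol M f \<phi> \<in> borel_measurable (completion M)"
    by (intro measurable_completion) simp
  have max_le: "max_rearrangement M (fun_conv conv invol M f \<phi>) t \<le> K t" if t: "0 < t" for t
  proof -
    obtain H b where H: "H \<in> borel_measurable borel" "\<And>x. nn_conv F G x \<le> H x + b"
      "(\<integral>\<^sup>+x. H x \<partial>M) + ennreal t * b \<le> ennreal t * K t" using ONeil[OF t] by blast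
    have Hc: "H \<in> borel_measurable (completion M)" using H(1) by (intro measurable_completion) simp
    have "level_integral (completion M) (\<lambda>x. ennreal (cmod (fun_conv conv invol M f \<phi> x))) (ennreal t) \<le>
      (\<integral>\<^sup>+x. H x \<partial>completion M) + ennreal t * b"
      using hm Hc order.trans[OF h_bound H(2)] by (intro level_integral_le_K_functional) auto
    also have "\<dots> \<le> ennreal t * K t" using H(3) by (simp add: nn_integral_completion)
    finally have "ennreal (1 / t) * level_integral (completion M) (\<lambda>x. ennreal (cmod (fun_conv conv invol M f \<phi> x))) (ennreal t)
       \<le> ennreal (1 / t) * (ennreal t * K t)" by (rule mult_left_mono) simp
    also have "\<dots> = K t" using t by (simp add: mult.assoc[symmetric] ennreal_mult[symmetric])
    finally show ?thesis by (simp add: max_rearrangement_level_integral[OF hm t])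
  qed
  have norm: "lorentz_norm M p0 q0 (fun_conv conv invol M f \<phi>)
      \<le> ennreal (3 * p0) * lorentz_norm M p1 q1 f * lorentz_norm M p2 q2 \<phi>"
    by (rule lorentz_norm_bilinear_bound[OF fm \<phi>m hm p q]) (use max_le in \<open>simp add: K_def\<close>)
  also have "\<dots> < \<infinity>" using f \<phi> by (auto simp: lorentz_space_def ennreal_mult_less_top)
  finally have mem: "fun_conv conv invol M f \<phi> \<in> lorentz_space M p0 q0"
    using hm by (simp add: lorentz_space_def)
  \<comment> \<open>The decomposition at t = 1 is enough: since \<open>K 1\<close> is finite,
    \<open>H\<close> is integrable and \<open>b\<close> is finite.\<close>
  have "AE x in M. nn_conv F G x < \<infinity>"
  proof -
    obtain H b where H: "H \<in> borel_measurable borel" "\<And>x. nn_conv F G x \<le> H x + b"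
      "(\<integral>\<^sup>+x. H x \<partial>M) + ennreal 1 * b \<le> ennreal 1 * K 1" using ONeil[OF zero_less_one] by blast
    have "(\<integral>\<^sup>+x. H x \<partial>M) + b \<le> K 1" using H(3) by simp
    then have fin: "(\<integral>\<^sup>+x. H x \<partial>M) + b < \<infinity>" using Kfin[OF zero_less_one] by (rule le_less_trans)
    then have "AE x in M. H x \<noteq> \<infinity>" using H(1) by (intro nn_integral_PInf_AE) auto
    then show ?thesis
    proof eventually_elim
      case (elim x)
      have "H x + b < \<infinity>" using elim fin by (simp add: less_top)
      with H(2)[of x] show ?case by (rule le_less_trans)
    qed
  qed
  then have "AE x in completion M. nn_conv F G x < \<infinity>" by (rule AE_completion)
  then have ex: "AE x in completion M. fun_conv_exists_at conv invol M f \<phi> x"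
  proof eventually_elim
    case (elim x)
    have "AE y in M. integrable (completion (point_conv x y)) f" using good[of x] by eventually_elim simp
    moreover have "integrable M (g x)"
      using le_less_trans[OF g_bound elim] by (intro integrableI_bounded) auto
    then have "integrable (completion M) (g x)" by (simp add: integrable_completion)
    then have "integrable (completion M) (\<lambda>y. translation conv x f y * \<phi> (invol y))"
      using integrable_cong_AE[OF conv_m gc AE_completion[OF conv_eq], of x] by simp
    ultimately show ?case unfolding fun_conv_exists_at_def by (auto intro: AE_completion)
  qed
  show ?thesis using ex mem norm by blast
qed

end

theorem theorem3p1:
  fixes conv :: "('a::t2_space set \<Rightarrow> complex) \<Rightarrow> ('a set \<Rightarrow> complex) \<Rightarrow> 'a set \<Rightarrow> complex"
    and e :: 'a
    and invol :: "'a \<Rightarrow> 'a"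
    and M :: "'a measure"
    and p0 p1 p2 :: real
    and q0 q1 q2 :: ennreal
    and f \<phi> :: "'a \<Rightarrow> complex"
  assumes "commutative_hypergroup conv e invol"
    and "haar_measure conv M"
    and "p1 \<ge> 1" and "p2 \<ge> 1" and "q1 \<ge> 1" and "q2 \<ge> 1"
    and "1 / p1 + 1 / p2 > 1"
    and "1 / p0 = 1 / p1 + 1 / p2 - 1"
    and "q0 \<ge> 1" and "1 / q1 + 1 / q2 \<ge> 1 / q0"
    and "f \<in> lorentz_space M p1 q1"
    and "\<phi> \<in> lorentz_space M p2 q2"
  shows "(AE x in completion M. fun_conv_exists_at conv invol M f \<phi> x) \<and>
    fun_conv conv invol M f \<phi> \<in> lorentz_space M p0 q0 \<and>
    lorentz_norm M p0 q0 (fun_conv conv invol M f \<phi>)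
      \<le> ennreal (3 * p0) * lorentz_norm M p1 q1 f * lorentz_norm M p2 q2 \<phi>"
proof -
  interpret commutative_hypergroup conv e invol by (rule assms(1))
  interpret haar_hypergroup conv e invol M by unfold_locales (rule assms(2))
  show ?thesis using assms by (intro fun_conv_lorentz)
qed

end
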